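(* Let $p$ be an odd prime and $S$ a finite $p$-group. Then every one of $I_o(S)$, $I_r(S)$, $I_e(S)$, $I_{\mathrm{lex}}(S)$, $I_{\mathrm{olex}}(S)$ and $I_{O,E,\zeta}(S)$ (for any fixed integers $O,E$ and any fixed sequence of integers $\zeta=(\zeta_1,\zeta_2,\dots)$) has the Glauberman property for $S$.
   Context: All groups are finite. $\mathfrak{Ab}(S)$ is the set of abelian subgroups of $S$. The rank of an abelian group is the size of its smallest generating set; the rank of a nonabelian $p$-group is the maximum of the ranks of its abelian subgroups. $\Omega_i(P)$ is the subgroup of a $p$-group $P$ generated by all elements of order $\leq p^i$, and for an abelian $p$-group $A$, $\omega_i(A):=|\Omega_i(A)|$. For sequences of integers, $\geq_{\mathrm{lex}}$ is the usual lexicographic order; when an abelian $p$-group $A$ appears on one side of $\geq_{\mathrm{lex}}$, it stands for the sequence $(\omega_1(A),\omega_2(A),\dots)$. Define: $\mathcal{A}_o(S)=\{A\in\mathfrak{Ab}(S): |A|\geq|A'|\text{ for all }A'\in\mathfrak{Ab}(S)\}$; $\mathcal{A}_r(S)=\{A\in\mathfrak{Ab}(S): \mathrm{rank}(A)=\mathrm{rank}(S)\}$; $\mathcal{A}_e(S)=\{A\in\mathcal{A}_r(S): A\text{ is elementary abelian}\}$; $\mathcal{A}_{\mathrm{lex}}(S)=\{A\in\mathfrak{Ab}(S): A\geq_{\mathrm{lex}}A'\text{ for all }A'\in\mathfrak{Ab}(S)\}$; $\mathcal{A}_{\mathrm{olex}}(S)=\{A\in\mathcal{A}_o(S): A\geq_{\mathrm{lex}}A'\text{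 for all }A'\in\mathcal{A}_o(S)\}$; $\mathcal{A}_{O,E,\zeta}(S)=\{A\in\mathfrak{Ab}(S): |A|=p^O,\ \mathrm{exponent}(A)\leq p^E,\ A\geq_{\mathrm{lex}}\zeta\}$. For each subscript, $I_{\cdots}(S)$ denotes the intersection of all members of $\mathcal{A}_{\cdots}(S)$, taken to be $1$ if $\mathcal{A}_{\cdots}(S)=\emptyset$. A subgroup of $S$ has the Glauberman property for $S$ if it is characteristic in every finite group $G$ satisfying: (a) $S$ is a Sylow $p$-subgroup of $G$; (b) $C_G(O_p(G))\leq O_p(G)$; (c) $G$ acts (by conjugation) $p$-stably on every normal $p$-subgroup of $G$. $O_p(G)$ is the largest normal $p$-subgroup of $G$. If $G$ acts on a $p$-group $P$, then $O_p(G\curvearrowright P)\trianglelefteq G$ denotes the preimage of $O_p(G/C_G(P))$ under the natural map $G\to G/C_G(P)$. An element $x\in G$ acts quadratically on $P$ if $[P,x,x]=1$, where $[P,x,x]=[[P,x],x]$ and commutators are $[w,x]=w^{-1}x^{-1}wx$ (in $P\rtimes G$). The action of $G$ on $P$ is $p$-stable if every element of $G$ that acts quadratically on $P$ lies in $O_p(G\curvearrowright P)$. *)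

theory Defs
  imports "HOL-Algebra.Algebra" "HOL-Library.Fun_Lexorder"
begin

section \<open>Finite \<open>p\<close>-groups\<close>

definition p_group :: "nat \<Rightarrow> ('a, 'm) monoid_scheme \<Rightarrow> bool" where
  "p_group p P \<longleftrightarrow> group P \<and> finite (carrier P) \<and> (\<exists>n. order P = p ^ n)"

definition sylow_subgroup :: "nat \<Rightarrow> 'a set \<Rightarrow> ('a, 'm) monoid_scheme \<Rightarrow> bool" where
  "sylow_subgroup p P G \<longleftrightarrow> subgroup P G \<and> card P = p ^ multiplicity p (order G)"

definition characteristic_subgroup :: "'a set \<Rightarrow> ('a, 'm) monoid_scheme \<Rightarrow> bool" where
  "characteristic_subgroup K G \<longleftrightarrow> subgroup K G \<and> (\<forall>f \<in> iso G G. f ` K = K)"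

definition centralizer :: "('a, 'm) monoid_scheme \<Rightarrow> 'a set \<Rightarrow> 'a set" where
  "centralizer G H = {g \<in> carrier G. \<forall>h \<in> H. g \<otimes>\<^bsub>G\<^esub> h = h \<otimes>\<^bsub>G\<^esub> g}"

definition p_core :: "nat \<Rightarrow> ('a, 'm) monoid_scheme \<Rightarrow> 'a set" where
  "p_core p G = (GREATEST N. N \<lhd> G \<and> p_group p (G\<lparr>carrier := N\<rparr>))"


section \<open>Invariants of abelian \<open>p\<close>-groups\<close>

definition abelian_rank :: "('a, 'm) monoid_scheme \<Rightarrow> nat" where
  "abelian_rank A =
     (LEAST n. \<exists>B \<subseteq> carrier A. finite B \<and> card B = n \<and> generate A B = carrier A)"

definition abelian_subgroups :: "('a, 'm) monoid_scheme \<Rightarrow> 'a set set" where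
  "abelian_subgroups S = {A. subgroup A S \<and> comm_group (S\<lparr>carrier := A\<rparr>)}"

definition p_group_rank :: "('a, 'm) monoid_scheme \<Rightarrow> nat" where
  "p_group_rank S =
     (if comm_group S then abelian_rank S
      else Max ((\<lambda>A. abelian_rank (S\<lparr>carrier := A\<rparr>)) ` abelian_subgroups S))"

definition group_exponent :: "('a, 'm) monoid_scheme \<Rightarrow> nat" where
  "group_exponent G = (LEAST n. 0 < n \<and> (\<forall>x \<in> carrier G. x [^]\<^bsub>G\<^esub> n = \<one>\<^bsub>G\<^esub>))"

definition elementary_abelian :: "nat \<Rightarrow> ('a, 'm) monoid_scheme \<Rightarrow> bool" where
  "elementary_abelian p A \<longleftrightarrow>
     comm_group A \<and> p_group p A \<and> (\<forall>x \<in> carrier A. x [^]\<^bsub>A\<^esub> p = \<one>\<^bsub>A\<^esub>)"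

definition Omega :: "nat \<Rightarrow> nat \<Rightarrow> ('a, 'm) monoid_scheme \<Rightarrow> 'a set" where
  "Omega p i P = generate P {x \<in> carrier P. group.ord P x \<le> p ^ i}"

text \<open>
  A sequence of integers \<open>(\<zeta>\<^sub>1, \<zeta>\<^sub>2, \<dots>)\<close> is a function on \<^typ>\<open>nat\<close> whose value at \<open>i\<close> is
  \<open>\<zeta>\<^bsub>i+1\<^esub>\<close>; thus position \<open>i\<close> of the sequence of \<open>A\<close> holds \<open>|\<Omega>\<^bsub>i+1\<^esub>(A)|\<close>.
\<close>

definition omega_seq :: "nat \<Rightarrow> ('a, 'm) monoid_scheme \<Rightarrow> nat \<Rightarrow> int" where
  "omega_seq p A = (\<lambda>i. int (card (Omega p (Suc i) A)))"

definition lex_ge :: "(nat \<Rightarrow> int) \<Rightarrow> (nat \<Rightarrow> int) \<Rightarrow> bool" where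
  "lex_ge f g \<longleftrightarrow> f = g \<or> Fun_Lexorder.less_fun g f"


section \<open>The families of abelian subgroups and their intersections\<close>

definition A_o :: "('a, 'm) monoid_scheme \<Rightarrow> 'a set set" where
  "A_o S = {A \<in> abelian_subgroups S. \<forall>A' \<in> abelian_subgroups S. card A \<ge> card A'}"

definition A_r :: "('a, 'm) monoid_scheme \<Rightarrow> 'a set set" where
  "A_r S = {A \<in> abelian_subgroups S. p_group_rank (S\<lparr>carrier := A\<rparr>) = p_group_rank S}"

definition A_e :: "nat \<Rightarrow> ('a, 'm) monoid_scheme \<Rightarrow> 'a set set" where
  "A_e p S = {A \<in> A_r S. elementary_abelian p (S\<lparr>carrier := A\<rparr>)}"

definition A_lex :: "nat \<Rightarrow> ('a, 'm) monoid_scheme \<Rightarrow> 'a set set" where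
  "A_lex p S = {A \<in> abelian_subgroups S. \<forall>A' \<in> abelian_subgroups S.
     lex_ge (omega_seq p (S\<lparr>carrier := A\<rparr>)) (omega_seq p (S\<lparr>carrier := A'\<rparr>))}"

definition A_olex :: "nat \<Rightarrow> ('a, 'm) monoid_scheme \<Rightarrow> 'a set set" where
  "A_olex p S = {A \<in> A_o S. \<forall>A' \<in> A_o S.
     lex_ge (omega_seq p (S\<lparr>carrier := A\<rparr>)) (omega_seq p (S\<lparr>carrier := A'\<rparr>))}"

text \<open>
  The integers \<open>ord_exp\<close> and \<open>exp_bound\<close> may be negative, so the powers of \<open>p\<close> are taken in the reals.
\<close>

definition A_OEz :: "nat \<Rightarrow> int \<Rightarrow> int \<Rightarrow> (nat \<Rightarrow> int) \<Rightarrow> ('a, 'm) monoid_scheme \<Rightarrow> 'a set set" where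
  "A_OEz p ord_exp exp_bound \<zeta> S = {A \<in> abelian_subgroups S.
     real (card A) = real p powi ord_exp \<and>
     real (group_exponent (S\<lparr>carrier := A\<rparr>)) \<le> real p powi exp_bound \<and>
     lex_ge (omega_seq p (S\<lparr>carrier := A\<rparr>)) \<zeta>}"

definition family_inter :: "('a, 'm) monoid_scheme \<Rightarrow> 'a set set \<Rightarrow> 'a set" where
  "family_inter S \<A> = (if \<A> = {} then {\<one>\<^bsub>S\<^esub>} else \<Inter>\<A>)"

definition "I_o S = family_inter S (A_o S)"
definition "I_r S = family_inter S (A_r S)"
definition "I_e p S = family_inter S (A_e p S)"
definition "I_lex p S = family_inter S (A_lex p S)"
definition "I_olex p S = family_inter S (A_olex p S)"
definition "I_OEz p ord_exp exp_bound \<zeta> S = family_inter S (A_OEz p ord_exp exp_bound \<zeta> S)"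


section \<open>\<open>p\<close>-stable actions\<close>

text \<open>
  An action of \<open>G\<close> on \<open>P\<close> is a homomorphism \<open>\<phi>\<close> from \<open>G\<close> to the automorphisms of \<open>P\<close>, so that
  \<open>x w x\<^sup>-\<^sup>1 = \<phi> x w\<close> in the semidirect product of \<open>P\<close> by \<open>G\<close>.  There
  \<open>[w, x] = w\<^sup>-\<^sup>1 (x\<^sup>-\<^sup>1 w x) = w\<^sup>-\<^sup>1 \<cdot> \<phi> (x\<^sup>-\<^sup>1) w\<close>, which is again an element of \<open>P\<close>.
\<close>

definition act_commutator ::
  "('g, 'm) monoid_scheme \<Rightarrow> ('a, 'n) monoid_scheme \<Rightarrow> ('g \<Rightarrow> 'a \<Rightarrow> 'a) \<Rightarrow> 'a \<Rightarrow> 'g \<Rightarrow> 'a" where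
  "act_commutator G P \<phi> w x = inv\<^bsub>P\<^esub> w \<otimes>\<^bsub>P\<^esub> \<phi> (inv\<^bsub>G\<^esub> x) w"

definition act_commutator_subgroup ::
  "('g, 'm) monoid_scheme \<Rightarrow> ('a, 'n) monoid_scheme \<Rightarrow> ('g \<Rightarrow> 'a \<Rightarrow> 'a) \<Rightarrow> 'a set \<Rightarrow> 'g \<Rightarrow> 'a set" where
  "act_commutator_subgroup G P \<phi> W x = generate P ((\<lambda>w. act_commutator G P \<phi> w x) ` W)"

definition acts_quadratically ::
  "('g, 'm) monoid_scheme \<Rightarrow> ('a, 'n) monoid_scheme \<Rightarrow> ('g \<Rightarrow> 'a \<Rightarrow> 'a) \<Rightarrow> 'g \<Rightarrow> bool" where
  "acts_quadratically G P \<phi> x \<longleftrightarrow>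
     act_commutator_subgroup G P \<phi> (act_commutator_subgroup G P \<phi> (carrier P) x) x = {\<one>\<^bsub>P\<^esub>}"

definition act_centralizer ::
  "('g, 'm) monoid_scheme \<Rightarrow> ('a, 'n) monoid_scheme \<Rightarrow> ('g \<Rightarrow> 'a \<Rightarrow> 'a) \<Rightarrow> 'g set" where
  "act_centralizer G P \<phi> = {g \<in> carrier G. \<forall>w \<in> carrier P. \<phi> g w = w}"

definition act_p_core ::
  "nat \<Rightarrow> ('g, 'm) monoid_scheme \<Rightarrow> ('a, 'n) monoid_scheme \<Rightarrow> ('g \<Rightarrow> 'a \<Rightarrow> 'a) \<Rightarrow> 'g set" where
  "act_p_core p G P \<phi> =
     {g \<in> carrier G. act_centralizer G P \<phi> #>\<^bsub>G\<^esub> g \<in> p_core p (G Mod act_centralizer G P \<phi>)}"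

definition p_stable_action ::
  "nat \<Rightarrow> ('g, 'm) monoid_scheme \<Rightarrow> ('a, 'n) monoid_scheme \<Rightarrow> ('g \<Rightarrow> 'a \<Rightarrow> 'a) \<Rightarrow> bool" where
  "p_stable_action p G P \<phi> \<longleftrightarrow>
     (\<forall>x \<in> carrier G. acts_quadratically G P \<phi> x \<longrightarrow> x \<in> act_p_core p G P \<phi>)"

definition conj_action :: "('g, 'm) monoid_scheme \<Rightarrow> 'g \<Rightarrow> 'g \<Rightarrow> 'g" where
  "conj_action G g w = g \<otimes>\<^bsub>G\<^esub> w \<otimes>\<^bsub>G\<^esub> inv\<^bsub>G\<^esub> g"


section \<open>The Glauberman property\<close>

text \<open>
  The overgroups \<open>G\<close> of \<open>S\<close> range over the finite groups on an arbitrary type \<open>'g\<close>, and \<open>S\<close> is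
  regarded as a subgroup of \<open>G\<close> along an injective homomorphism \<open>\<phi>\<close>; a literal inclusion is
  the case in which \<open>\<phi>\<close> is the identity map.  HOL cannot quantify over \<open>'g\<close> inside a formula, so it
  appears as a type argument.  Every finite group is isomorphic to one on \<^typ>\<open>nat\<close>, so already
  the instance \<open>'g = nat\<close> covers all finite overgroups.
\<close>

definition glauberman_property :: "'g itself \<Rightarrow> nat \<Rightarrow> 'a monoid \<Rightarrow> 'a set \<Rightarrow> bool" where
  "glauberman_property T p S K \<longleftrightarrow> subgroup K S \<and>
     (\<forall>(G :: 'g monoid) \<phi>.
        group G \<and> finite (carrier G) \<and> \<phi> \<in> mon S G \<and>
        sylow_subgroup p (\<phi> ` carrier S) G \<and>
        centralizer G (p_core p G) \<subseteq> p_core p G \<and>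
        (\<forall>P. P \<lhd> G \<and> p_group p (G\<lparr>carrier := P\<rparr>) \<longrightarrow>
           p_stable_action p G (G\<lparr>carrier := P\<rparr>) (conj_action G))
        \<longrightarrow> characteristic_subgroup (\<phi> ` K) G)"

end

theory Submission
  imports Defs
begin

text \<open>
  Each of the six families \<open>\<A>\<close> is closed under passing from \<open>A\<close> to an abelian subgroup \<open>D\<close> of \<open>S\<close>
  with \<open>|D| = |A|\<close> and at least as many solutions of \<open>x\<^sup>n = 1\<close> as \<open>A\<close> for every \<open>n\<close>
  (\<open>torsion_le\<close>).  This is the only property of \<open>\<A>\<close> that matters.  It makes \<open>\<A>\<close> invariant under
  isomorphisms of abelian subgroups, and it makes \<open>\<A>\<close> closed under a form of Glauberman's
  replacement: if \<open>A\<close> normalises \<open>B\<close>, the commutators of \<open>B\<close> are central in \<open>B\<close> and lie in \<open>A\<close>, and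
  \<open>B\<close> does not normalise \<open>A\<close>, choose \<open>x \<in> B - N\<^sub>B(A)\<close> with \<open>[x, A] \<subseteq> N\<^sub>B(A)\<close>.  For odd \<open>p\<close> the map
  \<open>a \<mapsto> [x, a]\<close> can be corrected to a homomorphism \<open>h : A \<rightarrow> B\<close>, and
  \<open>D = {a \<in> A. h a \<in> A} \<cdot> h(A)\<close> is abelian, normalises \<open>A\<close>, satisfies \<open>torsion_le A D\<close> and meets
  \<open>B\<close> in more than \<open>A \<inter> B\<close>.

  With \<open>Z = \<Inter>\<A>\<close>, the quadratic action of \<open>Z\<close> on \<open>O\<^sub>p(G)\<close> gives \<open>Z \<le> O\<^sub>p(G)\<close>, and \<open>Z \<inter> B\<close> is normal for
  every normal \<open>p\<close>-subgroup \<open>B\<close> by induction on \<open>|B|\<close>.  One may assume that \<open>B\<close> is the normal closure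
  of \<open>Z \<inter> B\<close>; then \<open>[B, B]\<close> lies in \<open>Z\<close> and is central in \<open>B\<close>.  Let \<open>L\<close> be the largest normal subgroup
  normalising \<open>Z \<inter> B\<close>.  By \<open>p\<close>-stability \<open>L\<close> contains every \<open>A \<in> \<A>\<close> that is normalised by \<open>B\<close>, and by
  Sylow's theorem in \<open>L\<close> every \<open>D \<in> \<A>\<close> inside \<open>L\<close> contains \<open>B\<close>.  An \<open>A \<in> \<A>\<close> outside \<open>L\<close> with \<open>A \<inter> B\<close>
  maximal would then have a replacement \<open>D \<le> L\<close>, so \<open>B \<le> D\<close> would normalise \<open>A\<close>.  Hence all of \<open>\<A>\<close>
  lies in \<open>L\<close>, and \<open>B \<le> Z\<close>.
\<close>

section \<open>Actions of \<open>p\<close>-groups and Sylow subgroups\<close>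

text \<open>Every stabiliser contains \<open>C\<close>, so \<open>card C\<close> cancels in the
  orbit-stabiliser formula and each orbit length divides \<open>p^n\<close>. Orbits of non-fixed
  points are longer than 1, hence of length divisible by \<open>p\<close>.\<close>

lemma fixed_points_mod_prime:
  assumes H: "group H" and p: "Factorial_Ring.prime p"
    and C: "subgroup C H" and ord: "order H = p ^ n * card C"
    and fin: "finite E"
    and closed: "\<And>h e. h \<in> carrier H \<Longrightarrow> e \<in> E \<Longrightarrow> act h e \<in> E"
    and one: "\<And>e. e \<in> E \<Longrightarrow> act \<one>\<^bsub>H\<^esub> e = e"
    and mult: "\<And>g h e. g \<in> carrier H \<Longrightarrow> h \<in> carrier H \<Longrightarrow> e \<in> E \<Longrightarrow>
                 act (g \<otimes>\<^bsub>H\<^esub> h) e = act g (act h e)"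
    and triv: "\<And>c e. c \<in> C \<Longrightarrow> e \<in> E \<Longrightarrow> act c e = e"
    and finH: "finite (carrier H)"
  shows "card {e \<in> E. \<forall>h \<in> carrier H. act h e = e} mod p = card E mod p"
proof -
  interpret H: group H by fact
  let ?F = "{e \<in> E. \<forall>h \<in> carrier H. act h e = e}"
  define \<phi> where "\<phi> = (\<lambda>h. restrict (act h) E)"
  have bij: "bij_betw (act h) E E" if h: "h \<in> carrier H" for h
  proof (rule bij_betw_byWitness[where f' = "act (inv\<^bsub>H\<^esub> h)"])
    show "\<forall>a\<in>E. act (inv\<^bsub>H\<^esub> h) (act h a) = a"
      using h mult[of "inv\<^bsub>H\<^esub> h" h] one by simp
    show "\<forall>a\<in>E. act h (act (inv\<^bsub>H\<^esub> h) a) = a"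
      using h mult[of h "inv\<^bsub>H\<^esub> h"] one by simp
  qed (use h closed in auto)
  have "group_action H E \<phi>"
    unfolding group_action_def group_hom_def group_hom_axioms_def
  proof (intro conjI H group_BijGroup homI)
    show "\<phi> h \<in> carrier (BijGroup E)" if "h \<in> carrier H" for h
      using bij[OF that] by (auto simp: \<phi>_def BijGroup_def Bij_def bij_betw_def inj_on_def)
    have Bij: "\<phi> h \<in> Bij E" if "h \<in> carrier H" for h
      using bij[OF that] by (auto simp: \<phi>_def Bij_def bij_betw_def inj_on_def)
    show "\<phi> (g \<otimes>\<^bsub>H\<^esub> h) = \<phi> g \<otimes>\<^bsub>BijGroup E\<^esub> \<phi> h"
      if gh: "g \<in> carrier H" "h \<in> carrier H" for g h
    proof -
      have "\<phi> (g \<otimes>\<^bsub>H\<^esub> h) = compose E (\<phi> g) (\<phi> h)"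
        unfolding \<phi>_def compose_def
        by (rule restrict_ext) (simp add: mult gh closed)
      then show ?thesis using Bij[OF gh(1)] Bij[OF gh(2)] by (simp add: BijGroup_def)
    qed
  qed
  then interpret act: group_action H E \<phi> .
  \<comment> \<open>The indicator of the non-fixed points: summed over \<open>E\<close> it counts
    them, and each orbit contributes a multiple of \<open>p\<close>.\<close>
  let ?f = "\<lambda>x. if x \<in> ?F then 0 else (1::nat)"
  have dvd: "p dvd (\<Sum>x\<in>orb. ?f x)" if orb: "orb \<in> orbits H E \<phi>" for orb
  proof -
    obtain x where x: "x \<in> E" "orb = orbit H \<phi> x"
      using orb by (auto simp: orbits_def)
    have orb_eq: "orb = (\<lambda>g. act g x) ` carrier H"
      using x by (auto simp: orbit_def \<phi>_def)
    show ?thesis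
    proof (cases "x \<in> ?F")
      case True
      then have "orb = {x}" using orb_eq H.one_closed by auto
      then show ?thesis using True by simp
    next
      case False
      have nF: "y \<notin> ?F" if y_orb: "y \<in> orb" for y
      proof
        assume y: "y \<in> ?F"
        obtain g where g: "g \<in> carrier H" "y = act g x" using y_orb unfolding orb_eq by blast
        have "x = act (inv\<^bsub>H\<^esub> g) y"
          using g x mult[of "inv\<^bsub>H\<^esub> g" g x] one by simp
        also have "\<dots> = y" using y g by simp
        finally show False using y False by simp
      qed
      have "(\<Sum>z\<in>orb. ?f z) = (\<Sum>z\<in>orb. 1)"
        by (rule sum.cong) (simp_all only: nF if_False)
      then have sum: "(\<Sum>z\<in>orb. ?f z) = card orb" by simp
      have st: "subgroup (stabilizer H \<phi> x) H" by (rule act.stabilizer_subgroup[OF x(1)])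
      have Cst: "C \<subseteq> stabilizer H \<phi> x"
        using triv x C by (auto simp: stabilizer_def \<phi>_def subgroup.mem_carrier)
      have "subgroup C (H\<lparr>carrier := stabilizer H \<phi> x\<rparr>)"
        using H.subgroup_incl[OF C st Cst] .
      moreover have "finite (stabilizer H \<phi> x)"
        using finH by (simp add: stabilizer_def)
      ultimately have "card C dvd card (stabilizer H \<phi> x)"
        using group.lagrange[OF H.subgroup_imp_group[OF st], of C]
        by (simp add: order_def) (metis dvd_triv_right)
      then obtain k where k: "card (stabilizer H \<phi> x) = card C * k" by auto
      have "card orb * (card C * k) = p ^ n * card C"
        using act.orbit_stabilizer_theorem[OF x(1)] k ord x by simp
      moreover have "card C \<noteq> 0"
        using subgroup.finite_imp_card_positive[OF C finH] by simp
      ultimately have "card orb * k = p ^ n" by simp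
      then have "card orb dvd p ^ n" by (metis dvd_triv_left)
      then obtain i where i: "card orb = p ^ i" using p by (metis divides_primepow_nat)
      have "card orb \<noteq> 1"
      proof
        assume "card orb = 1"
        then obtain y where y: "orb = {y}" by (auto simp: card_1_singleton_iff)
        have "x \<in> orb" using orb_eq one[OF x(1)] H.one_closed by force
        then have "orb = {x}" using y by auto
        then show False using False x orb_eq by auto
      qed
      then have "p dvd card orb" using i by (cases i) auto
      then show ?thesis using sum by simp
    qed
  qed
  have "(\<Sum>x\<in>E. ?f x) = (\<Sum>orb\<in>orbits H E \<phi>. \<Sum>x\<in>orb. ?f x)"
    using act.disjoint_sum[OF fin, of ?f] by simp
  then have "p dvd (\<Sum>x\<in>E. ?f x)" using dvd by (simp add: dvd_sum)
  also have "(\<Sum>x\<in>E. ?f x) = card (E - ?F)"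
  proof -
    have "(\<Sum>x\<in>E. ?f x) = (\<Sum>x\<in>E - ?F. ?f x)"
      by (rule sum.mono_neutral_right) (use fin in auto)
    also have "\<dots> = (\<Sum>x\<in>E - ?F. 1)" by (rule sum.cong) auto
    finally show ?thesis by simp
  qed
  finally obtain k where k: "card (E - ?F) = p * k" by (rule dvdE)
  have "card E = card ?F + card (E - ?F)"
  proof -
    have "?F \<union> (E - ?F) = E" "?F \<inter> (E - ?F) = {}" "finite ?F" "finite (E - ?F)" using fin by auto
    then show ?thesis using card_Un_disjoint[of ?F "E - ?F"] by (simp only:)
  qed
  then have "card E = card ?F + p * k" unfolding k .
  then show ?thesis by (simp only: mod_mult_self2)
qed

lemma p_group_carrier_iff:
  "p_group p (G\<lparr>carrier := P\<rparr>) \<longleftrightarrow> group (G\<lparr>carrier := P\<rparr>) \<and> finite P \<and> (\<exists>n. card P = p ^ n)"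
  by (simp add: p_group_def order_def)

text \<open>Applied to indices: \<open>k\<close> is the number of cosets or conjugates left after
  the full \<open>p\<close>-part of the group order has been split off.\<close>

lemma not_dvd_of_mult_multiplicity_dvd:
  fixes k m p :: nat
  assumes p: "Factorial_Ring.prime p" and d: "k * p ^ multiplicity p m dvd m" and m: "0 < m"
  shows "\<not> p dvd k"
proof
  assume "p dvd k"
  then have "p ^ Suc (multiplicity p m) dvd m"
    using dvd_trans[OF mult_dvd_mono[OF _ dvd_refl] d, of p] by simp
  then have "Suc (multiplicity p m) \<le> multiplicity p m"
    using p m by (intro multiplicity_geI) auto
  then show False by simp
qed

section \<open>Cosets, conjugation into a Sylow subgroup, and fixed cosets\<close>

context group
begin

lemma lagrange_subgroups:
  assumes "subgroup H G" "subgroup K G" "H \<subseteq> K"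
  shows "card (rcosets\<^bsub>G\<lparr>carrier := K\<rparr>\<^esub> H) * card H = card K"
  using group.lagrange[OF subgroup_imp_group[OF assms(2)] subgroup_incl[OF assms]]
  by (simp add: order_def)

lemma card_subgroups_dvd:
  assumes "subgroup H G" "subgroup K G" "H \<subseteq> K"
  shows "card H dvd card K"
  using lagrange_subgroups[OF assms] by (metis dvd_triv_right)

lemma rcosets_subgroup_eq: "rcosets\<^bsub>G\<lparr>carrier := K\<rparr>\<^esub> H = (\<lambda>x. H #> x) ` K"
  by (auto simp: RCOSETS_def r_coset_def)

lemma free_cancel:
  assumes "x \<in> carrier G" "y \<in> carrier G"
  shows "inv x \<otimes> (x \<otimes> y) = y" "x \<otimes> (inv x \<otimes> y) = y"
  using assms by (simp_all add: m_assoc[symmetric])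

lemma r_coset_eq_iff:
  assumes "subgroup H G" "x \<in> carrier G" "y \<in> carrier G"
  shows "H #> x = H #> y \<longleftrightarrow> x \<otimes> inv y \<in> H"
proof
  assume "H #> x = H #> y"
  then have "x \<in> H #> y" using rcos_self[OF assms(2,1)] by simp
  then obtain h where "h \<in> H" "x = h \<otimes> y" by (auto simp: r_coset_def)
  then show "x \<otimes> inv y \<in> H"
    using assms by (simp add: m_assoc subgroup.mem_carrier)
next
  assume "x \<otimes> inv y \<in> H"
  moreover have "x = x \<otimes> inv y \<otimes> y" using assms by (simp add: m_assoc)
  ultimately have "x \<in> H #> y" unfolding r_coset_def by blast
  then show "H #> x = H #> y" using repr_independence[of x H y] assms by simp
qed

text \<open>\<open>P\<close> permutes the right cosets of \<open>S\<close> in \<open>S L\<close> by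
  right multiplication. Their number is prime to \<open>p\<close>, so some coset \<open>S l\<close>
  is fixed, and \<open>S l x = S l\<close> says that \<open>l x l^-1\<close> lies in
  \<open>S\<close>. The case where \<open>L\<close> is the whole group is the usual Sylow
  conjugacy.\<close>

lemma ex_conj_into_sylow:
  assumes fin: "finite (carrier G)" and p: "Factorial_Ring.prime p"
    and S: "sylow_subgroup p S G" and L: "L \<lhd> G"
    and P: "subgroup P G" "P \<subseteq> L" "card P = p ^ n"
  shows "\<exists>l\<in>L. \<forall>x\<in>P. l \<otimes> x \<otimes> inv l \<in> S"
proof -
  have SG: "subgroup S G" and cS: "card S = p ^ multiplicity p (order G)"
    using S by (auto simp: sylow_subgroup_def)
  have LG: "subgroup L G" using L by (rule normal_imp_subgroup)
  note Lc = subgroup.mem_carrier[OF LG] and Sc = subgroup.mem_carrier[OF SG]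
    and Pc = subgroup.mem_carrier[OF P(1)]
  \<comment> \<open>Every coset of \<open>S\<close> in \<open>S L\<close> has a representative in
    \<open>L\<close>; this is what puts the conjugating element into \<open>L\<close>.\<close>
  define T where "T = S <#> L"
  have T: "subgroup T G"
    unfolding T_def using mult_norm_subgroup[OF L SG] commut_normal[OF SG L] by simp
  have ST: "S \<subseteq> T" unfolding T_def set_mult_def using subgroup.one_closed[OF LG] Sc by force
  have LT: "L \<subseteq> T" unfolding T_def set_mult_def using subgroup.one_closed[OF SG] Lc by force
  note Tc = subgroup.mem_carrier[OF T]
  define E where "E = (\<lambda>x. S #> x) ` T"
  have finT: "finite T" using fin T by (meson finite_subset subgroup.subset)
  have finE: "finite E" unfolding E_def using finT by simp
  have "card E * card S = card T"
    using lagrange_subgroups[OF SG T ST] by (simp add: E_def rcosets_subgroup_eq)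
  moreover have "card T dvd order G" using lagrange[OF T] by (metis dvd_triv_right)
  ultimately have d: "card E * p ^ multiplicity p (order G) dvd order G" using cS by simp
  have npE: "\<not> p dvd card E"
    using not_dvd_of_mult_multiplicity_dvd[OF p d] fin order_gt_0_iff_finite by simp
  let ?H = "G\<lparr>carrier := P\<rparr>"
  let ?act = "\<lambda>h e. e #> inv h"
  have "card {e \<in> E. \<forall>h \<in> carrier ?H. ?act h e = e} mod p = card E mod p"
  proof (rule fixed_points_mod_prime[where n = n and C = "{\<one>}"])
    show "subgroup {\<one>} ?H"
      using group.triv_subgroup[OF subgroup_imp_group[OF P(1)]] by simp
    show "order ?H = p ^ n * card {\<one>}" using P by (simp add: order_def)
    show "?act h e \<in> E" if he: "h \<in> carrier ?H" "e \<in> E" for h e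
    proof -
      obtain x where x: "x \<in> T" "e = S #> x" using he by (auto simp: E_def)
      have h: "h \<in> T" using he P LT by auto
      have "e #> inv h = S #> (x \<otimes> inv h)"
        using x h Tc SG by (simp add: coset_mult_assoc subgroup.subset)
      then show ?thesis unfolding E_def using x h T by (simp add: subgroup.m_closed subgroup.m_inv_closed)
    qed
    have Esub: "e \<subseteq> carrier G" if "e \<in> E" for e
      using that SG Tc by (auto simp: E_def r_coset_def Sc)
    show "?act \<one>\<^bsub>?H\<^esub> e = e" if "e \<in> E" for e using Esub[OF that] by simp
    show "?act (g \<otimes>\<^bsub>?H\<^esub> h) e = ?act g (?act h e)"
      if "g \<in> carrier ?H" "h \<in> carrier ?H" "e \<in> E" for g h e
      using that Esub[of e] Pc by (simp add: coset_mult_assoc inv_mult_group)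
    show "?act c e = e" if "c \<in> {\<one>}" "e \<in> E" for c e using that Esub[of e] by simp
    show "finite (carrier ?H)" using P finT LT by (auto intro: finite_subset)
  qed (use p finE subgroup_imp_group[OF P(1)] in auto)
  then have "card {e \<in> E. \<forall>h \<in> carrier ?H. ?act h e = e} \<noteq> 0"
    using npE by (metis dvd_eq_mod_eq_0 mod_0)
  then have "{e \<in> E. \<forall>h \<in> carrier ?H. ?act h e = e} \<noteq> {}" by (metis card.empty)
  then obtain e where e: "e \<in> E" "\<forall>h\<in>P. e #> inv h = e" by auto
  then obtain t where t: "t \<in> T" "e = S #> t" by (auto simp: E_def)
  then obtain s l where sl: "s \<in> S" "l \<in> L" "t = s \<otimes> l" by (auto simp: T_def set_mult_def)
  have el: "e = S #> l"
    using t sl SG Sc Lc by (simp add: coset_join2 coset_mult_assoc[symmetric] subgroup.subset)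
  show ?thesis
  proof (intro bexI[OF _ sl(2)] ballI)
    fix x assume x: "x \<in> P"
    have "S #> (l \<otimes> inv (inv x)) = S #> l #> inv (inv x)"
      using x Lc Pc sl subgroup.subset[OF SG] by (simp add: coset_mult_assoc)
    also have "\<dots> = S #> l" using e(2) subgroup.m_inv_closed[OF P(1) x] el by simp
    finally have "S #> (l \<otimes> inv (inv x)) = S #> l" .
    then show "l \<otimes> x \<otimes> inv l \<in> S"
      using r_coset_eq_iff[OF SG, of "l \<otimes> x" l] x Lc Pc sl by simp
  qed
qed

text \<open>\<open>A\<close> acts by conjugation on the cosets of \<open>N\<close> in
  \<open>B\<close>. Their number is a power of \<open>p\<close> greater than 1 and the coset
  \<open>N\<close> is fixed, so a second coset \<open>N x\<close> is fixed as well. Then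
  \<open>N (a x a^-1) = N x\<close> for all \<open>a\<close>, which puts
  \<open>x a x^-1 a^-1\<close> into \<open>N\<close>.\<close>

lemma ex_commutators_in_subgroup:
  assumes fin: "finite (carrier G)" and p: "Factorial_Ring.prime p"
    and A: "subgroup A G" "card A = p ^ n" and B: "subgroup B G" "card B = p ^ m"
    and N: "subgroup N G" "N \<subset> B"
    and AN: "\<And>a x. a \<in> A \<Longrightarrow> x \<in> N \<Longrightarrow> a \<otimes> x \<otimes> inv a \<in> N"
    and AB: "\<And>a x. a \<in> A \<Longrightarrow> x \<in> B \<Longrightarrow> a \<otimes> x \<otimes> inv a \<in> B"
  shows "\<exists>x\<in>B - N. \<forall>a\<in>A. x \<otimes> a \<otimes> inv x \<otimes> inv a \<in> N"
proof -
  note Ac = subgroup.mem_carrier[OF A(1)] and Bc = subgroup.mem_carrier[OF B(1)]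
    and Nc = subgroup.mem_carrier[OF N(1)]
  define E where "E = (\<lambda>x. N #> x) ` B"
  have finB: "finite B" using fin B by (meson finite_subset subgroup.subset)
  have finE: "finite E" unfolding E_def using finB by simp
  have c: "card E * card N = p ^ m"
    using lagrange_subgroups[OF N(1) B(1)] N(2) B(2) by (simp add: E_def rcosets_subgroup_eq)
  have pE: "p dvd card E"
  proof -
    have "card E dvd p ^ m" using c by (metis dvd_triv_left)
    then obtain i where i: "card E = p ^ i" using p by (metis divides_primepow_nat)
    have "card N < card B" using N(2) finB by (simp add: psubset_card_mono)
    then have "card E \<noteq> 1" using c B by auto
    then show ?thesis using i by (cases i) auto
  qed
  let ?H = "G\<lparr>carrier := A\<rparr>"
  let ?act = "\<lambda>a e. (a <# e) #> inv a"
  have act: "a <# (N #> x) #> inv a = N #> (a \<otimes> x \<otimes> inv a)" if a: "a \<in> A" and x: "x \<in> carrier G" for a x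
  proof -
    have *: "inv a \<in> A" using A a by (simp add: subgroup.m_inv_closed)
    have "a \<otimes> (n \<otimes> x) \<otimes> inv a = (a \<otimes> n \<otimes> inv a) \<otimes> (a \<otimes> x \<otimes> inv a)" if "n \<in> N" for n
      using a x that Ac Nc by (simp add: m_assoc free_cancel)
    then have 1: "a <# (N #> x) #> inv a \<subseteq> N #> (a \<otimes> x \<otimes> inv a)"
      using AN[OF a] by (auto simp: l_coset_def r_coset_def)
    have "n \<otimes> (a \<otimes> x \<otimes> inv a) = a \<otimes> ((inv a \<otimes> n \<otimes> inv (inv a)) \<otimes> x) \<otimes> inv a" if "n \<in> N" for n
      using a x that Ac Nc by (simp add: m_assoc free_cancel)
    then have 2: "N #> (a \<otimes> x \<otimes> inv a) \<subseteq> a <# (N #> x) #> inv a"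
      using AN[OF *] by (fastforce simp: l_coset_def r_coset_def)
    show ?thesis using 1 2 by blast
  qed
  let ?F = "{e \<in> E. \<forall>h \<in> carrier ?H. ?act h e = e}"
  have "card ?F mod p = card E mod p"
  proof (rule fixed_points_mod_prime[where n = n and C = "{\<one>}"])
    show "subgroup {\<one>} ?H"
      using group.triv_subgroup[OF subgroup_imp_group[OF A(1)]] by simp
    show "order ?H = p ^ n * card {\<one>}" using A by (simp add: order_def)
    show "?act h e \<in> E" if "h \<in> carrier ?H" "e \<in> E" for h e
      using that act[of h] AB[of h] Bc by (auto simp: E_def)
    show "?act \<one>\<^bsub>?H\<^esub> e = e" if "e \<in> E" for e
      using that act[of \<one>] subgroup.one_closed[OF A(1)] Bc by (auto simp: E_def)
    then show "?act c e = e" if "c \<in> {\<one>}" "e \<in> E" for c e using that by simp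
    show "?act (g \<otimes>\<^bsub>?H\<^esub> h) e = ?act g (?act h e)"
      if gh: "g \<in> carrier ?H" "h \<in> carrier ?H" and e: "e \<in> E" for g h e
    proof -
      obtain x where x: "x \<in> B" "e = N #> x" using e by (auto simp: E_def)
      have "g \<otimes> h \<in> A" using gh A by (simp add: subgroup.m_closed)
      then have "?act (g \<otimes> h) e = N #> (g \<otimes> h \<otimes> x \<otimes> inv (g \<otimes> h))"
        using act x Bc by blast
      also have "g \<otimes> h \<otimes> x \<otimes> inv (g \<otimes> h) = g \<otimes> (h \<otimes> x \<otimes> inv h) \<otimes> inv g"
        using x gh Bc Ac by (simp add: m_assoc inv_mult_group)
      also have "N #> (g \<otimes> (h \<otimes> x \<otimes> inv h) \<otimes> inv g) = ?act g (?act h e)"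
        using x gh act[of h x] act[of g "h \<otimes> x \<otimes> inv h"] Bc Ac by simp
      finally show ?thesis by simp
    qed
    show "finite (carrier ?H)"
      using finite_subset[OF subgroup.subset[OF A(1)] fin] by simp
  qed (use p finE subgroup_imp_group[OF A(1)] in auto)
  then have pF: "p dvd card ?F" using pE by (simp only: dvd_eq_mod_eq_0)
  have NF: "N #> \<one> \<in> ?F"
  proof -
    have "N #> (a \<otimes> \<one> \<otimes> inv a) = N #> \<one>" if "a \<in> A" for a using Ac[OF that] by simp
    then show ?thesis using act[of _ \<one>] subgroup.one_closed[OF B(1)] by (auto simp: E_def)
  qed
  have "card ?F \<noteq> 1"
  proof
    assume "card ?F = 1"
    then have "p dvd 1" using pF by (simp only:)
    then show False using p by simp
  qed
  then have "?F \<noteq> {N #> \<one>}" by (metis card_1_singleton_iff One_nat_def)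
  then obtain e where e: "e \<in> ?F" "e \<noteq> N #> \<one>"
    using NF by blast
  then have "e \<in> E" by simp
  then obtain x where x: "x \<in> B" "e = N #> x" unfolding E_def by blast
  have "x \<notin> N"
    using e(2) x(2) r_coset_eq_iff[OF N(1), of x \<one>] x Bc by auto
  moreover have "x \<otimes> a \<otimes> inv x \<otimes> inv a \<in> N" if a: "a \<in> A" for a
  proof -
    have "N #> (a \<otimes> x \<otimes> inv a) = N #> x" using e x a act[of a x] Bc by auto
    then have "N #> x = N #> (a \<otimes> x \<otimes> inv a)" by simp
    then have "x \<otimes> inv (a \<otimes> x \<otimes> inv a) \<in> N"
      using r_coset_eq_iff[OF N(1), of x "a \<otimes> x \<otimes> inv a"] a x Ac Bc by simp
    then show ?thesis using a x Ac Bc by (simp add: inv_mult_group m_assoc)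
  qed
  ultimately show ?thesis using x by blast
qed

section \<open>Conjugation as an action on elements and on subsets\<close>

lemma conj_action_closed [simp]:
  "g \<in> carrier G \<Longrightarrow> x \<in> carrier G \<Longrightarrow> conj_action G g x \<in> carrier G"
  by (simp add: conj_action_def)

lemma conj_action_one [simp]: "x \<in> carrier G \<Longrightarrow> conj_action G \<one> x = x"
  by (simp add: conj_action_def)

lemma conj_action_mult:
  "g \<in> carrier G \<Longrightarrow> h \<in> carrier G \<Longrightarrow> x \<in> carrier G \<Longrightarrow>
   conj_action G (g \<otimes> h) x = conj_action G g (conj_action G h x)"
  by (simp add: conj_action_def m_assoc inv_mult_group)

lemma conj_action_hom:
  "g \<in> carrier G \<Longrightarrow> x \<in> carrier G \<Longrightarrow> y \<in> carrier G \<Longrightarrow>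
   conj_action G g (x \<otimes> y) = conj_action G g x \<otimes> conj_action G g y"
  by (simp add: conj_action_def m_assoc free_cancel)

lemma conj_action_inv_cancel:
  "g \<in> carrier G \<Longrightarrow> x \<in> carrier G \<Longrightarrow> conj_action G (inv g) (conj_action G g x) = x"
  "g \<in> carrier G \<Longrightarrow> x \<in> carrier G \<Longrightarrow> conj_action G g (conj_action G (inv g) x) = x"
  by (simp_all add: conj_action_mult[symmetric])

lemma conj_action_in_mon: "g \<in> carrier G \<Longrightarrow> conj_action G g \<in> mon G G"
  unfolding mon_def
proof (intro CollectI conjI homI inj_onI)
  fix x y assume "g \<in> carrier G" "x \<in> carrier G" "y \<in> carrier G"
    "conj_action G g x = conj_action G g y"
  then show "x = y" using conj_action_inv_cancel(1) by metis
qed (simp_all add: conj_action_hom)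

lemma conj_image_one: "U \<subseteq> carrier G \<Longrightarrow> conj_action G \<one> ` U = U"
  by (force simp: image_iff)

lemma conj_image_mult:
  "g \<in> carrier G \<Longrightarrow> h \<in> carrier G \<Longrightarrow> U \<subseteq> carrier G \<Longrightarrow>
   conj_action G (g \<otimes> h) ` U = conj_action G g ` conj_action G h ` U"
  by (force simp: image_iff conj_action_mult)

lemma conj_image_subset: "g \<in> carrier G \<Longrightarrow> U \<subseteq> carrier G \<Longrightarrow> conj_action G g ` U \<subseteq> carrier G"
  by auto

lemma conj_image_eq_iff:
  assumes "g \<in> carrier G" "U \<subseteq> carrier G" "V \<subseteq> carrier G"
  shows "conj_action G g ` U = conj_action G g ` V \<longleftrightarrow> U = V"
  using inj_on_image_eq_iff[of "conj_action G g" "carrier G" U V] conj_action_in_mon[OF assms(1)] assms(2,3)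
  unfolding mon_def by blast

lemma coset_conj_eq_conj_image: "g <# U #> inv g = conj_action G g ` U"
  by (auto simp: l_coset_def r_coset_def conj_action_def)

text \<open>The conjugates of \<open>Z\<close> are prime to \<open>p\<close> in number, so \<open>K\<close>, acting on them through the \<open>p\<close>-group \<open>K/C\<close>, fixes one.\<close>

lemma normal_p_extension_normalises:
  assumes fin: "finite (carrier G)" and p: "Factorial_Ring.prime p"
    and S: "sylow_subgroup p S G" and Z: "Z \<subseteq> carrier G"
    and SZ: "\<And>s. s \<in> S \<Longrightarrow> conj_action G s ` Z = Z"
    and K: "K \<lhd> G" and C: "subgroup C G" "C \<subseteq> K" and card: "card K = p ^ n * card C"
    and triv: "\<And>c g. c \<in> C \<Longrightarrow> g \<in> carrier G \<Longrightarrow>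
                 conj_action G c ` conj_action G g ` Z = conj_action G g ` Z"
    and k: "k \<in> K"
  shows "conj_action G k ` Z = Z"
proof -
  have SG: "subgroup S G" and cS: "card S = p ^ multiplicity p (order G)"
    using S by (auto simp: sylow_subgroup_def)
  have KG: "subgroup K G" using K by (rule normal_imp_subgroup)
  note Kc = subgroup.mem_carrier[OF KG]
  define E where "E = (\<lambda>g. conj_action G g ` Z) ` carrier G"
  have finE: "finite E" unfolding E_def using fin by simp
  let ?\<psi> = "\<lambda>g. \<lambda>H \<in> {H. H \<subseteq> carrier G}. g <# H #> inv g"
  have os: "card (orbit G ?\<psi> Z) * card (stabilizer G ?\<psi> Z) = order G"
    using group_action.orbit_stabilizer_theorem[OF action_by_conjugation_on_power_set, of Z] Z by simp
  have orb: "orbit G ?\<psi> Z = E"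
    using Z by (auto simp: orbit_def E_def coset_conj_eq_conj_image)
  have "card S dvd card (stabilizer G ?\<psi> Z)"
  proof (rule card_subgroups_dvd[OF SG])
    show "subgroup (stabilizer G ?\<psi> Z) G"
      using normalizer_imp_subgroup[OF Z] by (simp add: normalizer_def)
    show "S \<subseteq> stabilizer G ?\<psi> Z"
      using SZ subgroup.mem_carrier[OF SG] Z by (auto simp: stabilizer_def coset_conj_eq_conj_image)
  qed
  from mult_dvd_mono[OF dvd_refl this] have "card E * p ^ multiplicity p (order G) dvd order G"
    unfolding cS os[unfolded orb, symmetric] .
  then have npE: "\<not> p dvd card E"
    using not_dvd_of_mult_multiplicity_dvd p fin order_gt_0_iff_finite by blast
  let ?H = "G\<lparr>carrier := K\<rparr>"
  let ?F = "{e \<in> E. \<forall>h \<in> carrier ?H. conj_action G h ` e = e}"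
  have Ec: "e \<subseteq> carrier G" if "e \<in> E" for e
    using that Z unfolding E_def by auto
  have "card ?F mod p = card E mod p"
  proof (rule fixed_points_mod_prime[where n = n and C = C])
    show "subgroup C ?H" by (rule subgroup_incl[OF C(1) KG C(2)])
    show "order ?H = p ^ n * card C" using card by (simp add: order_def)
    show "conj_action G h ` e \<in> E" if he: "h \<in> carrier ?H" "e \<in> E" for h e
    proof -
      obtain g where g: "g \<in> carrier G" "e = conj_action G g ` Z" using he unfolding E_def by blast
      then have "conj_action G h ` e = conj_action G (h \<otimes> g) ` Z"
        using he Kc Z by (simp add: conj_image_mult)
      then show ?thesis using g he Kc unfolding E_def by simp
    qed
    show "conj_action G \<one>\<^bsub>?H\<^esub> ` e = e" if "e \<in> E" for e
      using Ec[OF that] by (simp add: conj_image_one)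
    show "conj_action G (g \<otimes>\<^bsub>?H\<^esub> h) ` e = conj_action G g ` conj_action G h ` e"
      if "g \<in> carrier ?H" "h \<in> carrier ?H" "e \<in> E" for g h e
      using that Kc Ec by (simp add: conj_image_mult)
    show "conj_action G c ` e = e" if ce: "c \<in> C" "e \<in> E" for c e
      using triv ce unfolding E_def by blast
    show "finite (carrier ?H)"
      using finite_subset[OF subgroup.subset[OF KG] fin] by simp
  qed (use p finE subgroup_imp_group[OF KG] in auto)
  then have "card ?F \<noteq> 0" using npE by (metis dvd_eq_mod_eq_0 mod_0)
  then have "?F \<noteq> {}" by (metis card.empty)
  then obtain e where e: "e \<in> E" "\<forall>h\<in>K. conj_action G h ` e = e" by auto
  then obtain g where g: "g \<in> carrier G" "e = conj_action G g ` Z" unfolding E_def by blast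
  \<comment> \<open>So far \<open>K\<close> is known to fix one conjugate of \<open>Z\<close> only.
    As \<open>K\<close> is normal, \<open>g k g^-1\<close> is again in \<open>K\<close>, and
    conjugating back by \<open>g\<close> shows that \<open>k\<close> fixes \<open>Z\<close>
    itself.\<close>
  have gk: "g \<otimes> k \<otimes> inv g \<in> K" using normal.inv_op_closed2[OF K g(1) k] .
  have "conj_action G g ` conj_action G k ` Z = conj_action G (g \<otimes> k \<otimes> inv g \<otimes> g) ` Z"
    using g Kc[OF k] Z by (simp add: conj_image_mult[symmetric] m_assoc)
  also have "\<dots> = conj_action G g ` Z"
    using e(2) gk g Kc[OF gk] Z by (simp only: conj_image_mult)
  finally show ?thesis
    using conj_image_eq_iff[OF g(1) conj_image_subset[OF Kc[OF k] Z] Z] by blast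
qed

section \<open>The largest normal \<open>p\<close>-subgroup and its preimages\<close>

text \<open>Some conjugate of \<open>N\<close> lies in \<open>S\<close>, and a normal subgroup
  equals all of its conjugates.\<close>

lemma normal_p_subgroup_le_sylow:
  assumes fin: "finite (carrier G)" and p: "Factorial_Ring.prime p"
    and S: "sylow_subgroup p S G" and N: "N \<lhd> G" "p_group p (G\<lparr>carrier := N\<rparr>)"
  shows "N \<subseteq> S"
proof
  fix x assume x: "x \<in> N"
  note NG = normal_imp_subgroup[OF N(1)]
  obtain n where "card N = p ^ n" using N(2) by (auto simp: p_group_carrier_iff)
  then obtain l where l: "l \<in> carrier G" "\<forall>x\<in>N. l \<otimes> x \<otimes> inv l \<in> S"
    using ex_conj_into_sylow[OF fin p S normal_self NG subgroup.subset[OF NG]] by blast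
  have "inv l \<otimes> x \<otimes> l \<in> N" using normal.inv_op_closed1[OF N(1) l(1) x] .
  then have "l \<otimes> (inv l \<otimes> x \<otimes> l) \<otimes> inv l \<in> S" using l(2) by blast
  then show "x \<in> S"
    using l(1) subgroup.mem_carrier[OF NG x] by (simp add: m_assoc free_cancel)
qed

lemma p_group_subgroup:
  assumes p: "Factorial_Ring.prime p" and N: "subgroup N G" "p_group p (G\<lparr>carrier := N\<rparr>)"
    and M: "subgroup M G" "M \<subseteq> N"
  shows "p_group p (G\<lparr>carrier := M\<rparr>)"
proof -
  obtain n where n: "card N = p ^ n" and fin: "finite N" using N(2) by (auto simp: p_group_carrier_iff)
  have "card M dvd p ^ n" using card_subgroups_dvd[OF M(1) N(1) M(2)] n by simp
  then obtain i where "card M = p ^ i" unfolding divides_primepow_nat[OF p] by blast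
  then show ?thesis
    using subgroup_imp_group[OF M(1)] finite_subset[OF M(2) fin]
    by (intro p_group_carrier_iff[THEN iffD2] conjI exI)
qed

text \<open>All normal \<open>p\<close>-subgroups lie in one Sylow subgroup, so the normal subgroup
  that they generate does too and is itself a \<open>p\<close>-group.\<close>

lemma ex_largest_normal_p_subgroup:
  assumes fin: "finite (carrier G)" and p: "Factorial_Ring.prime p"
  shows "\<exists>Q. Q \<lhd> G \<and> p_group p (G\<lparr>carrier := Q\<rparr>) \<and>
           (\<forall>N. N \<lhd> G \<and> p_group p (G\<lparr>carrier := N\<rparr>) \<longrightarrow> N \<subseteq> Q)"
proof -
  have "order G \<noteq> 0" using fin order_gt_0_iff_finite by simp
  then obtain m where "order G = p ^ multiplicity p (order G) * m"
    using multiplicity_dvd by (metis dvdE)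
  then obtain S where S: "subgroup S G" "card S = p ^ multiplicity p (order G)"
    using sylow_thm[OF p is_group _ fin] by blast
  let ?\<N> = "{N. N \<lhd> G \<and> p_group p (G\<lparr>carrier := N\<rparr>)}"
  have "sylow_subgroup p S G" using S by (simp add: sylow_subgroup_def)
  then have inS: "\<Union>?\<N> \<subseteq> S" using normal_p_subgroup_le_sylow[OF fin p] by blast
  let ?Q = "generate G (\<Union>?\<N>)"
  have QS: "?Q \<subseteq> S" using generate_subgroup_incl[OF inS S(1)] .
  have Q: "?Q \<lhd> G"
  proof (rule normal_generateI)
    show "\<Union>?\<N> \<subseteq> carrier G" using inS subgroup.subset[OF S(1)] by (rule subset_trans)
    show "g \<otimes> h \<otimes> inv g \<in> \<Union>?\<N>" if h: "h \<in> \<Union>?\<N>" and g: "g \<in> carrier G" for h g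
    proof -
      obtain N where N: "N \<lhd> G" "p_group p (G\<lparr>carrier := N\<rparr>)" "h \<in> N" using h by blast
      then show ?thesis using normal.inv_op_closed2[OF N(1) g N(3)] by blast
    qed
  qed
  note QG = normal_imp_subgroup[OF Q]
  obtain i where "card ?Q = p ^ i"
    using card_subgroups_dvd[OF QG S(1) QS] unfolding S(2) divides_primepow_nat[OF p] by blast
  moreover have "finite ?Q" using finite_subset[OF subgroup.subset[OF QG] fin] .
  ultimately have "p_group p (G\<lparr>carrier := ?Q\<rparr>)"
    using subgroup_imp_group[OF QG] by (intro p_group_carrier_iff[THEN iffD2] conjI exI)
  moreover have "N \<subseteq> ?Q" if "N \<lhd> G \<and> p_group p (G\<lparr>carrier := N\<rparr>)" for N
    using that generate.incl[of _ "\<Union>?\<N>" G] by fast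
  ultimately show ?thesis using Q by (intro exI[of _ ?Q] conjI allI impI)
qed

text \<open>\<open>p_core\<close> is given by \<open>GREATEST\<close> with respect to inclusion,
  which has these properties only because a largest normal \<open>p\<close>-subgroup exists.\<close>

lemma p_core_greatest:
  assumes fin: "finite (carrier G)" and p: "Factorial_Ring.prime p"
  shows "p_core p G \<lhd> G" "p_group p (G\<lparr>carrier := p_core p G\<rparr>)"
    "N \<lhd> G \<Longrightarrow> p_group p (G\<lparr>carrier := N\<rparr>) \<Longrightarrow> N \<subseteq> p_core p G"
proof -
  obtain Q where Q: "Q \<lhd> G \<and> p_group p (G\<lparr>carrier := Q\<rparr>)"
    "\<And>N. N \<lhd> G \<and> p_group p (G\<lparr>carrier := N\<rparr>) \<Longrightarrow> N \<subseteq> Q"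
    using ex_largest_normal_p_subgroup[OF fin p] by blast
  have "p_core p G = Q"
    unfolding p_core_def using Q by (rule Greatest_equality)
  then show "p_core p G \<lhd> G" "p_group p (G\<lparr>carrier := p_core p G\<rparr>)"
    "N \<lhd> G \<Longrightarrow> p_group p (G\<lparr>carrier := N\<rparr>) \<Longrightarrow> N \<subseteq> p_core p G"
    using Q by auto
qed

text \<open>\<open>K\<close> is the preimage of \<open>O_p(G/C)\<close>; since \<open>K/C\<close> is
  a \<open>p\<close>-group, the index of \<open>C\<close> in \<open>K\<close> is a power of
  \<open>p\<close>. With \<open>C\<close> the kernel of an action, \<open>K\<close> is the group
  \<open>act_p_core\<close> in which \<open>p\<close>-stability places the quadratic
  elements.\<close>

lemma p_core_preimage:
  assumes fin: "finite (carrier G)" and p: "Factorial_Ring.prime p" and C: "C \<lhd> G"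
  defines "K \<equiv> {g \<in> carrier G. C #> g \<in> p_core p (G Mod C)}"
  shows "K \<lhd> G" "C \<subseteq> K" "\<exists>n. card K = p ^ n * card C"
proof -
  interpret C: normal C G by fact
  interpret Q: group "G Mod C" by (rule C.factorgroup_is_group)
  have finQ: "finite (carrier (G Mod C))" using fin by (simp add: carrier_FactGroup)
  note core = Q.p_core_greatest[OF finQ p]
  have coreG: "subgroup (p_core p (G Mod C)) (G Mod C)" by (rule normal_imp_subgroup[OF core(1)])
  have KU: "K = \<Union>(p_core p (G Mod C))"
    unfolding K_def using C.factgroup_subgroup_union_char[OF coreG] by simp
  show K: "K \<lhd> G" unfolding KU by (rule C.factgroup_subgroup_union_normal[OF core(1)])
  have Cc: "C \<in> p_core p (G Mod C)" using subgroup.one_closed[OF coreG] by simp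
  then show CK: "C \<subseteq> K" unfolding KU by blast
  have "(\<lambda>x. C #> x) ` K = p_core p (G Mod C)"
  proof
    show "(\<lambda>x. C #> x) ` K \<subseteq> p_core p (G Mod C)" unfolding K_def by blast
    show "p_core p (G Mod C) \<subseteq> (\<lambda>x. C #> x) ` K"
    proof
      fix e assume e: "e \<in> p_core p (G Mod C)"
      then have "e \<in> carrier (G Mod C)" by (rule subgroup.mem_carrier[OF coreG])
      then obtain g where "g \<in> carrier G" "e = C #> g" by (auto simp: carrier_FactGroup)
      then show "e \<in> (\<lambda>x. C #> x) ` K" using e unfolding K_def by blast
    qed
  qed
  then have "card (p_core p (G Mod C)) * card C = card K"
    using lagrange_subgroups[OF C.subgroup_axioms normal_imp_subgroup[OF K] CK]
    by (simp add: rcosets_subgroup_eq)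
  moreover obtain n where "card (p_core p (G Mod C)) = p ^ n"
    using core(2) by (auto simp: p_group_carrier_iff)
  ultimately show "\<exists>n. card K = p ^ n * card C" by metis
qed

section \<open>Conjugation on a normal subgroup: the kernel and quadratic elements\<close>

lemma act_centralizer_conj_normal:
  assumes B: "B \<lhd> G"
  shows "act_centralizer G (G\<lparr>carrier := B\<rparr>) (conj_action G) \<lhd> G" (is "?C \<lhd> G")
proof -
  note Bc = subgroup.mem_carrier[OF normal_imp_subgroup[OF B]]
  have C: "?C = {g \<in> carrier G. \<forall>w\<in>B. conj_action G g w = w}"
    by (simp add: act_centralizer_def)
  have inv: "conj_action G (inv g) w = w" if "g \<in> carrier G" "w \<in> B" "conj_action G g w = w" for g w
    using conj_action_inv_cancel(1)[of g w] that Bc by simp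
  have "subgroup ?C G"
    unfolding C
  proof (rule subgroupI)
    show "{g \<in> carrier G. \<forall>w\<in>B. conj_action G g w = w} \<noteq> {}" using Bc by force
  qed (auto simp: conj_action_mult Bc inv)
  moreover have "x \<otimes> h \<otimes> inv x \<in> ?C" if x: "x \<in> carrier G" and h: "h \<in> ?C" for x h
  proof -
    have hc: "h \<in> carrier G" using h by (simp add: C)
    have "conj_action G (x \<otimes> h \<otimes> inv x) w = w" if w: "w \<in> B" for w
    proof -
      have "conj_action G (inv x) w \<in> B"
        using normal.inv_op_closed1[OF B x w] x by (simp add: conj_action_def)
      then have "conj_action G h (conj_action G (inv x) w) = conj_action G (inv x) w"
        using h by (simp add: C)
      then show ?thesis using x hc w Bc by (simp add: conj_action_mult conj_action_inv_cancel)
    qed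
    then show ?thesis using x hc by (simp add: C)
  qed
  ultimately show ?thesis by (simp add: normal_inv_iff)
qed

text \<open>\<open>[w, x] = (w^-1 x^-1 w) x\<close> lies in \<open>A\<close> because
  \<open>B\<close> normalises \<open>A\<close>, and in \<open>B\<close> because \<open>B\<close> is
  normal. Hence \<open>[B, x]\<close> lies in \<open>A \<inter> B\<close>, where \<open>x\<close>
  acts trivially since \<open>A\<close> is abelian.\<close>

lemma acts_quadratically_of_abelian:
  assumes A: "subgroup A G" and comm: "\<And>a b. a \<in> A \<Longrightarrow> b \<in> A \<Longrightarrow> a \<otimes> b = b \<otimes> a"
    and B: "B \<lhd> G" and norm: "\<And>a b. a \<in> A \<Longrightarrow> b \<in> B \<Longrightarrow> b \<otimes> a \<otimes> inv b \<in> A" and x: "x \<in> A"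
  shows "acts_quadratically G (G\<lparr>carrier := B\<rparr>) (conj_action G) x"
proof -
  have BG: "subgroup B G" by (rule normal_imp_subgroup[OF B])
  note Bc = subgroup.mem_carrier[OF BG] and Ac = subgroup.mem_carrier[OF A]
  let ?B = "G\<lparr>carrier := B\<rparr>"
  let ?W = "act_commutator_subgroup G ?B (conj_action G) B x"
  have invB: "inv\<^bsub>?B\<^esub> w = inv w" if "w \<in> B" for w using m_inv_consistent[OF BG that] .
  have AB: "subgroup (A \<inter> B) G" using A BG by (rule subgroups_Inter_pair)
  have "act_commutator G ?B (conj_action G) w x \<in> A \<inter> B" if w: "w \<in> B" for w
  proof
    have "inv w \<otimes> (inv x \<otimes> w \<otimes> x) = (inv w \<otimes> inv x \<otimes> inv (inv w)) \<otimes> x"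
      using Bc[OF w] Ac[OF x] by (simp add: m_assoc)
    also have "\<dots> \<in> A"
      using norm[of "inv x" "inv w"] w x A BG by (simp add: subgroup.m_closed subgroup.m_inv_closed)
    finally show "act_commutator G ?B (conj_action G) w x \<in> A"
      using w Ac[OF x] by (simp add: act_commutator_def invB conj_action_def)
    have "inv w \<otimes> (inv x \<otimes> w \<otimes> x) \<in> B"
      using w normal.inv_op_closed1[OF B Ac[OF x] w] BG
      by (simp add: subgroup.m_closed subgroup.m_inv_closed)
    then show "act_commutator G ?B (conj_action G) w x \<in> B"
      using w Ac[OF x] by (simp add: act_commutator_def invB conj_action_def)
  qed
  then have im: "(\<lambda>w. act_commutator G ?B (conj_action G) w x) ` B \<subseteq> A \<inter> B" by blast
  then have "?W = generate G ((\<lambda>w. act_commutator G ?B (conj_action G) w x) ` B)"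
    unfolding act_commutator_subgroup_def using BG by (intro generate_consistent) auto
  then have W: "?W \<subseteq> A \<inter> B" using generate_subgroup_incl[OF im AB] by simp
  have one: "act_commutator G ?B (conj_action G) w x = \<one>" if "w \<in> ?W" for w
  proof -
    have w: "w \<in> A" "w \<in> B" using W that by auto
    then have "inv x \<otimes> w \<otimes> x = w"
      using comm[OF w(1) x] Ac[OF x] Bc by (simp add: m_assoc free_cancel)
    then show ?thesis using w Ac[OF x] Bc by (simp add: act_commutator_def invB conj_action_def)
  qed
  have "\<one> \<in> ?W" unfolding act_commutator_subgroup_def using generate.one[of ?B] by simp
  then have "(\<lambda>w. act_commutator G ?B (conj_action G) w x) ` ?W = {\<one>}" using one by force
  moreover have "generate ?B {\<one>} = {\<one>}"
    using group.generate_one[OF subgroup_imp_group[OF BG]] by simp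
  ultimately show ?thesis
    by (simp add: acts_quadratically_def act_commutator_subgroup_def[of _ _ _ ?W])
qed

end

section \<open>Glauberman replacement\<close>

text \<open>For abelian \<open>p\<close>-groups the counts at \<open>n = p^i\<close> are the numbers
  \<open>omega_i\<close>, the count at \<open>n = p\<close> determines the rank, and
  \<open>n\<close> kills \<open>A\<close> exactly when its count is the whole order. So all
  invariants that define the families are monotone along this relation.\<close>

definition torsion_le :: "('a, 'm) monoid_scheme \<Rightarrow> 'a set \<Rightarrow> 'a set \<Rightarrow> bool" where
  "torsion_le G A D \<longleftrightarrow> card A = card D \<and>
     (\<forall>n::nat. card {x \<in> A. x [^]\<^bsub>G\<^esub> n = \<one>\<^bsub>G\<^esub>} \<le> card {x \<in> D. x [^]\<^bsub>G\<^esub> n = \<one>\<^bsub>G\<^esub>})"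

context group
begin

text \<open>\<open>K\<close> centralises \<open>h(A)\<close>, so \<open>D = K h(A)\<close> is an
  abelian group. For the torsion, write \<open>a = k r\<close> with \<open>r\<close> a
  representative of the coset \<open>K a\<close> that is killed by \<open>n\<close> if
  \<open>a\<close> is. Then \<open>k h(r)\<close> is killed by \<open>n\<close> too. No two elements
  collide: equal images force \<open>h(r t^-1) \<in> K\<close> for the representatives
  \<open>r\<close> and \<open>t\<close>, hence \<open>r t^-1 \<in> K\<close>, so both elements lie
  in the same coset.\<close>

lemma replacement_of_hom:
  assumes A: "subgroup A G" and finA: "finite A"
    and comm: "\<And>a b. a \<in> A \<Longrightarrow> b \<in> A \<Longrightarrow> a \<otimes> b = b \<otimes> a"
    and hc: "\<And>a. a \<in> A \<Longrightarrow> h a \<in> carrier G"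
    and hmult: "\<And>a b. a \<in> A \<Longrightarrow> b \<in> A \<Longrightarrow> h (a \<otimes> b) = h a \<otimes> h b"
    and hK: "\<And>a. a \<in> A \<Longrightarrow> h a \<in> A \<Longrightarrow> h (h a) \<in> A"
    and Kcomm: "\<And>k b. k \<in> A \<Longrightarrow> h k \<in> A \<Longrightarrow> b \<in> A \<Longrightarrow> k \<otimes> h b = h b \<otimes> k"
  defines "K \<equiv> {a \<in> A. h a \<in> A}"
  defines "D \<equiv> {k \<otimes> h a | k a. k \<in> K \<and> a \<in> A}"
  shows "subgroup D G" "\<And>c d. c \<in> D \<Longrightarrow> d \<in> D \<Longrightarrow> c \<otimes> d = d \<otimes> c" "torsion_le G A D"
proof -
  note Ac [simp] = subgroup.mem_carrier[OF A] and Acl [simp] = subgroup.m_closed[OF A] subgroup.m_inv_closed[OF A]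
    and A1 [simp] = subgroup.one_closed[OF A]
  note [simp] = hc
  have KA: "k \<in> A" if "k \<in> K" for k using that by (simp add: K_def)
  have hKA: "h k \<in> A" if "k \<in> K" for k using that by (simp add: K_def)
  have hKK: "h k \<in> K" if "k \<in> K" for k using that hK by (simp add: K_def)
  have Kh: "k \<otimes> h b = h b \<otimes> k" if "k \<in> K" "b \<in> A" for k b
    using that Kcomm by (simp add: K_def)
  have h1 [simp]: "h \<one> = \<one>"
    using hmult[of \<one> \<one>, symmetric] by simp
  have hinv: "h (inv a) = inv (h a)" if "a \<in> A" for a
    using that hmult[of "inv a" a] by (intro inv_equality[symmetric]) auto
  have hcomm: "h a \<otimes> h b = h b \<otimes> h a" if "a \<in> A" "b \<in> A" for a b
    using that comm hmult by metis
  have K: "subgroup K G"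
  proof (rule subgroupI)
    show "K \<noteq> {}" using h1 A1 by (auto simp: K_def intro!: exI[of _ \<one>])
  qed (auto simp: K_def hmult hinv)
  note [simp] = KA hKA hKK
  note Kcl [simp] = subgroup.m_closed[OF K] subgroup.m_inv_closed[OF K]
  have Dmult: "(k \<otimes> h a) \<otimes> (l \<otimes> h b) = (k \<otimes> l) \<otimes> h (a \<otimes> b)"
    if "k \<in> K" "l \<in> K" "a \<in> A" "b \<in> A" for k l a b
  proof -
    have "(k \<otimes> h a) \<otimes> (l \<otimes> h b) = k \<otimes> (h a \<otimes> l) \<otimes> h b" using that by (simp add: m_assoc)
    also have "h a \<otimes> l = l \<otimes> h a" using Kh that by simp
    finally show ?thesis using that by (simp add: m_assoc hmult)
  qed
  show D: "subgroup D G"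
  proof (rule subgroupI)
    show "D \<subseteq> carrier G" by (auto simp: D_def)
    show "D \<noteq> {}" using A1 subgroup.one_closed[OF K] unfolding D_def by blast
    show "inv d \<in> D" if "d \<in> D" for d
    proof -
      obtain k a where ka: "k \<in> K" "a \<in> A" "d = k \<otimes> h a" using \<open>d \<in> D\<close> by (auto simp: D_def)
      have "inv d = inv k \<otimes> h (inv a)"
        using ka Kh[of "inv k" "inv a"] by (simp add: inv_mult_group hinv)
      moreover have "inv k \<in> K" "inv a \<in> A" using ka by simp_all
      ultimately show ?thesis unfolding D_def by blast
    qed
    show "c \<otimes> d \<in> D" if cd: "c \<in> D" "d \<in> D" for c d
    proof -
      obtain k a where ka: "k \<in> K" "a \<in> A" "c = k \<otimes> h a" using cd by (auto simp: D_def)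
      obtain l b where lb: "l \<in> K" "b \<in> A" "d = l \<otimes> h b" using cd by (auto simp: D_def)
      have "c \<otimes> d = (k \<otimes> l) \<otimes> h (a \<otimes> b)" using Dmult ka lb by simp
      moreover have "k \<otimes> l \<in> K" "a \<otimes> b \<in> A" using ka lb by auto
      ultimately show ?thesis unfolding D_def by blast
    qed
  qed
  show "c \<otimes> d = d \<otimes> c" if cd: "c \<in> D" "d \<in> D" for c d
  proof -
    obtain k a where ka: "k \<in> K" "a \<in> A" "c = k \<otimes> h a" using cd by (auto simp: D_def)
    obtain l b where lb: "l \<in> K" "b \<in> A" "d = l \<otimes> h b" using cd by (auto simp: D_def)
    show ?thesis using Dmult ka lb comm[of k l] comm[of a b] by simp
  qed
  have finD: "finite D"
  proof -
    have "D = (\<lambda>(k, a). k \<otimes> h a) ` (K \<times> A)" by (auto simp: D_def)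
    moreover have "finite K" using finA by (simp add: K_def del: KA hKA hKK)
    ultimately show ?thesis using finA by simp
  qed
  have rep: "a \<otimes> inv r \<in> K \<longleftrightarrow> b \<otimes> inv r \<in> K"
    if "a \<in> A" "b \<in> A" "r \<in> A" "a \<otimes> inv b \<in> K" for a b r
  proof -
    have 1: "a \<otimes> inv r = (a \<otimes> inv b) \<otimes> (b \<otimes> inv r)"
      using that(1-3) by (simp add: m_assoc free_cancel)
    have 2: "b \<otimes> inv r = inv (a \<otimes> inv b) \<otimes> (a \<otimes> inv r)"
      using that(1-3) by (simp add: m_assoc free_cancel inv_mult_group)
    show ?thesis
    proof
      assume "a \<otimes> inv r \<in> K"
      then show "b \<otimes> inv r \<in> K" unfolding 2 by (rule Kcl(1)[OF Kcl(2)[OF that(4)]])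
    next
      assume "b \<otimes> inv r \<in> K"
      then show "a \<otimes> inv r \<in> K" unfolding 1 by (rule Kcl(1)[OF that(4)])
    qed
  qed
  \<comment> \<open>The condition on \<open>r\<close> depends on \<open>a\<close> only through the
    coset \<open>K a\<close>, so \<open>SOME\<close> makes the same choice on the whole
    coset.\<close>
  define s where "s = (\<lambda>n::nat. \<lambda>a. SOME r. r \<in> A \<and> r [^] n = \<one> \<and> a \<otimes> inv r \<in> K)"
  have s: "s n a \<in> A \<and> s n a [^] n = \<one> \<and> a \<otimes> inv (s n a) \<in> K" if "a \<in> A" "a [^] n = \<one>" for n a
    unfolding s_def
    by (rule someI[of _ a]) (use that in \<open>simp add: subgroup.one_closed[OF K]\<close>)
  have s_cong: "s n a = s n b" if "a \<in> A" "b \<in> A" "a \<otimes> inv b \<in> K" for n a b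
    unfolding s_def using rep[OF that(1,2) _ that(3)] by metis
  \<comment> \<open>\<open>\<phi> n\<close> sends \<open>k \<cdot> r\<close> to \<open>k \<cdot> h r\<close>, where \<open>r\<close> is the chosen representative of the coset \<open>K r\<close>.\<close>
  define \<phi> where "\<phi> = (\<lambda>n a. (a \<otimes> inv (s n a)) \<otimes> h (s n a))"
  have hpow: "h (a [^] n) = h a [^] n" if "a \<in> A" for a and n :: nat
  proof (induction n)
    case (Suc n)
    have "a [^] n \<in> A" using that by (induction n) auto
    then show ?case using Suc that hmult by simp
  qed simp
  have inj: "inj_on (\<phi> n) {x \<in> A. x [^] n = \<one>}" for n
  proof (rule inj_onI)
    fix a b assume a: "a \<in> {x \<in> A. x [^] n = \<one>}" and b: "b \<in> {x \<in> A. x [^] n = \<one>}"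
      and eq: "\<phi> n a = \<phi> n b"
    let ?r = "s n a" and ?t = "s n b"
    have r: "?r \<in> A" "a \<otimes> inv ?r \<in> K" and t: "?t \<in> A" "b \<otimes> inv ?t \<in> K"
      using s a b by auto
    note rA = KA[OF r(2)] and tA = KA[OF t(2)]
    have "h (?r \<otimes> inv ?t) = inv (a \<otimes> inv ?r) \<otimes> (b \<otimes> inv ?t)"
    proof -
      have "(a \<otimes> inv ?r) \<otimes> h ?r = (b \<otimes> inv ?t) \<otimes> h ?t" using eq by (simp add: \<phi>_def)
      then have "inv (a \<otimes> inv ?r) \<otimes> ((a \<otimes> inv ?r) \<otimes> h ?r) \<otimes> inv (h ?t)
          = inv (a \<otimes> inv ?r) \<otimes> ((b \<otimes> inv ?t) \<otimes> h ?t) \<otimes> inv (h ?t)" by simp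
      moreover have "inv (a \<otimes> inv ?r) \<otimes> ((a \<otimes> inv ?r) \<otimes> h ?r) = h ?r"
        using rA r(1) by (intro free_cancel) auto
      moreover have "inv (a \<otimes> inv ?r) \<otimes> ((b \<otimes> inv ?t) \<otimes> h ?t) \<otimes> inv (h ?t)
          = inv (a \<otimes> inv ?r) \<otimes> (b \<otimes> inv ?t)"
        using rA tA t(1) by (simp add: m_assoc)
      ultimately show ?thesis using r t by (simp add: hmult hinv)
    qed
    then have "?r \<otimes> inv ?t \<in> K" using r t rA tA by (simp add: K_def del: KA hKA hKK)
    moreover have "a \<otimes> inv ?t = (a \<otimes> inv ?r) \<otimes> (?r \<otimes> inv ?t)"
      using a r t by (simp add: m_assoc free_cancel)
    ultimately have "a \<otimes> inv ?t \<in> K" using r(2) by simp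
    moreover have "b \<otimes> inv a = (b \<otimes> inv ?t) \<otimes> inv (a \<otimes> inv ?t)"
      using a b t by (simp add: m_assoc free_cancel inv_mult_group)
    ultimately have "b \<otimes> inv a \<in> K" using t(2) by simp
    then have "?t = ?r" using s_cong[of b a n] a b by simp
    then have "(a \<otimes> inv ?r) \<otimes> h ?r = (b \<otimes> inv ?r) \<otimes> h ?r" using eq by (simp add: \<phi>_def)
    then have "a \<otimes> inv ?r = b \<otimes> inv ?r" using a b r by simp
    then show "a = b" using a b r by simp
  qed
  have into: "\<phi> n ` {x \<in> A. x [^] n = \<one>} \<subseteq> {x \<in> D. x [^] n = \<one>}" for n
  proof (rule image_subsetI)
    fix a assume a: "a \<in> {x \<in> A. x [^] n = \<one>}"
    let ?r = "s n a"
    have r: "?r \<in> A" "?r [^] n = \<one>" "a \<otimes> inv ?r \<in> K" using s a by auto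
    have "(a \<otimes> inv ?r) [^] n = a [^] n \<otimes> inv ?r [^] n"
      using comm[of a "inv ?r"] a r by (intro pow_mult_distrib) auto
    then have 1: "(a \<otimes> inv ?r) [^] n = \<one>" using a r by (simp add: nat_pow_inv)
    have "\<phi> n a [^] n = (a \<otimes> inv ?r) [^] n \<otimes> h ?r [^] n"
      unfolding \<phi>_def using Kh[OF r(3) r(1)] a r by (intro pow_mult_distrib) auto
    also have "\<dots> = \<one>" using 1 r hpow[of ?r n] by simp
    finally have "\<phi> n a [^] n = \<one>" .
    moreover have "\<phi> n a \<in> D" unfolding \<phi>_def D_def using r by blast
    ultimately show "\<phi> n a \<in> {x \<in> D. x [^] n = \<one>}" by simp
  qed
  have le: "card {x \<in> A. x [^] n = \<one>} \<le> card {x \<in> D. x [^] n = \<one>}" for n :: nat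
    using card_inj_on_le[OF inj into] finD by simp
  \<comment> \<open>For \<open>n = 0\<close> the condition \<open>x^n = 1\<close> is empty, so
    \<open>\<phi> 0\<close> maps all of \<open>A\<close> injectively into \<open>D\<close>;
    surjectivity gives equality of orders.\<close>
  have onto: "D \<subseteq> \<phi> 0 ` A"
  proof
    fix d assume "d \<in> D"
    then obtain k a where ka: "k \<in> K" "a \<in> A" "d = k \<otimes> h a" by (auto simp: D_def)
    let ?r = "s 0 a"
    have r: "?r \<in> A" "a \<otimes> inv ?r \<in> K" using s[of a 0] ka by auto
    \<comment> \<open>Chosen so that \<open>?k\<close> times \<open>h ?r\<close> is \<open>k\<close>
      times \<open>h a\<close>; the correcting factor lies in \<open>K\<close> because
      \<open>h\<close> maps \<open>K\<close> into itself.\<close>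
    let ?k = "k \<otimes> h (a \<otimes> inv ?r)"
    have k: "?k \<in> K" using ka r by simp
    have b: "?k \<otimes> ?r \<in> A" using k r by simp
    have "?k \<otimes> ?r \<otimes> inv a = ?k \<otimes> inv (a \<otimes> inv ?r)"
      using KA[OF k] ka r by (simp add: m_assoc inv_mult_group del: KA)
    then have "?k \<otimes> ?r \<otimes> inv a \<in> K" using k r by simp
    then have "s 0 (?k \<otimes> ?r) = ?r" using s_cong[OF b ka(2)] by simp
    then have "\<phi> 0 (?k \<otimes> ?r) = ?k \<otimes> h ?r"
      using KA[OF k] r unfolding \<phi>_def by (simp add: m_assoc del: KA)
    also have "\<dots> = d" using ka r by (simp add: m_assoc hmult hinv)
    finally show "d \<in> \<phi> 0 ` A" using b by (metis imageI)
  qed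
  have "card D \<le> card A" using surj_card_le[OF finA onto] .
  moreover have "card A \<le> card D" using le[of 0] by simp
  ultimately show "torsion_le G A D" using le by (simp add: torsion_le_def)
qed

text \<open>The map \<open>f\<close> fails to be a homomorphism by the factor
  \<open>g a b = [a, f b]\<close>, which lies in \<open>A \<inter> B\<close>. Commutators of
  \<open>B\<close> are invariant under \<open>A\<close>, and this forces the values of
  \<open>f\<close> to commute with \<open>A \<inter> B\<close> and with each other; then
  \<open>g\<close> is symmetric and can be removed by a square root. The symmetry of
  \<open>[a, h b]\<close> in the conclusion is what later makes the elements \<open>k\<close> of
  \<open>A\<close> with \<open>h k \<in> A\<close> commute with \<open>h(A)\<close>.\<close>

lemma replacement_hom:
  assumes A: "subgroup A G" and finA: "finite A" and oddA: "odd (card A)"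
    and comm: "\<And>a b. a \<in> A \<Longrightarrow> b \<in> A \<Longrightarrow> a \<otimes> b = b \<otimes> a"
    and B: "subgroup B G"
    and AB: "\<And>a w. a \<in> A \<Longrightarrow> w \<in> B \<Longrightarrow> a \<otimes> w \<otimes> inv a \<in> B"
    and BA: "\<And>u v. u \<in> B \<Longrightarrow> v \<in> B \<Longrightarrow> u \<otimes> v \<otimes> inv u \<otimes> inv v \<in> A"
    and BB: "\<And>u v w. u \<in> B \<Longrightarrow> v \<in> B \<Longrightarrow> w \<in> B \<Longrightarrow>
               (u \<otimes> v \<otimes> inv u \<otimes> inv v) \<otimes> w = w \<otimes> (u \<otimes> v \<otimes> inv u \<otimes> inv v)"
    and x: "x \<in> B"
  defines "f \<equiv> \<lambda>a. x \<otimes> a \<otimes> inv x \<otimes> inv a"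
  assumes norm: "\<And>a b. a \<in> A \<Longrightarrow> b \<in> A \<Longrightarrow> f b \<otimes> a \<otimes> inv (f b) \<in> A"
  obtains h where "\<And>a. a \<in> A \<Longrightarrow> h a \<in> B"
    "\<And>a b. a \<in> A \<Longrightarrow> b \<in> A \<Longrightarrow> h (a \<otimes> b) = h a \<otimes> h b"
    "\<And>a b. a \<in> A \<Longrightarrow> b \<in> A \<Longrightarrow> a \<otimes> h b \<otimes> inv a \<otimes> inv (h b) = b \<otimes> h a \<otimes> inv b \<otimes> inv (h a)"
    "\<And>a b. a \<in> A \<Longrightarrow> b \<in> A \<Longrightarrow> h b \<otimes> a \<otimes> inv (h b) \<in> A"
    "\<And>a. a \<in> A \<Longrightarrow> h a \<in> A \<longleftrightarrow> f a \<in> A"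
proof -
  note Ac [simp] = subgroup.mem_carrier[OF A] and Acl [simp] = subgroup.m_closed[OF A] subgroup.m_inv_closed[OF A]
  note Bc [simp] = subgroup.mem_carrier[OF B] and Bcl [simp] = subgroup.m_closed[OF B] subgroup.m_inv_closed[OF B]
  note x [simp]
  define z where "z = (\<lambda>u v. u \<otimes> v \<otimes> inv u \<otimes> inv v)"
  have zA [simp]: "z u v \<in> A" if "u \<in> B" "v \<in> B" for u v using BA that by (simp add: z_def)
  have zB [simp]: "z u v \<in> B" if "u \<in> B" "v \<in> B" for u v using that by (simp add: z_def)
  have zcB: "z u v \<otimes> w = w \<otimes> z u v" if "u \<in> B" "v \<in> B" "w \<in> B" for u v w
    using BB that by (simp add: z_def)
  have zcA: "z u v \<otimes> a = a \<otimes> z u v" if "u \<in> B" "v \<in> B" "a \<in> A" for u v a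
    using comm that by simp
  have zz: "z u v \<otimes> z u' v' = z u' v' \<otimes> z u v" if "u \<in> B" "v \<in> B" "u' \<in> B" "v' \<in> B" for u v u' v'
    using that by (intro zcB) simp_all
  \<comment> \<open>Commutators of \<open>B\<close> are central in \<open>B\<close>, so the
    commutator map \<open>z\<close> is multiplicative in each argument.\<close>
  have zmul1: "z (u \<otimes> v) w = z u w \<otimes> z v w" if "u \<in> B" "v \<in> B" "w \<in> B" for u v w
  proof -
    have "z (u \<otimes> v) w = (u \<otimes> z v w) \<otimes> w \<otimes> inv u \<otimes> inv w"
      using that by (simp add: z_def m_assoc inv_mult_group)
    also have "u \<otimes> z v w = z v w \<otimes> u" using zcB[of v w u] that by simp
    also have "z v w \<otimes> u \<otimes> w \<otimes> inv u \<otimes> inv w = z v w \<otimes> z u w"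
      using that by (simp add: z_def m_assoc)
    also have "\<dots> = z u w \<otimes> z v w" using that by (intro zz)
    finally show ?thesis .
  qed
  have zswap: "z v u = inv (z u v)" if "u \<in> B" "v \<in> B" for u v
    using that by (simp add: z_def m_assoc inv_mult_group)
  have zmul2: "z w (u \<otimes> v) = z w u \<otimes> z w v" if "u \<in> B" "v \<in> B" "w \<in> B" for u v w
  proof -
    have "z w (u \<otimes> v) = inv (z u w \<otimes> z v w)"
      using that zswap[of "u \<otimes> v" w] zmul1[of u v w] by simp
    also have "\<dots> = inv (z v w) \<otimes> inv (z u w)"
      using that Bc[OF zB] by (simp add: inv_mult_group del: zB)
    also have "\<dots> = z w v \<otimes> z w u" using zswap[of u w] zswap[of v w] that by simp
    also have "\<dots> = z w u \<otimes> z w v" using that by (intro zz)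
    finally show ?thesis .
  qed
  have zone: "u \<otimes> v = v \<otimes> u" if "u \<in> B" "v \<in> B" "z u v = \<one>" for u v
  proof -
    have "u \<otimes> v = z u v \<otimes> (v \<otimes> u)" using that(1,2) by (simp add: z_def m_assoc free_cancel)
    then show ?thesis using that by simp
  qed
  have kB [simp]: "conj_action G a u \<in> B" if "a \<in> A" "u \<in> B" for a u
    using AB that by (simp add: conj_action_def)
  have zinv: "z (conj_action G a u) (conj_action G a v) = z u v" if "a \<in> A" "u \<in> B" "v \<in> B" for a u v
  proof -
    have "z (conj_action G a u) (conj_action G a v) = a \<otimes> z u v \<otimes> inv a"
      using that by (simp add: z_def conj_action_def m_assoc inv_mult_group free_cancel)
    also have "a \<otimes> z u v = z u v \<otimes> a" using zcA[of u v a] that by simp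
    also have "z u v \<otimes> a \<otimes> inv a = z u v" using that by (simp add: m_assoc)
    finally show ?thesis .
  qed
  have fB [simp]: "f a \<in> B" if "a \<in> A" for a
  proof -
    have "f a = x \<otimes> conj_action G a (inv x)" using that by (simp add: f_def conj_action_def m_assoc)
    then show ?thesis using that by simp
  qed
  \<comment> \<open>This factorisation of \<open>x\<close> drives the next two computations: a
    commutator with \<open>x\<close> is split along it, and \<open>zinv\<close> evaluates the factor
    that contains the conjugate of \<open>x\<close>.\<close>
  have fx: "f a \<otimes> conj_action G a x = x" if "a \<in> A" for a
    using that by (simp add: f_def conj_action_def m_assoc free_cancel)
  define g where "g = (\<lambda>a b. a \<otimes> f b \<otimes> inv a \<otimes> inv (f b))"
  have kf: "conj_action G a (f b) = g a b \<otimes> f b" if "a \<in> A" "b \<in> A" for a b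
    using that fB[of b] by (simp add: g_def conj_action_def m_assoc del: fB)
  have gA [simp]: "g a b \<in> A" if "a \<in> A" "b \<in> A" for a b
  proof -
    have "g a b = a \<otimes> (f b \<otimes> inv a \<otimes> inv (f b))" using that by (simp add: g_def m_assoc)
    then show ?thesis using that norm[of "inv a" b] by simp
  qed
  have gB [simp]: "g a b \<in> B" if "a \<in> A" "b \<in> A" for a b
  proof -
    have "g a b = conj_action G a (f b) \<otimes> inv (f b)" using that by (simp add: g_def conj_action_def)
    then show ?thesis using that by simp
  qed
  have fmul: "f (a \<otimes> b) = f a \<otimes> (g a b \<otimes> f b)" if "a \<in> A" "b \<in> A" for a b
    unfolding kf[OF that, symmetric]
    using that by (simp add: f_def conj_action_def m_assoc inv_mult_group free_cancel)
  \<comment> \<open>Since \<open>b\<close> commutes with \<open>w\<close>, \<open>zinv\<close> turns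
    the second factor into \<open>z x w\<close>, which cancels against the left-hand side.\<close>
  have zfw: "z (f b) w = \<one>" if b: "b \<in> A" and w: "w \<in> A" "w \<in> B" for b w
  proof -
    have "z x w = z (f b) w \<otimes> z (conj_action G b x) w"
      using zmul1[of "f b" "conj_action G b x" w] fx b w by simp
    also have "conj_action G b w = w"
      using comm[OF b w(1)] b w by (simp add: conj_action_def m_assoc)
    then have "z (conj_action G b x) w = z x w" using zinv[of b x w] b w by simp
    finally show ?thesis using b w Bc[OF zB] by (simp del: zB)
  qed
  have fw: "f b \<otimes> w = w \<otimes> f b" if "b \<in> A" "w \<in> A" "w \<in> B" for b w
    using zone zfw that by simp
  \<comment> \<open>The same splitting for \<open>f c\<close> in place of \<open>w\<close>;
    conjugation by \<open>b\<close> now changes \<open>f c\<close> by the factor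
    \<open>g b c\<close>, which survives.\<close>
  have zff: "z (f b) (f c) = z x (g b c)" if b: "b \<in> A" and c: "c \<in> A" for b c
  proof -
    have "z x (g b c) \<otimes> z x (f c) = z (f b \<otimes> conj_action G b x) (conj_action G b (f c))"
      using zmul2[of "g b c" "f c" x] fx kf b c by simp
    also have "\<dots> = z (f b) (g b c \<otimes> f c) \<otimes> z x (f c)"
      using zmul1[of "f b" "conj_action G b x" "conj_action G b (f c)"] zinv[of b x "f c"] kf[of b c] b c
      by simp
    also have "z (f b) (g b c \<otimes> f c) = z (f b) (f c)"
      using zmul2[of "g b c" "f c" "f b"] zfw[of b "g b c"] b c by simp
    finally show ?thesis using b c Bc[OF zB] by (simp del: zB)
  qed
  \<comment> \<open>Serves twice to compare the expansions of \<open>f (b c)\<close> and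
    \<open>f (c b)\<close>: first after applying \<open>z x\<close>, then, once the values of
    \<open>f\<close> commute, for \<open>f\<close> itself.\<close>
  have cancel: "q = q'"
    if "r \<otimes> (q \<otimes> s) = s \<otimes> (q' \<otimes> r)" "r \<in> carrier G" "s \<in> carrier G" "q \<in> carrier G" "q' \<in> carrier G"
      "r \<otimes> s = s \<otimes> r" "q' \<otimes> r = r \<otimes> q'" "q' \<otimes> s = s \<otimes> q'" for q q' r s
  proof -
    have "s \<otimes> (q' \<otimes> r) = s \<otimes> (r \<otimes> q')" using that(7) by simp
    also have "\<dots> = r \<otimes> s \<otimes> q'" using that(2,3,5,6) by (simp add: m_assoc[symmetric])
    also have "\<dots> = r \<otimes> (q' \<otimes> s)" using that(2,3,5,8) by (simp add: m_assoc)
    finally have "r \<otimes> (q \<otimes> s) = r \<otimes> (q' \<otimes> s)" using that(1) by simp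
    then show ?thesis using that(2-5) by simp
  qed
  \<comment> \<open>By \<open>zff\<close> the commutator of \<open>f b\<close> and \<open>f c\<close> is then both symmetric and alternating, hence trivial as \<open>|A|\<close> is odd.\<close>
  have zxg: "z x (g b c) = z x (g c b)" if b: "b \<in> A" and c: "c \<in> A" for b c
  proof (rule cancel[of "z x (f b)" _ "z x (f c)"])
    have "z x (f (b \<otimes> c)) = z x (f (c \<otimes> b))" using comm[OF b c] by simp
    then show "z x (f b) \<otimes> (z x (g b c) \<otimes> z x (f c)) = z x (f c) \<otimes> (z x (g c b) \<otimes> z x (f b))"
      using fmul zmul2 b c by simp
  qed (use b c zz in simp_all)
  have sq1: "t = \<one>" if "t \<in> A" "t \<otimes> t = \<one>" for t
  proof -
    have "t [^] card A = \<one>"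
      using group.pow_order_eq_1[OF subgroup_imp_group[OF A], of t] that(1)
      by (simp add: order_def nat_pow_consistent[symmetric])
    moreover obtain k where "card A = Suc (2 * k)" using oddA by (auto elim: oddE)
    moreover have "t [^] (2 * k) = \<one>"
      using that nat_pow_pow[of t 2 k] by (simp add: numeral_2_eq_2)
    ultimately show ?thesis using that by simp
  qed
  have ff: "f b \<otimes> f c = f c \<otimes> f b" if b: "b \<in> A" and c: "c \<in> A" for b c
  proof -
    let ?t = "z (f b) (f c)"
    have "?t = inv ?t" using zff[of b c] zff[of c b] zxg[of b c] zswap[of "f b" "f c"] b c by simp
    then have "?t \<otimes> ?t = \<one>" using r_inv[OF Bc[OF zB], of "f b" "f c"] b c by simp
    then have "?t = \<one>" using sq1[of ?t] b c by simp
    then show ?thesis using fB[OF b] fB[OF c] by (intro zone)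
  qed
  have gsym: "g b c = g c b" if b: "b \<in> A" and c: "c \<in> A" for b c
  proof (rule cancel[of "f b" _ "f c"])
    show "f b \<otimes> (g b c \<otimes> f c) = f c \<otimes> (g c b \<otimes> f b)"
      using fmul[OF b c] fmul[OF c b] comm[OF b c] by simp
  qed (use b c ff fw Ac[OF gA] Bc[OF fB] in simp_all)
  have gmul: "g (a \<otimes> b) c = g a c \<otimes> g b c" if a: "a \<in> A" and b: "b \<in> A" and c: "c \<in> A" for a b c
  proof -
    have "g (a \<otimes> b) c = a \<otimes> g b c \<otimes> inv a \<otimes> g a c"
      using a b c Bc[OF fB[OF c]] by (simp add: g_def m_assoc inv_mult_group free_cancel)
    also have "a \<otimes> g b c = g b c \<otimes> a" using comm a b c by simp
    also have "g b c \<otimes> a \<otimes> inv a = g b c" using a Ac[OF gA[OF b c]] by (simp add: m_assoc)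
    also have "g b c \<otimes> g a c = g a c \<otimes> g b c" using comm a b c by simp
    finally show ?thesis .
  qed
  \<comment> \<open>Since \<open>f (a b) = f a \<cdot> g a b \<cdot> f b\<close> with \<open>g\<close> symmetric and bimultiplicative, \<open>f a \<cdot> g a a\<^sup>-\<^sup>1\<^sup>/\<^sup>2\<close> is a
    homomorphism; the square root in the odd-order group \<open>A\<close> is the power with exponent \<open>m\<close>.\<close>
  define m where "m = (card A + 1) div 2"
  have m: "2 * m = Suc (card A)" using oddA by (auto simp: m_def elim!: oddE)
  define q where "q = (\<lambda>a. inv (g a a [^] m))"
  have powA: "t [^] n \<in> A" if "t \<in> A" for t and n :: nat
    using that subgroup.one_closed[OF A] by (induction n) auto
  have powB: "t [^] n \<in> B" if "t \<in> B" for t and n :: nat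
    using that subgroup.one_closed[OF B] by (induction n) auto
  have qA [simp]: "q a \<in> A" and qB [simp]: "q a \<in> B" if "a \<in> A" for a
    using that powA powB by (simp_all add: q_def)
  have lcomm: "a \<otimes> (b \<otimes> c) = b \<otimes> (a \<otimes> c)" if "a \<in> A" "b \<in> A" "c \<in> A" for a b c
    using comm[OF that(1,2)] that by (simp add: m_assoc[symmetric])
  have qmul: "q a \<otimes> q b = q (a \<otimes> b) \<otimes> g a b" if a: "a \<in> A" and b: "b \<in> A" for a b
  proof -
    have ab: "a \<otimes> b \<in> A" using a b by simp
    have "g (a \<otimes> b) (a \<otimes> b) = g (a \<otimes> b) a \<otimes> g (a \<otimes> b) b"
      using gmul[OF a b ab] gsym[OF a ab] gsym[OF b ab] by simp
    also have "\<dots> = g a a \<otimes> g b b \<otimes> (g a b \<otimes> g a b)"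
      using gmul[OF a b a] gmul[OF a b b] gsym[OF a b] a b
      by (simp add: m_assoc comm lcomm)
    finally have e: "g (a \<otimes> b) (a \<otimes> b) = g a a \<otimes> g b b \<otimes> (g a b \<otimes> g a b)" .
    have dist: "(t \<otimes> u) [^] m = t [^] m \<otimes> u [^] m" if "t \<in> A" "u \<in> A" for t u
      using that comm by (intro pow_mult_distrib) auto
    have "g a b [^] card A = \<one>"
      using group.pow_order_eq_1[OF subgroup_imp_group[OF A], of "g a b"] a b
      by (simp add: order_def nat_pow_consistent[symmetric])
    then have "g a b [^] m \<otimes> g a b [^] m = g a b"
      using nat_pow_mult[of "g a b" m m] m Ac[OF gA[OF a b]] by (simp add: mult_2)
    then have "g (a \<otimes> b) (a \<otimes> b) [^] m = g a a [^] m \<otimes> g b b [^] m \<otimes> g a b"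
      using e dist a b by simp
    then have "q (a \<otimes> b) = inv (g a a [^] m \<otimes> g b b [^] m \<otimes> g a b)" by (simp add: q_def)
    also have "\<dots> = inv (g a b) \<otimes> (q b \<otimes> q a)"
      using a b Ac[OF gA] by (simp add: q_def inv_mult_group)
    finally have "q (a \<otimes> b) \<otimes> g a b = g a b \<otimes> (inv (g a b) \<otimes> (q b \<otimes> q a))"
      using comm[OF qA[OF ab] gA[OF a b]] by simp
    also have "\<dots> = q b \<otimes> q a" using a b Ac[OF gA] Ac[OF qA] by (simp add: free_cancel)
    finally show ?thesis using comm a b by simp
  qed
  define h where "h = (\<lambda>a. f a \<otimes> q a)"
  \<comment> \<open>The factor \<open>q b\<close> lies in the abelian group \<open>A\<close>, so it
    does not affect the commutator with \<open>a\<close>, and the symmetry of \<open>g\<close>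
    carries over to \<open>h\<close>.\<close>
  have hg: "a \<otimes> h b \<otimes> inv a \<otimes> inv (h b) = g a b" if a: "a \<in> A" and b: "b \<in> A" for a b
  proof -
    have "a \<otimes> h b \<otimes> inv a \<otimes> inv (h b) = a \<otimes> f b \<otimes> (q b \<otimes> inv a) \<otimes> inv (q b) \<otimes> inv (f b)"
      using a b Bc[OF fB[OF b]] Ac[OF qA[OF b]] by (simp add: h_def m_assoc inv_mult_group)
    also have "q b \<otimes> inv a = inv a \<otimes> q b" using comm a b by simp
    also have "a \<otimes> f b \<otimes> (inv a \<otimes> q b) \<otimes> inv (q b) \<otimes> inv (f b) = g a b"
      using a b Bc[OF fB[OF b]] Ac[OF qA[OF b]] by (simp add: g_def m_assoc free_cancel)
    finally show ?thesis .
  qed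
  show thesis
  proof (rule that[of h])
    show "h a \<in> B" if "a \<in> A" for a using that by (simp add: h_def)
    show "h (a \<otimes> b) = h a \<otimes> h b" if a: "a \<in> A" and b: "b \<in> A" for a b
    proof -
      note c [simp] = Bc[OF fB[OF a]] Bc[OF fB[OF b]] Ac[OF qA[OF a]] Ac[OF qA[OF b]]
        Ac[OF gA[OF a b]] Ac[OF qA[OF Acl(1)[OF a b]]]
      have "h (a \<otimes> b) = f a \<otimes> (g a b \<otimes> f b) \<otimes> q (a \<otimes> b)" using fmul[OF a b] by (simp add: h_def)
      also have "g a b \<otimes> f b = f b \<otimes> g a b" using fw a b by simp
      also have "f a \<otimes> (f b \<otimes> g a b) \<otimes> q (a \<otimes> b) = f a \<otimes> f b \<otimes> (g a b \<otimes> q (a \<otimes> b))"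
        by (simp add: m_assoc)
      also have "g a b \<otimes> q (a \<otimes> b) = q a \<otimes> q b"
        using qmul[OF a b] comm[of "g a b" "q (a \<otimes> b)"] a b by simp
      also have "f a \<otimes> f b \<otimes> (q a \<otimes> q b) = f a \<otimes> (f b \<otimes> q a) \<otimes> q b" by (simp add: m_assoc)
      also have "f b \<otimes> q a = q a \<otimes> f b" using fw a b by simp
      finally show ?thesis by (simp add: h_def m_assoc)
    qed
    show "a \<otimes> h b \<otimes> inv a \<otimes> inv (h b) = b \<otimes> h a \<otimes> inv b \<otimes> inv (h a)"
      if "a \<in> A" "b \<in> A" for a b
      using hg gsym that by simp
    show "h b \<otimes> a \<otimes> inv (h b) \<in> A" if a: "a \<in> A" and b: "b \<in> A" for a b
    proof -
      have "h b \<otimes> a \<otimes> inv (h b) = f b \<otimes> (q b \<otimes> a \<otimes> inv (q b)) \<otimes> inv (f b)"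
        using a b Bc[OF fB[OF b]] Ac[OF qA[OF b]] by (simp add: h_def m_assoc inv_mult_group)
      then show ?thesis using norm[of "q b \<otimes> a \<otimes> inv (q b)" b] a b by simp
    qed
    show "h a \<in> A \<longleftrightarrow> f a \<in> A" if a: "a \<in> A" for a
    proof
      assume "h a \<in> A"
      then have "h a \<otimes> inv (q a) \<in> A" using a by simp
      then show "f a \<in> A" using Bc[OF fB[OF a]] Ac[OF qA[OF a]] by (simp add: h_def m_assoc)
    qed (use a in \<open>simp add: h_def\<close>)
  qed
qed

text \<open>With \<open>N\<close> the normaliser of \<open>A\<close> in \<open>B\<close>, the
  fixed-coset argument provides \<open>x\<close> outside \<open>N\<close> with
  \<open>[x, A] \<subseteq> N\<close>. An element \<open>w\<close> of \<open>A \<inter> B\<close>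
  has \<open>[x, w] \<in> A\<close>, hence lies in \<open>K\<close> and in \<open>D\<close>. As
  \<open>x\<close> does not normalise \<open>A\<close>, some \<open>[x, a]\<close> is outside
  \<open>A\<close>, and then \<open>h a\<close> is in \<open>D \<inter> B\<close> but not in
  \<open>A\<close>.\<close>

lemma glauberman_replacement:
  assumes fin: "finite (carrier G)" and p: "Factorial_Ring.prime p" "odd p"
    and A: "subgroup A G" "card A = p ^ n"
    and comm: "\<And>a b. a \<in> A \<Longrightarrow> b \<in> A \<Longrightarrow> a \<otimes> b = b \<otimes> a"
    and B: "subgroup B G" "card B = p ^ m"
    and AB: "\<And>a w. a \<in> A \<Longrightarrow> w \<in> B \<Longrightarrow> a \<otimes> w \<otimes> inv a \<in> B"
    and BA: "\<And>u v. u \<in> B \<Longrightarrow> v \<in> B \<Longrightarrow> u \<otimes> v \<otimes> inv u \<otimes> inv v \<in> A"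
    and BB: "\<And>u v w. u \<in> B \<Longrightarrow> v \<in> B \<Longrightarrow> w \<in> B \<Longrightarrow>
               (u \<otimes> v \<otimes> inv u \<otimes> inv v) \<otimes> w = w \<otimes> (u \<otimes> v \<otimes> inv u \<otimes> inv v)"
    and nn: "\<not> (\<forall>b\<in>B. \<forall>a\<in>A. b \<otimes> a \<otimes> inv b \<in> A)"
  shows "\<exists>D. subgroup D G \<and> (\<forall>c\<in>D. \<forall>d\<in>D. c \<otimes> d = d \<otimes> c) \<and> torsion_le G A D \<and>
    (\<forall>T. subgroup T G \<longrightarrow> A \<subseteq> T \<longrightarrow> B \<subseteq> T \<longrightarrow> D \<subseteq> T) \<and>
    A \<inter> B \<subset> D \<inter> B \<and> (\<forall>d\<in>D. \<forall>a\<in>A. d \<otimes> a \<otimes> inv d \<in> A)"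
proof -
  note Ac [simp] = subgroup.mem_carrier[OF A(1)]
    and Acl [simp] = subgroup.m_closed[OF A(1)] subgroup.m_inv_closed[OF A(1)]
  note Bc [simp] = subgroup.mem_carrier[OF B(1)]
    and Bcl [simp] = subgroup.m_closed[OF B(1)] subgroup.m_inv_closed[OF B(1)]
  have finA: "finite A" using finite_subset[OF subgroup.subset[OF A(1)] fin] .
  \<comment> \<open>Equality of the image with \<open>A\<close> makes closure under inverses
    immediate; as \<open>A\<close> is finite, inclusion suffices for membership
    (\<open>NI\<close>).\<close>
  define N where "N = {b \<in> B. conj_action G b ` A = A}"
  have Nim: "conj_action G b ` A = A" if "b \<in> carrier G" "\<And>a. a \<in> A \<Longrightarrow> b \<otimes> a \<otimes> inv b \<in> A" for b
  proof (rule card_subset_eq[OF finA])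
    show "conj_action G b ` A \<subseteq> A" using that by (auto simp: conj_action_def)
    have "inj_on (conj_action G b) A"
      using conj_action_in_mon[OF that(1)] subgroup.subset[OF A(1)] unfolding mon_def
      by (blast intro: inj_on_subset)
    then show "card (conj_action G b ` A) = card A" by (rule card_image)
  qed
  have NA: "b \<otimes> a \<otimes> inv b \<in> A" if "b \<in> N" "a \<in> A" for a b
  proof -
    have "conj_action G b a \<in> A" using that unfolding N_def by blast
    then show ?thesis by (simp add: conj_action_def)
  qed
  have NI: "b \<in> N" if "b \<in> B" "\<And>a. a \<in> A \<Longrightarrow> b \<otimes> a \<otimes> inv b \<in> A" for b
    unfolding N_def using that Nim by simp
  have NB: "b \<in> B" if "b \<in> N" for b using that by (simp add: N_def)
  have Asub: "A \<subseteq> carrier G" using subgroup.subset[OF A(1)] .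
  have N: "subgroup N G"
  proof (rule subgroupI)
    show "N \<subseteq> carrier G" using NB by auto
    have "\<one> \<in> N" by (rule NI) (simp_all add: subgroup.one_closed[OF B(1)])
    then show "N \<noteq> {}" by blast
    show "inv b \<in> N" if b: "b \<in> N" for b
    proof -
      have bB: "b \<in> B" using NB b .
      have "conj_action G (inv b) ` A = conj_action G (inv b) ` conj_action G b ` A"
        using b by (simp add: N_def)
      also have "\<dots> = A"
        using bB Asub conj_image_mult[of "inv b" b A, symmetric] by (simp add: conj_image_one)
      finally show ?thesis using bB by (simp add: N_def)
    qed
    show "b \<otimes> c \<in> N" if "b \<in> N" "c \<in> N" for b c
      using that Asub by (simp add: N_def conj_image_mult)
  qed
  have "N \<noteq> B" using nn NA by blast
  then have "N \<subset> B" using NB by blast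
  moreover have "a \<otimes> b \<otimes> inv a \<in> N" if a: "a \<in> A" and b: "b \<in> N" for a b
  proof (rule NI)
    show "a \<otimes> b \<otimes> inv a \<in> B" using AB a NB[OF b] .
    fix c assume c: "c \<in> A"
    have "a \<otimes> b \<otimes> inv a \<otimes> c \<otimes> inv (a \<otimes> b \<otimes> inv a) = a \<otimes> (b \<otimes> (inv a \<otimes> c \<otimes> a) \<otimes> inv b) \<otimes> inv a"
      using a c NB[OF b] by (simp add: m_assoc inv_mult_group)
    also have "\<dots> \<in> A" using NA[OF b, of "inv a \<otimes> c \<otimes> a"] a c by simp
    finally show "a \<otimes> b \<otimes> inv a \<otimes> c \<otimes> inv (a \<otimes> b \<otimes> inv a) \<in> A" .
  qed
  ultimately obtain x where x: "x \<in> B" "x \<notin> N" and xN: "\<And>a. a \<in> A \<Longrightarrow> x \<otimes> a \<otimes> inv x \<otimes> inv a \<in> N"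
    using ex_commutators_in_subgroup[OF fin p(1) A B N _ _ AB] by blast
  define f where "f = (\<lambda>a. x \<otimes> a \<otimes> inv x \<otimes> inv a)"
  have "odd (card A)" using A(2) p(2) by simp
  moreover have "f b \<otimes> a \<otimes> inv (f b) \<in> A" if "a \<in> A" "b \<in> A" for a b
    unfolding f_def by (rule NA[OF xN[OF that(2)] that(1)])
  ultimately obtain h where h: "\<And>a. a \<in> A \<Longrightarrow> h a \<in> B"
    "\<And>a b. a \<in> A \<Longrightarrow> b \<in> A \<Longrightarrow> h (a \<otimes> b) = h a \<otimes> h b"
    "\<And>a b. a \<in> A \<Longrightarrow> b \<in> A \<Longrightarrow> a \<otimes> h b \<otimes> inv a \<otimes> inv (h b) = b \<otimes> h a \<otimes> inv b \<otimes> inv (h a)"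
    "\<And>a b. a \<in> A \<Longrightarrow> b \<in> A \<Longrightarrow> h b \<otimes> a \<otimes> inv (h b) \<in> A"
    "\<And>a. a \<in> A \<Longrightarrow> h a \<in> A \<longleftrightarrow> f a \<in> A"
    using replacement_hom[OF A(1) finA _ comm B(1) AB BA BB x(1)] unfolding f_def by blast
  have hc [simp]: "h a \<in> carrier G" if "a \<in> A" for a using h(1)[OF that] by simp
  define K where "K = {a \<in> A. h a \<in> A}"
  have fAB: "f w \<in> A" if "w \<in> A" "w \<in> B" for w
    unfolding f_def using BA[OF x(1) that(2)] .
  have ABK: "w \<in> K" if "w \<in> A" "w \<in> B" for w using that fAB h(5) by (simp add: K_def)
  have hK: "h (h a) \<in> A" if "a \<in> A" "h a \<in> A" for a
    using ABK[OF that(2) h(1)[OF that(1)]] by (simp add: K_def)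
  \<comment> \<open>By symmetry \<open>[k, h b] = [b, h k]\<close>, and the latter is trivial
    because \<open>b\<close> and \<open>h k\<close> both lie in the abelian group
    \<open>A\<close>.\<close>
  have Kcomm: "k \<otimes> h b = h b \<otimes> k" if k: "k \<in> A" "h k \<in> A" and b: "b \<in> A" for k b
  proof -
    have "b \<otimes> h k = h k \<otimes> b" using comm k b by simp
    then have "b \<otimes> h k \<otimes> inv b \<otimes> inv (h k) = \<one>" using k b by (simp add: m_assoc)
    then have "k \<otimes> h b \<otimes> inv k \<otimes> inv (h b) = \<one>" using h(3)[of k b] k b by simp
    then have "k \<otimes> h b \<otimes> inv k \<otimes> inv (h b) \<otimes> (h b \<otimes> k) = h b \<otimes> k" using k b by simp
    then show ?thesis using k b by (simp add: m_assoc free_cancel)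
  qed
  define D where "D = {k \<otimes> h a | k a. k \<in> K \<and> a \<in> A}"
  note rep = replacement_of_hom[OF A(1) finA comm hc h(2) hK Kcomm, folded K_def, folded D_def]
  have oneA: "\<one> \<in> A" using subgroup.one_closed[OF A(1)] .
  have "h \<one> \<otimes> h \<one> = h \<one>" using h(2)[OF oneA oneA, symmetric] by simp
  then have h1: "h \<one> = \<one>" using hc[OF oneA] by simp
  have KD: "k \<in> D" if "k \<in> K" for k
  proof -
    have "k = k \<otimes> h \<one>" using that h1 by (simp add: K_def)
    then show ?thesis unfolding D_def using that oneA by blast
  qed
  have hD: "h a \<in> D" if "a \<in> A" for a
  proof -
    have "h a = \<one> \<otimes> h a" "\<one> \<in> K" using that h1 oneA by (simp_all add: K_def)
    then show ?thesis unfolding D_def using that by blast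
  qed
  show ?thesis
  proof (intro exI[of _ D] conjI ballI allI impI)
    show "subgroup D G" by (rule rep(1))
    show "torsion_le G A D" by (rule rep(3))
    show "c \<otimes> d = d \<otimes> c" if "c \<in> D" "d \<in> D" for c d by (rule rep(2)) (use that in simp_all)
    \<comment> \<open>With a Sylow subgroup for \<open>T\<close>, this keeps the replacement inside
      it.\<close>
    show "D \<subseteq> T" if T: "subgroup T G" "A \<subseteq> T" "B \<subseteq> T" for T
    proof
      fix d assume "d \<in> D"
      then obtain k a where ka: "k \<in> K" "a \<in> A" "d = k \<otimes> h a" by (auto simp: D_def)
      then have "k \<in> T" "h a \<in> T" using h(1)[of a] T by (auto simp: K_def)
      then show "d \<in> T" using ka subgroup.m_closed[OF T(1)] by simp
    qed
    obtain a where a: "a \<in> A" "x \<otimes> a \<otimes> inv x \<notin> A" using x NI by blast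
    have "f a \<notin> A"
    proof
      assume "f a \<in> A"
      then have "f a \<otimes> a \<in> A" using a by simp
      then show False using a x by (simp add: f_def m_assoc)
    qed
    then have "h a \<notin> A" using h(5) a by simp
    moreover have "A \<inter> B \<subseteq> D \<inter> B" using ABK KD by blast
    ultimately show "A \<inter> B \<subset> D \<inter> B" using hD[OF a(1)] h(1)[OF a(1)] by blast
    show "d \<otimes> b \<otimes> inv d \<in> A" if d: "d \<in> D" and b: "b \<in> A" for d b
    proof -
      obtain k a where ka: "k \<in> K" "a \<in> A" "d = k \<otimes> h a" using d by (auto simp: D_def)
      then have k: "k \<in> A" by (simp add: K_def)
      have "d \<otimes> b \<otimes> inv d = k \<otimes> (h a \<otimes> b \<otimes> inv (h a)) \<otimes> inv k"
        using ka k b by (simp add: m_assoc inv_mult_group)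
      then show ?thesis using h(4)[OF b ka(2)] k by simp
    qed
  qed
qed

section \<open>Normal \<open>p\<close>-subgroups and \<open>p\<close>-stability\<close>

text \<open>When \<open>M\<close> lies in \<open>B\<close> this is the preimage of the centre of
  \<open>B/M\<close>, expressed by commutators so that no quotient group is formed.\<close>

lemma central_mod_normal:
  assumes M: "M \<lhd> G" and B: "B \<lhd> G"
  shows "{y \<in> B. \<forall>b\<in>B. y \<otimes> b \<otimes> inv y \<otimes> inv b \<in> M} \<lhd> G" (is "?Y \<lhd> G")
proof -
  note MG = normal_imp_subgroup[OF M] and BG = normal_imp_subgroup[OF B]
  note Mc [simp] = subgroup.mem_carrier[OF MG] and Bc [simp] = subgroup.mem_carrier[OF BG]
    and [simp] = subgroup.m_closed[OF MG] subgroup.m_inv_closed[OF MG]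
      subgroup.m_closed[OF BG] subgroup.m_inv_closed[OF BG]
  have "subgroup ?Y G"
  proof (rule subgroupI)
    show "?Y \<subseteq> carrier G" by auto
    have "\<one> \<in> ?Y" using subgroup.one_closed[OF MG] subgroup.one_closed[OF BG] by simp
    then show "?Y \<noteq> {}" by blast
    show "inv y \<in> ?Y" if y: "y \<in> ?Y" for y
    proof -
      have "inv y \<otimes> b \<otimes> inv (inv y) \<otimes> inv b \<in> M" if b: "b \<in> B" for b
      proof -
        have "inv y \<otimes> inv (y \<otimes> b \<otimes> inv y \<otimes> inv b) \<otimes> y \<in> M"
          using y b by (intro normal.inv_op_closed1[OF M]) auto
        then show ?thesis using y b by (simp add: m_assoc inv_mult_group free_cancel)
      qed
      then show ?thesis using y by simp
    qed
    show "x \<otimes> y \<in> ?Y" if xy: "x \<in> ?Y" "y \<in> ?Y" for x y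
    proof -
      have "x \<otimes> y \<otimes> b \<otimes> inv (x \<otimes> y) \<otimes> inv b \<in> M" if b: "b \<in> B" for b
      proof -
        have "x \<otimes> y \<otimes> b \<otimes> inv (x \<otimes> y) \<otimes> inv b =
          (x \<otimes> (y \<otimes> b \<otimes> inv y \<otimes> inv b) \<otimes> inv x) \<otimes> (x \<otimes> b \<otimes> inv x \<otimes> inv b)"
          using xy b by (simp add: m_assoc inv_mult_group free_cancel)
        moreover have "x \<otimes> (y \<otimes> b \<otimes> inv y \<otimes> inv b) \<otimes> inv x \<in> M"
          using xy b by (intro normal.inv_op_closed2[OF M]) auto
        ultimately show ?thesis using xy b by simp
      qed
      then show ?thesis using xy by simp
    qed
  qed
  moreover have "g \<otimes> y \<otimes> inv g \<in> ?Y" if g: "g \<in> carrier G" and y: "y \<in> ?Y" for g y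
  proof -
    have yB: "y \<in> B" using y by simp
    have "g \<otimes> y \<otimes> inv g \<otimes> b \<otimes> inv (g \<otimes> y \<otimes> inv g) \<otimes> inv b \<in> M" if b: "b \<in> B" for b
    proof -
      have c: "inv g \<otimes> b \<otimes> g \<in> B" by (rule normal.inv_op_closed1[OF B g b])
      have "g \<otimes> y \<otimes> inv g \<otimes> b \<otimes> inv (g \<otimes> y \<otimes> inv g) \<otimes> inv b =
        g \<otimes> (y \<otimes> (inv g \<otimes> b \<otimes> g) \<otimes> inv y \<otimes> inv (inv g \<otimes> b \<otimes> g)) \<otimes> inv g"
        using g yB b by (simp add: m_assoc inv_mult_group free_cancel)
      also have "\<dots> \<in> M"
        using y c by (intro normal.inv_op_closed2[OF M g]) auto
      finally show ?thesis .
    qed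
    then show ?thesis using normal.inv_op_closed2[OF B g yB] by simp
  qed
  ultimately show ?thesis by (simp add: normal_inv_iff)
qed

text \<open>Take \<open>M\<close> maximal among the normal subgroups of \<open>G\<close> properly
  contained in \<open>B\<close>. The \<open>p\<close>-group \<open>B/M\<close> has a non-trivial
  centre, whose preimage is normal in \<open>G\<close> and larger than \<open>M\<close>, hence equal
  to \<open>B\<close>; so \<open>B/M\<close> is abelian.\<close>

lemma ex_normal_containing_commutators:
  assumes fin: "finite (carrier G)" and p: "Factorial_Ring.prime p"
    and B: "B \<lhd> G" "card B = p ^ m" "B \<noteq> {\<one>}"
  obtains M where "M \<lhd> G" "M \<subset> B"
    "\<And>u v. u \<in> B \<Longrightarrow> v \<in> B \<Longrightarrow> u \<otimes> v \<otimes> inv u \<otimes> inv v \<in> M"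
proof -
  note BG = normal_imp_subgroup[OF B(1)]
  have finB: "finite B" using finite_subset[OF subgroup.subset[OF BG] fin] .
  let ?\<M> = "{M. M \<lhd> G \<and> M \<subset> B}"
  have "finite ?\<M>" using finB by (auto intro: finite_subset[of _ "Pow B"])
  moreover have "{\<one>} \<in> ?\<M>" using one_is_normal B(3) subgroup.one_closed[OF BG] by blast
  ultimately obtain M where M': "M \<in> ?\<M>" "\<forall>M'\<in>?\<M>. M \<subseteq> M' \<longrightarrow> M = M'"
    using finite_has_maximal2 by meson
  then have M: "M \<lhd> G" "M \<subset> B" by simp_all
  have max: "M = M'" if "M' \<lhd> G" "M' \<subset> B" "M \<subseteq> M'" for M'
    using M'(2) that by simp
  let ?Y = "{y \<in> B. \<forall>b\<in>B. y \<otimes> b \<otimes> inv y \<otimes> inv b \<in> M}"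
  note MG = normal_imp_subgroup[OF M(1)]
  have Y: "?Y \<lhd> G" by (rule central_mod_normal[OF M(1) B(1)])
  have "\<exists>x\<in>B - M. \<forall>a\<in>B. x \<otimes> a \<otimes> inv x \<otimes> inv a \<in> M"
    by (rule ex_commutators_in_subgroup[OF fin p BG B(2) BG B(2) MG M(2)])
      (simp_all add: normal.inv_op_closed2[OF M(1)] normal.inv_op_closed2[OF B(1)]
         subgroup.mem_carrier[OF BG])
  then obtain x where x: "x \<in> ?Y" "x \<notin> M" by blast
  have "M \<subseteq> ?Y"
  proof
    fix y assume y: "y \<in> M"
    have "y \<otimes> b \<otimes> inv y \<otimes> inv b \<in> M" if b: "b \<in> B" for b
    proof -
      have bc: "b \<in> carrier G" using subgroup.mem_carrier[OF BG b] .
      have "b \<otimes> inv y \<otimes> inv b \<in> M"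
        using normal.inv_op_closed2[OF M(1) bc] subgroup.m_inv_closed[OF MG y] by blast
      then have "y \<otimes> (b \<otimes> inv y \<otimes> inv b) \<in> M" using subgroup.m_closed[OF MG y] by blast
      then show ?thesis using bc subgroup.mem_carrier[OF MG y] by (simp add: m_assoc)
    qed
    then show "y \<in> ?Y" using y M(2) by blast
  qed
  moreover have "M \<noteq> ?Y" using x by blast
  ultimately have "\<not> ?Y \<subset> B" using max[OF Y] by blast
  then have "?Y = B" by blast
  then show thesis using that[OF M] by blast
qed

section \<open>The largest normal subgroup that stabilises a given set\<close>

definition conj_stabilizer_core :: "'a set \<Rightarrow> 'a set" where
  "conj_stabilizer_core Z =
     {x \<in> carrier G. \<forall>g\<in>carrier G. conj_action G (g \<otimes> x \<otimes> inv g) ` Z = Z}"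

lemma conj_stabilizer_core_normal:
  assumes Z: "Z \<subseteq> carrier G"
  shows "conj_stabilizer_core Z \<lhd> G"
proof -
  let ?L = "conj_stabilizer_core Z"
  have "subgroup ?L G"
  proof (rule subgroupI)
    show "?L \<subseteq> carrier G" by (auto simp: conj_stabilizer_core_def)
    have "\<one> \<in> ?L" using Z by (simp add: conj_stabilizer_core_def conj_image_one)
    then show "?L \<noteq> {}" by blast
    show "inv x \<in> ?L" if x: "x \<in> ?L" for x
    proof -
      have xc: "x \<in> carrier G" using x by (simp add: conj_stabilizer_core_def)
      have "conj_action G (g \<otimes> inv x \<otimes> inv g) ` Z = Z" if g: "g \<in> carrier G" for g
      proof -
        have gx: "conj_action G (g \<otimes> x \<otimes> inv g) ` Z = Z" using x g by (simp add: conj_stabilizer_core_def)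
        have "conj_action G (g \<otimes> inv x \<otimes> inv g) ` Z
            = conj_action G (g \<otimes> inv x \<otimes> inv g) ` conj_action G (g \<otimes> x \<otimes> inv g) ` Z"
          by (simp only: gx)
        also have "\<dots> = conj_action G (g \<otimes> inv x \<otimes> inv g \<otimes> (g \<otimes> x \<otimes> inv g)) ` Z"
          using g xc Z by (intro conj_image_mult[symmetric]) auto
        also have "g \<otimes> inv x \<otimes> inv g \<otimes> (g \<otimes> x \<otimes> inv g) = \<one>"
          using g xc by (simp add: m_assoc free_cancel)
        finally show ?thesis using Z by (simp add: conj_image_one)
      qed
      then show ?thesis using xc by (simp add: conj_stabilizer_core_def)
    qed
    show "x \<otimes> y \<in> ?L" if xy: "x \<in> ?L" "y \<in> ?L" for x y
    proof -
      have c: "x \<in> carrier G" "y \<in> carrier G" using xy by (simp_all add: conj_stabilizer_core_def)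
      have "conj_action G (g \<otimes> (x \<otimes> y) \<otimes> inv g) ` Z = Z" if g: "g \<in> carrier G" for g
      proof -
        have "g \<otimes> (x \<otimes> y) \<otimes> inv g = (g \<otimes> x \<otimes> inv g) \<otimes> (g \<otimes> y \<otimes> inv g)"
          using g c by (simp add: m_assoc free_cancel)
        then have "conj_action G (g \<otimes> (x \<otimes> y) \<otimes> inv g) ` Z
            = conj_action G (g \<otimes> x \<otimes> inv g) ` conj_action G (g \<otimes> y \<otimes> inv g) ` Z"
          using g c Z by (simp add: conj_image_mult)
        also have "\<dots> = Z" using xy g by (simp add: conj_stabilizer_core_def)
        finally show ?thesis .
      qed
      then show ?thesis using c by (simp add: conj_stabilizer_core_def)
    qed
  qed
  moreover have "h \<otimes> x \<otimes> inv h \<in> ?L" if h: "h \<in> carrier G" and x: "x \<in> ?L" for h x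
  proof -
    have xc: "x \<in> carrier G" using x by (simp add: conj_stabilizer_core_def)
    have "conj_action G (g \<otimes> (h \<otimes> x \<otimes> inv h) \<otimes> inv g) ` Z = Z" if g: "g \<in> carrier G" for g
    proof -
      have "g \<otimes> (h \<otimes> x \<otimes> inv h) \<otimes> inv g = (g \<otimes> h) \<otimes> x \<otimes> inv (g \<otimes> h)"
        using g h xc by (simp add: m_assoc inv_mult_group)
      then show ?thesis using x g h by (simp add: conj_stabilizer_core_def)
    qed
    then show ?thesis using xc h by (simp add: conj_stabilizer_core_def)
  qed
  ultimately show ?thesis by (simp add: normal_inv_iff)
qed

lemma conj_stabilizer_core_fixes:
  assumes Z: "Z \<subseteq> carrier G" and x: "x \<in> conj_stabilizer_core Z"
  shows "conj_action G x ` Z = Z"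
proof -
  have "conj_action G (\<one> \<otimes> x \<otimes> inv \<one>) ` Z = Z"
    using x unfolding conj_stabilizer_core_def by blast
  then show ?thesis using x by (simp add: conj_stabilizer_core_def)
qed

text \<open>By \<open>p\<close>-stability \<open>x\<close> lies in the normal subgroup
  \<open>?K\<close>, the preimage of \<open>O_p(G/C_G(B))\<close>. The conjugates of
  \<open>Z\<close> are subsets of \<open>B\<close>, so \<open>C_G(B)\<close> fixes each of them, and
  \<open>?K\<close> normalises \<open>Z\<close> because its quotient by \<open>C_G(B)\<close> is a
  \<open>p\<close>-group. All conjugates of \<open>x\<close> stay in \<open>?K\<close>.\<close>

lemma quadratic_in_conj_stabilizer_core:
  assumes fin: "finite (carrier G)" and p: "Factorial_Ring.prime p"
    and S: "sylow_subgroup p S G" and B: "B \<lhd> G"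
    and stable: "p_stable_action p G (G\<lparr>carrier := B\<rparr>) (conj_action G)"
    and Z: "Z \<subseteq> B" and SZ: "\<And>s. s \<in> S \<Longrightarrow> conj_action G s ` Z = Z"
    and x: "x \<in> carrier G" "acts_quadratically G (G\<lparr>carrier := B\<rparr>) (conj_action G) x"
  shows "x \<in> conj_stabilizer_core Z"
proof -
  let ?C = "act_centralizer G (G\<lparr>carrier := B\<rparr>) (conj_action G)"
  let ?K = "{g \<in> carrier G. ?C #> g \<in> p_core p (G Mod ?C)}"
  note Bc = subgroup.mem_carrier[OF normal_imp_subgroup[OF B]]
  have Zc: "Z \<subseteq> carrier G" using Z Bc by blast
  have C: "?C \<lhd> G" by (rule act_centralizer_conj_normal[OF B])
  note K = p_core_preimage[OF fin p C]
  obtain n where n: "card ?K = p ^ n * card ?C" using K(3) by blast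
  have xK: "x \<in> ?K" using stable x by (simp add: p_stable_action_def act_p_core_def)
  have triv: "conj_action G c ` conj_action G g ` Z = conj_action G g ` Z"
    if c: "c \<in> ?C" and g: "g \<in> carrier G" for c g
  proof -
    have "conj_action G c w = w" if "w \<in> conj_action G g ` Z" for w
    proof -
      have "w \<in> B" using that Z normal.inv_op_closed2[OF B g] by (auto simp: conj_action_def)
      then show ?thesis using c by (simp add: act_centralizer_def)
    qed
    then show ?thesis by simp
  qed
  have "conj_action G (g \<otimes> x \<otimes> inv g) ` Z = Z" if g: "g \<in> carrier G" for g
    using normal_p_extension_normalises[OF fin p S Zc SZ K(1) normal_imp_subgroup[OF C] K(2) n triv
      normal.inv_op_closed2[OF K(1) g xK]] .
  then show ?thesis using x by (simp add: conj_stabilizer_core_def)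
qed

end

section \<open>Intersections of upward closed families\<close>

lemma torsion_le_image:
  assumes G: "group G" and H: "group H" and \<theta>: "\<theta> \<in> hom G H" "inj_on \<theta> (carrier G)"
    and A: "A \<subseteq> carrier G"
  shows "card (\<theta> ` A) = card A"
    "card {x \<in> \<theta> ` A. x [^]\<^bsub>H\<^esub> (n::nat) = \<one>\<^bsub>H\<^esub>} = card {x \<in> A. x [^]\<^bsub>G\<^esub> n = \<one>\<^bsub>G\<^esub>}"
proof -
  interpret \<theta>: group_hom G H \<theta> by (rule group_hom.intro[OF G H]) (simp add: group_hom_axioms_def \<theta>)
  have inj: "inj_on \<theta> A" using \<theta>(2) A by (rule inj_on_subset)
  show "card (\<theta> ` A) = card A" by (rule card_image[OF inj])
  have "\<theta> x [^]\<^bsub>H\<^esub> n = \<one>\<^bsub>H\<^esub> \<longleftrightarrow> x [^]\<^bsub>G\<^esub> n = \<one>\<^bsub>G\<^esub>" if "x \<in> A" for x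
  proof -
    have x: "x \<in> carrier G" using that A by blast
    have "\<theta> (x [^]\<^bsub>G\<^esub> n) = \<theta> \<one>\<^bsub>G\<^esub> \<longleftrightarrow> x [^]\<^bsub>G\<^esub> n = \<one>\<^bsub>G\<^esub>"
      using \<theta>(2) x by (intro inj_on_eq_iff[of \<theta> "carrier G"]) auto
    then show ?thesis using x by (simp add: \<theta>.hom_nat_pow)
  qed
  then have "{x \<in> \<theta> ` A. x [^]\<^bsub>H\<^esub> n = \<one>\<^bsub>H\<^esub>} = \<theta> ` {x \<in> A. x [^]\<^bsub>G\<^esub> n = \<one>\<^bsub>G\<^esub>}" by auto
  moreover have "inj_on \<theta> {x \<in> A. x [^]\<^bsub>G\<^esub> n = \<one>\<^bsub>G\<^esub>}"
    using inj by (rule inj_on_subset) blast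
  ultimately show "card {x \<in> \<theta> ` A. x [^]\<^bsub>H\<^esub> n = \<one>\<^bsub>H\<^esub>} = card {x \<in> A. x [^]\<^bsub>G\<^esub> n = \<one>\<^bsub>G\<^esub>}"
    by (simp add: card_image)
qed

text \<open>Here \<open>S\<close> is a literal subgroup of the overgroup \<open>G\<close>. Upward
  closure replaces any knowledge of how \<open>\<A>\<close> was defined, and \<open>nonempty\<close>
  makes the intersection a subgroup of \<open>S\<close>.\<close>

locale p_stable_group = group G for G (structure) +
  fixes p :: nat and S :: "'a set" and \<A> :: "'a set set"
  assumes fin: "finite (carrier G)"
    and p: "Factorial_Ring.prime p" "odd p"
    and S: "sylow_subgroup p S G"
    and constrained: "centralizer G (p_core p G) \<subseteq> p_core p G"
    and stable: "\<And>P. P \<lhd> G \<Longrightarrow> p_group p (G\<lparr>carrier := P\<rparr>) \<Longrightarrow>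
                   p_stable_action p G (G\<lparr>carrier := P\<rparr>) (conj_action G)"
    and nonempty: "\<A> \<noteq> {}"
    and \<A>_subgroup: "\<And>A. A \<in> \<A> \<Longrightarrow> subgroup A G"
    and \<A>_le: "\<And>A. A \<in> \<A> \<Longrightarrow> A \<subseteq> S"
    and \<A>_comm: "\<And>A a b. A \<in> \<A> \<Longrightarrow> a \<in> A \<Longrightarrow> b \<in> A \<Longrightarrow> a \<otimes> b = b \<otimes> a"
    and \<A>_upward: "\<And>A D. A \<in> \<A> \<Longrightarrow> subgroup D G \<Longrightarrow> D \<subseteq> S \<Longrightarrow>
             (\<And>a b. a \<in> D \<Longrightarrow> b \<in> D \<Longrightarrow> a \<otimes> b = b \<otimes> a) \<Longrightarrow> torsion_le G A D \<Longrightarrow> D \<in> \<A>"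
begin

section \<open>The intersection \<open>Z\<close> and its invariance under \<open>S\<close>\<close>

abbreviation Z :: "'a set" where "Z \<equiv> \<Inter>\<A>"

lemma S_subgroup: "subgroup S G"
  using S by (simp add: sylow_subgroup_def)

lemma finite_\<A>: "finite \<A>"
proof (rule finite_subset)
  show "\<A> \<subseteq> Pow (carrier G)" using \<A>_subgroup subgroup.subset by blast
qed (use fin in simp)

lemma Z_subgroup: "subgroup Z G"
  using \<A>_subgroup nonempty by (rule subgroups_Inter)

lemma Z_comm: "a \<in> Z \<Longrightarrow> b \<in> Z \<Longrightarrow> a \<otimes> b = b \<otimes> a"
  using nonempty \<A>_comm by blast

lemma Z_carrier: "a \<in> Z \<Longrightarrow> a \<in> carrier G"
  by (rule subgroup.mem_carrier[OF Z_subgroup])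

lemma \<A>_card: "A \<in> \<A> \<Longrightarrow> \<exists>n. card A = p ^ n"
  using card_subgroups_dvd[OF \<A>_subgroup S_subgroup \<A>_le] S
  unfolding sylow_subgroup_def using divides_primepow_nat[OF p(1)] by metis

text \<open>Injective homomorphisms preserve all torsion counts, so upward closure applies to the
  image. The map may move \<open>S\<close>, which allows a conjugate of a member of
  \<open>\<A>\<close> to be brought back into the family.\<close>

lemma \<A>_image:
  assumes A: "A \<in> \<A>" and \<theta>: "\<theta> \<in> mon G G" and le: "\<theta> ` A \<subseteq> S"
  shows "\<theta> ` A \<in> \<A>"
proof (rule \<A>_upward[OF A])
  have hom: "\<theta> \<in> hom G G" and inj: "inj_on \<theta> (carrier G)" using \<theta> by (auto simp: mon_def)
  interpret \<theta>: group_hom G G \<theta> by unfold_locales (rule hom)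
  show "subgroup (\<theta> ` A) G" by (rule \<theta>.subgroup_img_is_subgroup[OF \<A>_subgroup[OF A]])
  show "a \<otimes> b = b \<otimes> a" if "a \<in> \<theta> ` A" "b \<in> \<theta> ` A" for a b
  proof -
    have "\<theta> x \<otimes> \<theta> y = \<theta> y \<otimes> \<theta> x" if "x \<in> A" "y \<in> A" for x y
      using \<A>_comm[OF A that] subgroup.mem_carrier[OF \<A>_subgroup[OF A]] that
      by (metis \<theta>.hom_mult)
    then show ?thesis using that by blast
  qed
  show "torsion_le G A (\<theta> ` A)"
    using torsion_le_image[OF is_group is_group hom inj subgroup.subset[OF \<A>_subgroup[OF A]]]
    by (simp add: torsion_le_def)
qed (rule le)

text \<open>\<open>\<theta>\<close> induces an injective map of the finite family
  \<open>\<A>\<close> to itself, hence a permutation of it, and so maps the intersection into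
  itself.\<close>

lemma Z_image:
  assumes \<theta>: "\<theta> \<in> mon G G" and le: "\<theta> ` S \<subseteq> S"
  shows "\<theta> ` Z = Z"
proof (rule card_subset_eq)
  have inj: "inj_on \<theta> (carrier G)" using \<theta> by (auto simp: mon_def)
  show "finite Z" using finite_subset[OF subgroup.subset[OF Z_subgroup] fin] .
  show "card (\<theta> ` Z) = card Z"
    using inj_on_subset[OF inj subgroup.subset[OF Z_subgroup]] by (rule card_image)
  have "(\<lambda>A. \<theta> ` A) ` \<A> = \<A>"
  proof (rule card_subset_eq[OF finite_\<A>])
    show "(\<lambda>A. \<theta> ` A) ` \<A> \<subseteq> \<A>"
    proof (rule image_subsetI)
      fix A assume A: "A \<in> \<A>"
      show "\<theta> ` A \<in> \<A>" by (rule \<A>_image[OF A \<theta>]) (use \<A>_le[OF A] le in blast)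
    qed
    have "inj_on (\<lambda>A. \<theta> ` A) \<A>"
    proof (rule inj_onI)
      fix A B assume "A \<in> \<A>" "B \<in> \<A>" "\<theta> ` A = \<theta> ` B"
      then show "A = B"
        using inj_on_image_eq_iff[OF inj] subgroup.subset[OF \<A>_subgroup] by blast
    qed
    then show "card ((\<lambda>A. \<theta> ` A) ` \<A>) = card \<A>" by (rule card_image)
  qed
  then show "\<theta> ` Z \<subseteq> Z" by blast
qed

lemma Z_conj_S:
  assumes s: "s \<in> S"
  shows "conj_action G s ` Z = Z"
proof (rule Z_image[OF conj_action_in_mon])
  show "s \<in> carrier G" by (rule subgroup.mem_carrier[OF S_subgroup s])
  show "conj_action G s ` S \<subseteq> S"
    using s S_subgroup by (auto simp: conj_action_def subgroup.m_closed subgroup.m_inv_closed)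
qed

lemma le_S: "N \<lhd> G \<Longrightarrow> p_group p (G\<lparr>carrier := N\<rparr>) \<Longrightarrow> N \<subseteq> S"
  by (rule normal_p_subgroup_le_sylow[OF fin p(1) S])

lemma conj_normal_Int:
  assumes B: "B \<lhd> G" and s: "s \<in> S"
  shows "conj_action G s ` (Z \<inter> B) = Z \<inter> B"
proof (rule card_subset_eq)
  have sc: "s \<in> carrier G" by (rule subgroup.mem_carrier[OF S_subgroup s])
  show "finite (Z \<inter> B)" using finite_subset[OF subgroup.subset[OF Z_subgroup] fin] by simp
  show "conj_action G s ` (Z \<inter> B) \<subseteq> Z \<inter> B"
    using Z_conj_S[OF s] normal.inv_op_closed2[OF B sc] by (auto simp: conj_action_def image_iff)
  have "inj_on (conj_action G s) (Z \<inter> B)"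
    using conj_action_in_mon[OF sc] Z_carrier unfolding mon_def by (auto intro: inj_on_subset)
  then show "card (conj_action G s ` (Z \<inter> B)) = card (Z \<inter> B)" by (rule card_image)
qed

section \<open>Normality of the intersections of \<open>Z\<close> with normal
  \<open>p\<close>-subgroups\<close>

text \<open>If the normal closure of \<open>Z \<inter> B\<close> is smaller than \<open>B\<close>,
  the induction hypothesis for it suffices. Otherwise \<open>B\<close> is generated by the
  conjugates of \<open>Z \<inter> B\<close>, and the aim becomes
  \<open>B \<subseteq> Z\<close>.\<close>

lemma normal_Z_Int_step:
  assumes B: "B \<lhd> G" "p_group p (G\<lparr>carrier := B\<rparr>)"
    and IH: "\<And>M. M \<lhd> G \<Longrightarrow> p_group p (G\<lparr>carrier := M\<rparr>) \<Longrightarrow> M \<subset> B \<Longrightarrow> Z \<inter> M \<lhd> G"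
  shows "Z \<inter> B \<lhd> G"
proof -
  note BG = normal_imp_subgroup[OF B(1)]
  note Bc = subgroup.mem_carrier[OF BG]
  let ?Z = "Z \<inter> B"
  have ZG: "subgroup ?Z G" by (rule subgroups_Inter_pair[OF Z_subgroup BG])
  have Zc: "?Z \<subseteq> carrier G" using Bc by blast
  have BS: "B \<subseteq> S" by (rule le_S[OF B])
  obtain m where m: "card B = p ^ m" using B(2) by (auto simp: p_group_carrier_iff)
  define C where "C = (\<Union>g\<in>carrier G. conj_action G g ` ?Z)"
  have CB: "C \<subseteq> B" using normal.inv_op_closed2[OF B(1)] by (auto simp: C_def conj_action_def)
  have ZC: "?Z \<subseteq> C" using conj_image_one[OF Zc] unfolding C_def by blast
  have gen: "generate G C \<lhd> G"
  proof (rule normal_generateI)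
    show "C \<subseteq> carrier G" using CB Bc by blast
    show "g \<otimes> c \<otimes> inv g \<in> C" if c: "c \<in> C" and g: "g \<in> carrier G" for c g
    proof -
      obtain k z where k: "k \<in> carrier G" "z \<in> ?Z" "c = conj_action G k z" using c unfolding C_def by blast
      then have "g \<otimes> c \<otimes> inv g = conj_action G (g \<otimes> k) z"
        using g Zc by (simp add: conj_action_mult Bc) (simp add: conj_action_def)
      then show ?thesis using k g unfolding C_def by blast
    qed
  qed
  have genB: "generate G C \<subseteq> B" by (rule generate_subgroup_incl[OF CB BG])
  show ?thesis
  proof (cases "generate G C = B")
    case False
    then have lt: "generate G C \<subset> B" using genB by blast
    have "p_group p (G\<lparr>carrier := generate G C\<rparr>)"
      by (rule p_group_subgroup[OF p(1) BG B(2) normal_imp_subgroup[OF gen] genB])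
    then have "Z \<inter> generate G C \<lhd> G" using IH gen lt by blast
    moreover have "Z \<inter> generate G C = ?Z" using genB ZC generate.incl[of _ C G] by blast
    ultimately show ?thesis by simp
  next
    case gB: True
    \<comment> \<open>The device for proving facts about \<open>B\<close>: it is enough to check
      them on the conjugates of \<open>Z \<inter> B\<close>.\<close>
    have in_B: "B \<subseteq> T" if "subgroup T G" "C \<subseteq> T" for T
      using generate_subgroup_incl[OF that(2,1)] gB by simp
    show ?thesis
    proof (cases "B = {\<one>}")
      case True
      then have "?Z = {\<one>}" using subgroup.one_closed[OF ZG] by blast
      then show ?thesis using one_is_normal by simp
    next
      case False
      obtain M where M: "M \<lhd> G" "M \<subset> B"
        and BM: "\<And>u v. u \<in> B \<Longrightarrow> v \<in> B \<Longrightarrow> u \<otimes> v \<otimes> inv u \<otimes> inv v \<in> M"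
        using ex_normal_containing_commutators[OF fin p(1) B(1) m False] by blast
      have "p_group p (G\<lparr>carrier := M\<rparr>)"
        using p_group_subgroup[OF p(1) BG B(2) normal_imp_subgroup[OF M(1)]] M(2) by blast
      then have W: "Z \<inter> M \<lhd> G" using IH M by blast
      define W where "W = Z \<inter> M"
      note W = W[folded W_def]
      note WG = normal_imp_subgroup[OF W]
      have WZ: "W \<subseteq> Z" unfolding W_def by blast
      \<comment> \<open>The commutator lies in \<open>Z\<close> because \<open>B\<close>, as a
        subgroup of \<open>S\<close>, normalises \<open>Z\<close>, and in \<open>M\<close> because
        \<open>B/M\<close> is abelian.\<close>
      have ZBW: "z \<otimes> b \<otimes> inv z \<otimes> inv b \<in> W" if z: "z \<in> ?Z" and b: "b \<in> B" for z b
      proof -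
        have "conj_action G b (inv z) \<in> Z"
          using Z_conj_S[of b] b BS subgroup.m_inv_closed[OF Z_subgroup, of z] z by blast
        then have "z \<otimes> (b \<otimes> inv z \<otimes> inv b) \<in> Z"
          using subgroup.m_closed[OF Z_subgroup, of z] z by (simp add: conj_action_def)
        then have "z \<otimes> b \<otimes> inv z \<otimes> inv b \<in> Z" using z b Bc by (simp add: m_assoc)
        then show ?thesis using BM[of z b] z b unfolding W_def by blast
      qed
      \<comment> \<open>\<open>?Y\<close> is normal in \<open>G\<close> and contains
        \<open>Z \<inter> B\<close>, hence all conjugates of it; so \<open>B/W\<close> is
        abelian.\<close>
      have "B \<subseteq> {y \<in> B. \<forall>b\<in>B. y \<otimes> b \<otimes> inv y \<otimes> inv b \<in> W}" (is "_ \<subseteq> ?Y")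
      proof (rule in_B)
        show "subgroup ?Y G" using central_mod_normal[OF W B(1)] by (rule normal_imp_subgroup)
        have Yn: "?Y \<lhd> G" by (rule central_mod_normal[OF W B(1)])
        show "C \<subseteq> ?Y"
        proof
          fix c assume "c \<in> C"
          then obtain g z where g: "g \<in> carrier G" "z \<in> ?Z" "c = conj_action G g z" unfolding C_def by blast
          have "z \<in> ?Y" using ZBW g(2) by blast
          then have "g \<otimes> z \<otimes> inv g \<in> ?Y" by (rule normal.inv_op_closed2[OF Yn g(1)])
          then show "c \<in> ?Y" using g by (simp add: conj_action_def)
        qed
      qed
      then have BW: "\<And>u v. u \<in> B \<Longrightarrow> v \<in> B \<Longrightarrow> u \<otimes> v \<otimes> inv u \<otimes> inv v \<in> W" by blast
      \<comment> \<open>As \<open>W\<close> is normal in \<open>G\<close> and lies in the abelian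
        group \<open>Z\<close>, each conjugate of \<open>Z \<inter> B\<close> centralises it:
        conjugate back, commute inside \<open>Z\<close>, and return.\<close>
      have "B \<subseteq> {u \<in> carrier G. \<forall>w\<in>W. w \<otimes> u = u \<otimes> w}" (is "_ \<subseteq> ?T")
      proof (rule in_B)
        have Wc [simp]: "w \<in> carrier G" if "w \<in> W" for w by (rule subgroup.mem_carrier[OF WG that])
        show "subgroup ?T G"
        proof (rule subgroupI)
          show "?T \<noteq> {}" using Wc by force
          show "inv u \<in> ?T" if u: "u \<in> ?T" for u
          proof -
            have "w \<otimes> inv u = inv u \<otimes> w" if w: "w \<in> W" for w
            proof -
              have uc: "u \<in> carrier G" "w \<in> carrier G" using u w by simp_all
              have "w \<otimes> inv u = inv u \<otimes> (u \<otimes> w) \<otimes> inv u" using u w by (simp add: m_assoc free_cancel)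
              also have "u \<otimes> w = w \<otimes> u" using u w by simp
              also have "inv u \<otimes> (w \<otimes> u) \<otimes> inv u = inv u \<otimes> w" using uc by (simp add: m_assoc)
              finally show ?thesis .
            qed
            then show ?thesis using u by simp
          qed
          show "u \<otimes> v \<in> ?T" if uv: "u \<in> ?T" "v \<in> ?T" for u v
          proof -
            have "w \<otimes> (u \<otimes> v) = u \<otimes> v \<otimes> w" if w: "w \<in> W" for w
            proof -
              have c: "u \<in> carrier G" "v \<in> carrier G" "w \<in> carrier G" using uv w by simp_all
              then have "w \<otimes> (u \<otimes> v) = w \<otimes> u \<otimes> v" by (simp add: m_assoc)
              also have "w \<otimes> u = u \<otimes> w" using uv w by simp
              also have "u \<otimes> w \<otimes> v = u \<otimes> (w \<otimes> v)" using c by (simp add: m_assoc)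
              also have "w \<otimes> v = v \<otimes> w" using uv w by simp
              also have "u \<otimes> (v \<otimes> w) = u \<otimes> v \<otimes> w" using c by (simp add: m_assoc)
              finally show ?thesis .
            qed
            then show ?thesis using uv by simp
          qed
        qed auto
        show "C \<subseteq> ?T"
        proof
          fix c assume "c \<in> C"
          then obtain g z where g: "g \<in> carrier G" "z \<in> ?Z" "c = conj_action G g z" unfolding C_def by blast
          have zc: "z \<in> carrier G" using g Zc by blast
          have "w \<otimes> c = c \<otimes> w" if w: "w \<in> W" for w
          proof -
            let ?w = "inv g \<otimes> w \<otimes> g"
            have "?w \<in> Z" using normal.inv_op_closed1[OF W g(1) w] WZ by blast
            then have "?w \<otimes> z = z \<otimes> ?w" using Z_comm g(2) by blast
            then have "g \<otimes> (?w \<otimes> z) \<otimes> inv g = g \<otimes> (z \<otimes> ?w) \<otimes> inv g" by simp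
            then show ?thesis using g zc w by (simp add: conj_action_def m_assoc free_cancel)
          qed
          then show "c \<in> ?T" using g zc by simp
        qed
      qed
      then have Wcentral: "\<And>w u. w \<in> W \<Longrightarrow> u \<in> B \<Longrightarrow> w \<otimes> u = u \<otimes> w" by blast
      define L where "L = conj_stabilizer_core ?Z"
      have L: "L \<lhd> G" unfolding L_def by (rule conj_stabilizer_core_normal[OF Zc])
      \<comment> \<open>An abelian subgroup normalised by \<open>B\<close> acts quadratically on
        \<open>B\<close>, and \<open>Z \<inter> B\<close> is invariant under \<open>S\<close>, so
        \<open>p\<close>-stability applies.\<close>
      have quad: "A \<subseteq> L" if A: "A \<in> \<A>" and nA: "\<forall>b\<in>B. \<forall>a\<in>A. b \<otimes> a \<otimes> inv b \<in> A" for A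
      proof
        fix a assume a: "a \<in> A"
        show "a \<in> L" unfolding L_def
        proof (rule quadratic_in_conj_stabilizer_core[OF fin p(1) S B(1) stable[OF B]])
          show "a \<in> carrier G" using \<A>_subgroup[OF A] a by (rule subgroup.mem_carrier)
          show "acts_quadratically G (G\<lparr>carrier := B\<rparr>) (conj_action G) a"
            by (rule acts_quadratically_of_abelian[OF \<A>_subgroup[OF A] \<A>_comm[OF A] B(1) _ a])
              (use nA in simp_all)
        qed (use conj_normal_Int[OF B(1)] in auto)
      qed
      \<comment> \<open>For a generator \<open>g z g^-1\<close> of \<open>B\<close>, the conjugate
        of \<open>D\<close> by \<open>g^-1\<close> still lies in the normal subgroup
        \<open>L\<close>, and some \<open>l \<in> L\<close> moves it into \<open>S\<close>. The
        result is a member of \<open>\<A>\<close>, so it contains \<open>Z \<inter> B\<close> and in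
        particular \<open>l z l^-1\<close>, as \<open>l\<close> stabilises
        \<open>Z \<inter> B\<close>. Undoing both conjugations gives
        \<open>g z g^-1 \<in> D\<close>.\<close>
      have contains: "B \<subseteq> D" if D: "D \<in> \<A>" and DL: "D \<subseteq> L" for D
      proof (rule in_B[OF \<A>_subgroup[OF D]])
        note Dc = subgroup.mem_carrier[OF \<A>_subgroup[OF D]]
        have Dsub: "D \<subseteq> carrier G" using Dc by blast
        show "C \<subseteq> D"
        proof
          fix c assume "c \<in> C"
          then obtain g z where g: "g \<in> carrier G" "z \<in> ?Z" "c = conj_action G g z" unfolding C_def by blast
          let ?P = "conj_action G (inv g) ` D"
          have homg: "group_hom G G (conj_action G (inv g))"
            using conj_action_in_mon[of "inv g"] g by unfold_locales (simp add: mon_def)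
          have PG: "subgroup ?P G" by (rule group_hom.subgroup_img_is_subgroup[OF homg \<A>_subgroup[OF D]])
          have PL: "?P \<subseteq> L"
            using DL normal.inv_op_closed2[OF L, of "inv g"] g by (auto simp: conj_action_def)
          obtain n where n: "card D = p ^ n" using \<A>_card[OF D] by blast
          have "card ?P = card D"
            using conj_action_in_mon[of "inv g"] g Dsub unfolding mon_def
            by (intro card_image) (auto intro: inj_on_subset)
          then obtain l where l: "l \<in> L" "\<forall>x\<in>?P. l \<otimes> x \<otimes> inv l \<in> S"
            using ex_conj_into_sylow[OF fin p(1) S L PG PL] n by auto
          have lc: "l \<in> carrier G" by (rule subgroup.mem_carrier[OF normal_imp_subgroup[OF L] l(1)])
          have "conj_action G (l \<otimes> inv g) ` D = conj_action G l ` ?P"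
            using lc g Dsub by (simp add: conj_image_mult)
          also have "\<dots> \<subseteq> S" using l(2) by (auto simp: conj_action_def)
          finally have "conj_action G (l \<otimes> inv g) ` D \<in> \<A>"
            using lc g by (intro \<A>_image[OF D conj_action_in_mon]) auto
          moreover have "conj_action G l z \<in> ?Z"
            using conj_stabilizer_core_fixes[OF Zc l(1)[unfolded L_def]] g(2) by blast
          ultimately have "conj_action G l z \<in> conj_action G (l \<otimes> inv g) ` D" by blast
          then obtain d where d: "d \<in> D" "conj_action G l z = conj_action G (l \<otimes> inv g) d" by blast
          then have "conj_action G l z = conj_action G l (conj_action G (inv g) d)"
            using lc g Dc by (simp add: conj_action_mult)
          then have "z = conj_action G (inv g) d"
            using conj_action_inv_cancel(1)[OF lc, of z] conj_action_inv_cancel(1)[OF lc, of "conj_action G (inv g) d"]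
              g Zc d Dc[OF d(1)] by auto
          then have "c = d" using g d Dc[OF d(1)] by (simp add: conj_action_inv_cancel)
          then show "c \<in> D" using d by simp
        qed
      qed
      have "\<forall>A\<in>\<A>. A \<subseteq> L"
      proof (rule ccontr)
        assume "\<not> (\<forall>A\<in>\<A>. A \<subseteq> L)"
        then have ne: "{A \<in> \<A>. \<not> A \<subseteq> L} \<noteq> {}" by blast
        have finN: "finite {A \<in> \<A>. \<not> A \<subseteq> L}" using finite_\<A> by simp
        obtain A where A: "A \<in> \<A>" "\<not> A \<subseteq> L"
          and max: "\<And>A'. A' \<in> \<A> \<Longrightarrow> \<not> A' \<subseteq> L \<Longrightarrow> card (A' \<inter> B) \<le> card (A \<inter> B)"
        proof -
          let ?k = "\<lambda>A. card (A \<inter> B)"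
          have "Max (?k ` {A \<in> \<A>. \<not> A \<subseteq> L}) \<in> ?k ` {A \<in> \<A>. \<not> A \<subseteq> L}"
            using ne finN by (intro Max_in) auto
          then obtain A where A: "A \<in> \<A>" "\<not> A \<subseteq> L" "Max (?k ` {A \<in> \<A>. \<not> A \<subseteq> L}) = ?k A" by auto
          have "?k A' \<le> ?k A" if "A' \<in> \<A>" "\<not> A' \<subseteq> L" for A'
            unfolding A(3)[symmetric] using finN that by (intro Max_ge) auto
          then show ?thesis using that A by blast
        qed
        note AG = \<A>_subgroup[OF A(1)]
        obtain n where n: "card A = p ^ n" using \<A>_card[OF A(1)] by blast
        have WA: "W \<subseteq> A" using WZ A(1) by blast
        have nn: "\<not> (\<forall>b\<in>B. \<forall>a\<in>A. b \<otimes> a \<otimes> inv b \<in> A)" using quad A by blast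
        have AB: "a \<otimes> w \<otimes> inv a \<in> B" if "a \<in> A" "w \<in> B" for a w
          using normal.inv_op_closed2[OF B(1) subgroup.mem_carrier[OF AG that(1)] that(2)] .
        have BA: "u \<otimes> v \<otimes> inv u \<otimes> inv v \<in> A" if "u \<in> B" "v \<in> B" for u v
          using BW[OF that] WA by blast
        have BB: "u \<otimes> v \<otimes> inv u \<otimes> inv v \<otimes> w = w \<otimes> (u \<otimes> v \<otimes> inv u \<otimes> inv v)"
          if "u \<in> B" "v \<in> B" "w \<in> B" for u v w
          using Wcentral[OF BW[OF that(1,2)] that(3)] .
        obtain D where D: "subgroup D G" "\<forall>c\<in>D. \<forall>d\<in>D. c \<otimes> d = d \<otimes> c" "torsion_le G A D"
          "\<forall>T. subgroup T G \<longrightarrow> A \<subseteq> T \<longrightarrow> B \<subseteq> T \<longrightarrow> D \<subseteq> T"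
          "A \<inter> B \<subset> D \<inter> B" "\<forall>d\<in>D. \<forall>a\<in>A. d \<otimes> a \<otimes> inv d \<in> A"
          by (rule exE[OF glauberman_replacement[OF fin p AG n \<A>_comm[OF A(1)] BG m AB BA BB nn]]) blast+
        have "D \<subseteq> S" using D(4) S_subgroup \<A>_le[OF A(1)] BS by blast
        then have DA: "D \<in> \<A>" using \<A>_upward[OF A(1) D(1) _ _ D(3)] D(2) by blast
        have "finite (D \<inter> B)" using finite_subset[OF subgroup.subset[OF D(1)] fin] by simp
        then have "card (A \<inter> B) < card (D \<inter> B)" using D(5) by (rule psubset_card_mono)
        \<comment> \<open>Outside \<open>L\<close> the larger intersection of \<open>D\<close> with
          \<open>B\<close> would contradict the choice of \<open>A\<close>. So
          \<open>contains\<close> yields \<open>B \<subseteq> D\<close>, although \<open>D\<close>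
          normalises \<open>A\<close> and \<open>B\<close> does not.\<close>
        then have "D \<subseteq> L" using max[OF DA] by fastforce
        then have "B \<subseteq> D" by (rule contains[OF DA])
        then have "\<forall>b\<in>B. \<forall>a\<in>A. b \<otimes> a \<otimes> inv b \<in> A" using D(6) by blast
        then show False using nn by blast
      qed
      then have "B \<subseteq> Z" using contains by blast
      then have "?Z = B" by blast
      then show ?thesis using B(1) by simp
    qed
  qed
qed

lemma normal_Z_Int:
  assumes "B \<lhd> G" "p_group p (G\<lparr>carrier := B\<rparr>)"
  shows "Z \<inter> B \<lhd> G"
  using assms
proof (induction "card B" arbitrary: B rule: less_induct)
  case less
  show ?case
  proof (rule normal_Z_Int_step[OF less.prems])
    fix M assume M: "M \<lhd> G" "p_group p (G\<lparr>carrier := M\<rparr>)" "M \<subset> B"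
    have "finite B" using less.prems(2) by (simp add: p_group_carrier_iff)
    then have "card M < card B" using M(3) by (rule psubset_card_mono)
    then show "Z \<inter> M \<lhd> G" using less.hyps M by blast
  qed
qed

section \<open>Containment of \<open>Z\<close> in \<open>O_p(G)\<close> and invariance under
  automorphisms\<close>

text \<open>\<open>Z\<close> is abelian and normalised by \<open>Q = O_p(G)\<close>, so it acts
  quadratically on \<open>Q\<close> and lies in the preimage \<open>?K\<close> of
  \<open>O_p(G/C_G(Q))\<close>. Since \<open>C_G(Q) \<subseteq> Q\<close> is a
  \<open>p\<close>-group, \<open>?K\<close> is a normal \<open>p\<close>-subgroup and therefore
  contained in \<open>Q\<close>.\<close>

lemma Z_le_p_core: "Z \<subseteq> p_core p G"
proof
  fix x assume x: "x \<in> Z"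
  note Q = p_core_greatest[OF fin p(1)]
  define Q where "Q = p_core p G"
  note Q = Q[folded Q_def]
  note QG = normal_imp_subgroup[OF Q(1)]
  let ?C = "act_centralizer G (G\<lparr>carrier := Q\<rparr>) (conj_action G)"
  let ?K = "{g \<in> carrier G. ?C #> g \<in> p_core p (G Mod ?C)}"
  have C: "?C \<lhd> G" by (rule act_centralizer_conj_normal[OF Q(1)])
  note K = p_core_preimage[OF fin p(1) C]
  have "acts_quadratically G (G\<lparr>carrier := Q\<rparr>) (conj_action G) x"
  proof (rule acts_quadratically_of_abelian[OF Z_subgroup Z_comm Q(1) _ x])
    show "b \<otimes> a \<otimes> inv b \<in> Z" if a: "a \<in> Z" and b: "b \<in> Q" for a b
    proof -
      have "conj_action G b a \<in> Z" using Z_conj_S[of b] le_S[OF Q(1,2)] a b by blast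
      then show ?thesis by (simp add: conj_action_def)
    qed
  qed auto
  then have xK: "x \<in> ?K"
    using stable[OF Q(1,2)] Z_carrier[OF x] unfolding p_stable_action_def act_p_core_def by blast
  have "?C \<subseteq> Q"
  proof
    fix c assume c: "c \<in> ?C"
    then have cc: "c \<in> carrier G" by (simp add: act_centralizer_def)
    have "c \<otimes> w = w \<otimes> c" if w: "w \<in> Q" for w
    proof -
      have wc: "w \<in> carrier G" by (rule subgroup.mem_carrier[OF QG w])
      have "c \<otimes> w \<otimes> inv c = w" using c w by (simp add: act_centralizer_def conj_action_def)
      then have "c \<otimes> w \<otimes> inv c \<otimes> c = w \<otimes> c" by simp
      then show ?thesis using cc wc by (simp add: m_assoc)
    qed
    then have "c \<in> centralizer G Q" using cc by (simp add: centralizer_def)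
    then show "c \<in> Q" using constrained unfolding Q_def by blast
  qed
  then have "p_group p (G\<lparr>carrier := ?C\<rparr>)"
    by (rule p_group_subgroup[OF p(1) QG Q(2) normal_imp_subgroup[OF C]])
  then obtain i where i: "card ?C = p ^ i" by (auto simp: p_group_carrier_iff)
  obtain n where n: "card ?K = p ^ n * card ?C" using K(3) by blast
  have "card ?K = p ^ (n + i)" using n i by (simp add: power_add)
  then have "p_group p (G\<lparr>carrier := ?K\<rparr>)"
    using subgroup_imp_group[OF normal_imp_subgroup[OF K(1)]] fin
    by (intro p_group_carrier_iff[THEN iffD2] conjI exI) simp_all
  then show "x \<in> Q" using Q(3)[OF K(1)] xK by blast
qed

text \<open>\<open>Z = Z \<inter> O_p(G)\<close> is normal. An automorphism \<open>\<alpha>\<close>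
  moves \<open>S\<close> to another Sylow subgroup, which some \<open>l\<close> conjugates back to
  \<open>S\<close>; the composite preserves \<open>S\<close> and hence \<open>Z\<close>, and
  normality removes the conjugation.\<close>

theorem Z_characteristic: "characteristic_subgroup Z G"
  unfolding characteristic_subgroup_def
proof (intro conjI ballI Z_subgroup)
  have "Z \<inter> p_core p G = Z" using Z_le_p_core by blast
  then have normal: "Z \<lhd> G" using normal_Z_Int[OF p_core_greatest(1,2)[OF fin p(1)]] by simp
  fix \<alpha> assume \<alpha>: "\<alpha> \<in> iso G G"
  then have hom: "\<alpha> \<in> hom G G" and inj: "inj_on \<alpha> (carrier G)" by (auto simp: iso_def bij_betw_def)
  interpret \<alpha>: group_hom G G \<alpha> by unfold_locales (rule hom)
  have im: "subgroup (\<alpha> ` S) G" by (rule \<alpha>.subgroup_img_is_subgroup[OF S_subgroup])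
  have "card (\<alpha> ` S) = p ^ multiplicity p (order G)"
    using S card_image[OF inj_on_subset[OF inj subgroup.subset[OF S_subgroup]]]
    by (simp add: sylow_subgroup_def)
  then obtain l where l: "l \<in> carrier G" "\<forall>x\<in>\<alpha> ` S. l \<otimes> x \<otimes> inv l \<in> S"
    using ex_conj_into_sylow[OF fin p(1) S normal_self im subgroup.subset[OF im]] by blast
  have "conj_action G l \<circ> \<alpha> \<in> mon G G"
  proof -
    have c: "conj_action G l \<in> hom G G" "inj_on (conj_action G l) (carrier G)"
      using conj_action_in_mon[OF l(1)] by (simp_all add: mon_def)
    have "inj_on (conj_action G l) (\<alpha> ` carrier G)"
      using c(2) by (rule inj_on_subset) (use \<alpha>.hom_closed in blast)
    then show ?thesis using Group.hom_compose[OF hom c(1)] comp_inj_on[OF inj] by (simp add: mon_def)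
  qed
  then have "(conj_action G l \<circ> \<alpha>) ` Z = Z"
    using l by (intro Z_image) (auto simp: conj_action_def)
  then have "conj_action G l ` \<alpha> ` Z = Z" by (simp only: image_comp)
  moreover have "conj_action G l ` Z = Z"
  proof
    show "conj_action G l ` Z \<subseteq> Z" using normal.inv_op_closed2[OF normal l(1)] by (auto simp: conj_action_def)
    show "Z \<subseteq> conj_action G l ` Z"
    proof
      fix x assume x: "x \<in> Z"
      have "conj_action G (inv l) x \<in> Z"
        using normal.inv_op_closed1[OF normal l(1) x] l by (simp add: conj_action_def)
      then show "x \<in> conj_action G l ` Z"
        using conj_action_inv_cancel(2)[OF l(1) Z_carrier[OF x]] by (metis imageI)
    qed
  qed
  moreover have "\<alpha> ` Z \<subseteq> carrier G" "Z \<subseteq> carrier G" using Z_carrier \<alpha>.hom_closed by blast+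
  ultimately show "\<alpha> ` Z = Z" using conj_image_eq_iff[OF l(1)] by metis
qed

end

section \<open>The families of abelian subgroups\<close>

text \<open>Element orders are powers of \<open>p\<close>, so being at most \<open>p^i\<close> means
  dividing \<open>p^i\<close>; in an abelian group the solutions already form a subgroup and
  generation adds nothing.\<close>

lemma Omega_comm_group:
  assumes H: "comm_group H" and p: "Factorial_Ring.prime p" and card: "card (carrier H) = p ^ n"
  shows "Omega p i H = {x \<in> carrier H. x [^]\<^bsub>H\<^esub> (p ^ i) = \<one>\<^bsub>H\<^esub>}"
proof -
  interpret H: comm_group H by fact
  have "card (carrier H) > 0" using card p by (simp add: prime_gt_0_nat)
  then have fin: "finite (carrier H)" using card_gt_0_iff by blast
  let ?T = "{x \<in> carrier H. x [^]\<^bsub>H\<^esub> (p ^ i) = \<one>\<^bsub>H\<^esub>}"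
  have "H.ord x \<le> p ^ i \<longleftrightarrow> x [^]\<^bsub>H\<^esub> (p ^ i) = \<one>\<^bsub>H\<^esub>" if x: "x \<in> carrier H" for x
  proof -
    have "H.ord x dvd p ^ n" using H.ord_dvd_group_order[OF x] card by (simp add: order_def)
    then obtain j where j: "H.ord x = p ^ j" unfolding divides_primepow_nat[OF p] by blast
    have p1: "1 < p" using p by (rule prime_gt_1_nat)
    have "H.ord x \<le> p ^ i \<longleftrightarrow> H.ord x dvd p ^ i"
      unfolding j using p1 by (simp add: power_increasing_iff dvd_power_iff_le)
    then show ?thesis using H.pow_eq_id[OF x] by simp
  qed
  then have eq: "{x \<in> carrier H. H.ord x \<le> p ^ i} = ?T" by blast
  have "subgroup ?T H"
    by (rule H.subgroupI) (auto simp: H.nat_pow_distrib H.nat_pow_inv)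
  then have "generate H ?T = ?T"
    using H.generate_subgroup_incl[of ?T ?T] generate.incl[of _ ?T H] by blast
  then show ?thesis unfolding Omega_def eq .
qed

text \<open>At the first index where the sequences differ, the pointwise inequality is
  strict.\<close>

lemma lex_ge_of_pointwise:
  assumes "\<And>i. g i \<le> f i"
  shows "lex_ge f g"
proof (cases "f = g")
  case False
  then have "\<exists>i. f i \<noteq> g i" by blast
  define k where "k = (LEAST i. f i \<noteq> g i)"
  have "f k \<noteq> g k" unfolding k_def using \<open>\<exists>i. f i \<noteq> g i\<close> by (rule LeastI_ex)
  moreover have "f i = g i" if "i < k" for i using not_less_Least[OF that[unfolded k_def]] by simp
  ultimately have "less_fun g f"
    using assms[of k] by (intro less_funI exI[of _ k]) auto
  then show ?thesis by (simp add: lex_ge_def)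
qed (simp add: lex_ge_def)

lemma lex_ge_trans: "lex_ge f g \<Longrightarrow> lex_ge g h \<Longrightarrow> lex_ge f h"
  unfolding lex_ge_def using less_fun_trans by blast

section \<open>The rank of a finite abelian \<open>p\<close>-group\<close>

context comm_group
begin

text \<open>The products \<open>t x^i\<close> form a subgroup, and \<open>x^p \<in> T\<close> allows
  \<open>i\<close> to be reduced modulo \<open>p\<close>.\<close>

lemma ex_subgroup_insert:
  assumes fin: "finite (carrier G)" and p: "0 < p"
    and T: "subgroup T G" and x: "x \<in> carrier G" "x [^] (p::nat) \<in> T"
  shows "\<exists>T'. subgroup T' G \<and> insert x T \<subseteq> T' \<and> card T' \<le> p * card T"
proof -
  define T' where "T' = {t \<otimes> x [^] (i::nat) | t i. t \<in> T}"
  note Tc [simp] = subgroup.mem_carrier[OF T] and [simp] = subgroup.m_closed[OF T] subgroup.m_inv_closed[OF T]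
    and T1 [simp] = subgroup.one_closed[OF T] and x(1) [simp]
  have xp: "x [^] (p * i) \<in> T" for i
  proof (induction i)
    case (Suc i)
    then show ?case using x by (simp add: nat_pow_mult[symmetric])
  qed simp
  have T'I: "t \<otimes> x [^] (i::nat) \<in> T'" if "t \<in> T" for t i unfolding T'_def using that by blast
  have "subgroup T' G"
  proof (rule subgroupI)
    show "T' \<subseteq> carrier G" by (auto simp: T'_def)
    show "T' \<noteq> {}" using T'I[OF T1] by blast
    show "inv a \<in> T'" if a: "a \<in> T'" for a
    proof -
      obtain t i where t: "t \<in> T" "a = t \<otimes> x [^] (i::nat)" using a by (auto simp: T'_def)
      \<comment> \<open>Lets \<open>x^-i\<close> be rewritten as an element of \<open>T\<close>
        times a non-negative power of \<open>x\<close>.\<close>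
      have e: "p * i = i + (p - 1) * i" using p by (cases p) auto
      have "x [^] (p * i) = x [^] i \<otimes> x [^] ((p - 1) * i)" unfolding e by (simp add: nat_pow_mult)
      then have "inv (x [^] (p * i)) \<otimes> x [^] ((p - 1) * i) = inv (x [^] i)"
        by (simp add: inv_mult m_assoc)
      then have "inv a = (inv t \<otimes> inv (x [^] (p * i))) \<otimes> x [^] ((p - 1) * i)"
        using t by (simp add: inv_mult m_assoc)
      then show ?thesis using T'I[of "inv t \<otimes> inv (x [^] (p * i))"] t xp by simp
    qed
    show "a \<otimes> b \<in> T'" if ab: "a \<in> T'" "b \<in> T'" for a b
    proof -
      obtain t i where t: "t \<in> T" "a = t \<otimes> x [^] (i::nat)" using ab by (auto simp: T'_def)
      obtain s j where s: "s \<in> T" "b = s \<otimes> x [^] (j::nat)" using ab by (auto simp: T'_def)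
      have "a \<otimes> b = (t \<otimes> s) \<otimes> x [^] (i + j)" using t s by (simp add: nat_pow_mult[symmetric] m_ac)
      then show ?thesis using T'I[of "t \<otimes> s"] t s by simp
    qed
  qed
  moreover have "insert x T \<subseteq> T'"
  proof -
    have "x = \<one> \<otimes> x [^] (1::nat)" by simp
    then have "x \<in> T'" using T'I[OF T1, of 1] by simp
    moreover have "t \<in> T'" if "t \<in> T" for t using T'I[OF that, of 0] that by simp
    ultimately show ?thesis by blast
  qed
  moreover have "card T' \<le> p * card T"
  proof -
    have finT: "finite T" using finite_subset[OF subgroup.subset[OF T] fin] .
    have "T' \<subseteq> (\<lambda>(t, i). t \<otimes> x [^] i) ` (T \<times> {..<p})"
    proof
      fix a assume "a \<in> T'"
      then obtain t i where t: "t \<in> T" "a = t \<otimes> x [^] (i::nat)" by (auto simp: T'_def)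
      have "x [^] i = x [^] (p * (i div p)) \<otimes> x [^] (i mod p)" by (simp add: nat_pow_mult)
      then have "a = (t \<otimes> x [^] (p * (i div p))) \<otimes> x [^] (i mod p)" using t by (simp add: m_assoc)
      moreover have "t \<otimes> x [^] (p * (i div p)) \<in> T" using t xp by simp
      moreover have "i mod p < p" using p by simp
      ultimately show "a \<in> (\<lambda>(t, i). t \<otimes> x [^] i) ` (T \<times> {..<p})" by force
    qed
    then have "card T' \<le> card (T \<times> {..<p})" using finT by (intro surj_card_le) auto
    then show ?thesis by (simp add: card_cartesian_product mult.commute[of p])
  qed
  ultimately show ?thesis by blast
qed

text \<open>With \<open>P\<close> the subgroup of \<open>p\<close>-th powers, the kernel of the
  \<open>p\<close>-th power map has order \<open>|G/P|\<close>, and the minimal number of generators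
  of \<open>G\<close> is the dimension of \<open>G/P\<close> over the field with \<open>p\<close>
  elements. Both inequalities are obtained by counting subgroups above \<open>P\<close>.\<close>

lemma power_abelian_rank:
  assumes p: "Factorial_Ring.prime p" and ord: "card (carrier G) = p ^ n"
  shows "p ^ abelian_rank G = card {x \<in> carrier G. x [^] p = \<one>}"
proof (rule antisym)
  have p1: "1 < p" using p by (rule prime_gt_1_nat)
  have "card (carrier G) > 0" using ord p1 by simp
  then have fin: "finite (carrier G)" using card_gt_0_iff by blast
  let ?pow = "\<lambda>x. x [^] p"
  define P where "P = ?pow ` carrier G"
  have hom: "group_hom G G ?pow" by unfold_locales (auto simp: hom_def nat_pow_distrib)
  have PG: "subgroup P G" unfolding P_def by (rule group_hom.img_is_subgroup[OF hom])
  have Pc: "P \<subseteq> carrier G" by (rule subgroup.subset[OF PG])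
  have finP: "finite P" using finite_subset[OF Pc fin] .
  have P0: "0 < card P" using PG fin by (rule subgroup.finite_imp_card_positive)
  have cardP: "card P * card {x \<in> carrier G. x [^] p = \<one>} = card (carrier G)"
  proof -
    interpret pw: group_hom G "G\<lparr>carrier := P\<rparr>" ?pow
      by (intro group_hom.intro group_hom_axioms.intro is_group subgroup_imp_group[OF PG])
        (auto simp: hom_def nat_pow_distrib P_def)
    have "card (carrier (G Mod kernel G (G\<lparr>carrier := P\<rparr>) ?pow)) = card P"
      using pw.FactGroup_iso_set iso_same_card[of "G Mod kernel G (G\<lparr>carrier := P\<rparr>) ?pow" "G\<lparr>carrier := P\<rparr>"]
      by (auto simp: P_def is_iso_def)
    moreover have "card (rcosets (kernel G (G\<lparr>carrier := P\<rparr>) ?pow)) * card (kernel G (G\<lparr>carrier := P\<rparr>) ?pow) = order G"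
      by (rule lagrange[OF pw.subgroup_kernel])
    ultimately show ?thesis by (simp add: kernel_def FactGroup_def order_def)
  qed
  \<comment> \<open>The elements of \<open>B\<close> are adjoined to \<open>P\<close> one at a time.
    Their \<open>p\<close>-th powers are already in \<open>P\<close>, so each multiplies the order
    by at most \<open>p\<close>, and \<open>|G| \<le> p^|B| |P|\<close> follows.\<close>
  have upper: "card {x \<in> carrier G. x [^] p = \<one>} \<le> p ^ card B"
    if B: "B \<subseteq> carrier G" "generate G B = carrier G" for B
  proof -
    have "finite B" using finite_subset[OF B(1) fin] .
    then have "B \<subseteq> carrier G \<Longrightarrow> \<exists>T. subgroup T G \<and> P \<union> B \<subseteq> T \<and> card T \<le> p ^ card B * card P"
    proof (induction B rule: finite_induct)
      case empty
      then show ?case using PG by auto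
    next
      case (insert x B)
      then obtain T where T: "subgroup T G" "P \<union> B \<subseteq> T" "card T \<le> p ^ card B * card P" by auto
      have "x \<in> carrier G" "x [^] p \<in> T" using insert.prems T(2) by (auto simp: P_def)
      then obtain T' where T': "subgroup T' G" "insert x T \<subseteq> T'" "card T' \<le> p * card T"
        using ex_subgroup_insert[OF fin _ T(1), of p x] p1 by auto
      have "card T' \<le> p ^ card (insert x B) * card P"
        using order_trans[OF T'(3) mult_le_mono2[OF T(3), of p]] insert.hyps by (simp add: mult.assoc)
      then show ?case using T T' by blast
    qed
    then obtain T where T: "subgroup T G" "P \<union> B \<subseteq> T" "card T \<le> p ^ card B * card P" using B by blast
    have "carrier G \<subseteq> T" using generate_subgroup_incl[OF _ T(1), of B] T(2) B(2) by blast
    then have "T = carrier G" using subgroup.subset[OF T(1)] by blast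
    then have "card P * card {x \<in> carrier G. x [^] p = \<one>} \<le> card P * p ^ card B"
      using T(3) cardP by (simp add: mult.commute)
    then show ?thesis using P0 by simp
  qed
  have "\<exists>B. B \<subseteq> carrier G \<and> finite B \<and> card B = abelian_rank G \<and> generate G B = carrier G"
  proof -
    have "generate G (carrier G) = carrier G"
      using generate_incl[of "carrier G"] generate.incl[of _ "carrier G" G] by blast
    then have "\<exists>m. \<exists>B \<subseteq> carrier G. finite B \<and> card B = m \<and> generate G B = carrier G"
      using fin by blast
    then show ?thesis unfolding abelian_rank_def by (rule LeastI2_ex) blast
  qed
  then show "card {x \<in> carrier G. x [^] p = \<one>} \<le> p ^ abelian_rank G" using upper by metis
  \<comment> \<open>Each element of \<open>B\<close> contributes a full factor \<open>p\<close> over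
    \<open>P\<close>, that is, \<open>B\<close> is independent modulo \<open>P\<close>. A maximal
    such \<open>B\<close> generates \<open>G\<close> together with \<open>P\<close>, since any
    element outside could be added.\<close>
  let ?good = "\<lambda>B. B \<subseteq> carrier G \<and> p ^ card B * card P \<le> card (generate G (P \<union> B))"
  have finB: "finite B" if "?good B" for B using finite_subset[OF _ fin, of B] that by blast
  have "generate G P = P"
    using generate_subgroup_incl[OF order_refl PG] generate.incl[of _ P G] by blast
  then have "?good {}" by simp
  moreover have "finite {B. ?good B}" using fin by (auto intro: finite_subset[of _ "Pow (carrier G)"])
  ultimately obtain B where B: "?good B" and max: "\<And>B'. ?good B' \<Longrightarrow> B \<subseteq> B' \<Longrightarrow> B = B'"
    using finite_has_maximal2[of "{B. ?good B}" "{}"] by auto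
  let ?T = "generate G (P \<union> B)"
  have PB: "P \<union> B \<subseteq> carrier G" using B Pc by blast
  have T: "subgroup ?T G" by (rule generate_is_subgroup[OF PB])
  have T_eq: "?T = carrier G"
  proof (rule ccontr)
    assume "?T \<noteq> carrier G"
    then obtain x where x: "x \<in> carrier G" "x \<notin> ?T" using subgroup.subset[OF T] by blast
    let ?T' = "generate G (P \<union> insert x B)"
    have T': "subgroup ?T' G" using PB x by (intro generate_is_subgroup) auto
    have le: "?T \<subseteq> ?T'" by (rule mono_generate) blast
    have xT': "x \<in> ?T'" by (rule generate.incl) blast
    have finT': "finite ?T'" using finite_subset[OF subgroup.subset[OF T'] fin] .
    obtain k where k: "card ?T' = card ?T * k" using card_subgroups_dvd[OF T T' le] by blast
    have "card ?T' dvd p ^ n"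
      using card_subgroups_dvd[OF T' subgroup_self subgroup.subset[OF T']] ord by simp
    then have "k dvd p ^ n" unfolding k by (rule dvd_mult_right)
    then obtain i where i: "k = p ^ i" unfolding divides_primepow_nat[OF p] by blast
    have "card ?T < card ?T'" using le x xT' finT' by (intro psubset_card_mono) auto
    then have "i \<noteq> 0" using k i by (cases i) auto
    then have "p \<le> k" unfolding i using p1 by (simp add: self_le_power)
    then have "p * card ?T \<le> card ?T'" unfolding k by simp
    moreover have xB: "x \<notin> B" using x generate.incl[of x "P \<union> B" G] by blast
    moreover have "p * (p ^ card B * card P) \<le> p * card ?T" using B by (intro mult_le_mono2) blast
    ultimately have "p * (p ^ card B * card P) \<le> card ?T'" by (meson order_trans)
    then have "p ^ card (insert x B) * card P \<le> card ?T'"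
      using finB[OF B] xB by (simp add: mult.assoc)
    then have "?good (insert x B)" using B x by blast
    then have "B = insert x B" by (rule max) blast
    then show False using xB by blast
  qed
  let ?U = "generate G B"
  have U: "subgroup ?U G" using B by (intro generate_is_subgroup) auto
  have prod: "\<exists>u\<in>?U. \<exists>y\<in>carrier G. x = u \<otimes> y [^] p" if x: "x \<in> carrier G" for x
  proof -
    have "subgroup (P <#> ?U) G"
      using mult_subgroups[OF PG U] by simp
    moreover have "P \<union> B \<subseteq> P <#> ?U"
    proof -
      have "y \<in> P <#> ?U" if "y \<in> P" for y
        using that Pc subgroup.one_closed[OF U] unfolding set_mult_def by force
      moreover have "y \<in> P <#> ?U" if "y \<in> B" for y
        using that B generate.incl[OF that, of G] subgroup.one_closed[OF PG] unfolding set_mult_def by force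
      ultimately show ?thesis by blast
    qed
    ultimately have "x \<in> P <#> ?U" using generate_subgroup_incl T_eq x by blast
    then obtain y u where "y \<in> carrier G" "u \<in> ?U" "x = y [^] p \<otimes> u"
      unfolding set_mult_def P_def by blast
    then show ?thesis using m_comm[of "y [^] p" u] subgroup.mem_carrier[OF U] by auto
  qed
  \<comment> \<open>Iterating \<open>prod\<close> replaces \<open>p\<close>-th powers by
    \<open>p^k\<close>-th powers; for \<open>k = n\<close> these are trivial, so \<open>B\<close>
    alone generates \<open>G\<close>.\<close>
  have "\<exists>u\<in>?U. \<exists>y\<in>carrier G. x = u \<otimes> y [^] (p ^ k)" if x: "x \<in> carrier G" for x and k :: nat
  proof (induction k)
    case 0
    then show ?case using x subgroup.one_closed[OF U] by (intro bexI[of _ \<one>] bexI[of _ x]) auto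
  next
    case (Suc k)
    then obtain u y where u: "u \<in> ?U" "y \<in> carrier G" "x = u \<otimes> y [^] (p ^ k)" by blast
    obtain v w where v: "v \<in> ?U" "w \<in> carrier G" "y = v \<otimes> w [^] p" using prod[OF u(2)] by blast
    note Uc [simp] = subgroup.mem_carrier[OF U]
    have vU: "v [^] j \<in> ?U" for j :: nat
      using v(1) subgroup.m_closed[OF U] subgroup.one_closed[OF U] by (induction j) auto
    have "x = (u \<otimes> v [^] (p ^ k)) \<otimes> w [^] (p ^ Suc k)"
      using u v by (simp add: nat_pow_distrib nat_pow_pow m_assoc)
    moreover have "u \<otimes> v [^] (p ^ k) \<in> ?U" using u(1) vU subgroup.m_closed[OF U] by blast
    ultimately show ?case using v(2) by blast
  qed
  moreover have "y [^] (p ^ n) = \<one>" if "y \<in> carrier G" for y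
    using pow_order_eq_1[OF that] ord by (simp add: order_def)
  ultimately have "carrier G \<subseteq> ?U" using subgroup.mem_carrier[OF U] by (metis r_one subsetI)
  then have "?U = carrier G" using subgroup.subset[OF U] by blast
  then have "abelian_rank G \<le> card B"
    unfolding abelian_rank_def using B finB[OF B] by (intro Least_le) blast
  then have "p ^ abelian_rank G \<le> p ^ card B" using p1 by (simp add: power_increasing)
  moreover have "p ^ card B * card P \<le> card {x \<in> carrier G. x [^] p = \<one>} * card P"
    using B T_eq cardP by (simp add: mult.commute)
  ultimately show "p ^ abelian_rank G \<le> card {x \<in> carrier G. x [^] p = \<one>}" using P0 by simp
qed

end

section \<open>Transport of an upward closed family along an embedding of \<open>S\<close>\<close>

lemma abelian_subgroups_iff:
  assumes "group S"
  shows "A \<in> abelian_subgroups S \<longleftrightarrow> subgroup A S \<and> (\<forall>a\<in>A. \<forall>b\<in>A. a \<otimes>\<^bsub>S\<^esub> b = b \<otimes>\<^bsub>S\<^esub> a)"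
proof -
  interpret group S by fact
  show ?thesis
  proof
    assume "A \<in> abelian_subgroups S"
    then have A: "subgroup A S" "comm_group (S\<lparr>carrier := A\<rparr>)" by (simp_all add: abelian_subgroups_def)
    then interpret A: comm_group "S\<lparr>carrier := A\<rparr>" by simp
    show "subgroup A S \<and> (\<forall>a\<in>A. \<forall>b\<in>A. a \<otimes>\<^bsub>S\<^esub> b = b \<otimes>\<^bsub>S\<^esub> a)" using A(1) A.m_comm by simp
  next
    assume A: "subgroup A S \<and> (\<forall>a\<in>A. \<forall>b\<in>A. a \<otimes>\<^bsub>S\<^esub> b = b \<otimes>\<^bsub>S\<^esub> a)"
    then have "comm_group (S\<lparr>carrier := A\<rparr>)"
      by (intro group.group_comm_groupI subgroup_imp_group) auto
    then show "A \<in> abelian_subgroups S" using A by (simp add: abelian_subgroups_def)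
  qed
qed

text \<open>The images of the members of \<open>\<A>\<close> under \<open>\<phi>\<close> form a
  family in \<open>G\<close> as required by \<open>p_stable_group\<close>. For an empty family the
  intersection is trivial by convention, and so characteristic.\<close>

lemma glauberman_property_of_upward_closed:
  assumes p: "Factorial_Ring.prime p" "odd p" and S: "p_group p S"
    and le: "\<A> \<subseteq> abelian_subgroups S"
    and up: "\<And>A D. A \<in> \<A> \<Longrightarrow> D \<in> abelian_subgroups S \<Longrightarrow> torsion_le S A D \<Longrightarrow> D \<in> \<A>"
  shows "glauberman_property TYPE('g) p S (family_inter S \<A>)"
proof -
  have gS: "group S" using S by (simp add: p_group_def)
  interpret S: group S by (rule gS)
  have \<A>D: "subgroup A S" "\<And>a b. a \<in> A \<Longrightarrow> b \<in> A \<Longrightarrow> a \<otimes>\<^bsub>S\<^esub> b = b \<otimes>\<^bsub>S\<^esub> a" if "A \<in> \<A>" for A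
    using that le abelian_subgroups_iff[OF gS, of A] by blast+
  have \<A>c: "A \<subseteq> carrier S" if "A \<in> \<A>" for A by (rule subgroup.subset[OF \<A>D(1)[OF that]])
  have "subgroup (family_inter S \<A>) S"
    using S.subgroups_Inter[of \<A>] \<A>D(1) S.triv_subgroup by (auto simp: family_inter_def)
  moreover have "characteristic_subgroup (\<phi> ` family_inter S \<A>) G"
    if G: "group G" "finite (carrier G)" and \<phi>: "\<phi> \<in> mon S G"
      and syl: "sylow_subgroup p (\<phi> ` carrier S) G"
      and con: "centralizer G (p_core p G) \<subseteq> p_core p G"
      and stab: "\<forall>P. P \<lhd> G \<and> p_group p (G\<lparr>carrier := P\<rparr>) \<longrightarrow>
             p_stable_action p G (G\<lparr>carrier := P\<rparr>) (conj_action G)"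
    for G :: "'g monoid" and \<phi>
  proof -
    interpret G: group G by (rule G(1))
    have hom: "\<phi> \<in> hom S G" and inj: "inj_on \<phi> (carrier S)" using \<phi> by (auto simp: mon_def)
    interpret \<phi>: group_hom S G \<phi> by unfold_locales (rule hom)
    show ?thesis
    proof (cases "\<A> = {}")
      case True
      have "f \<one>\<^bsub>G\<^esub> = \<one>\<^bsub>G\<^esub>" if "f \<in> iso G G" for f
        using hom_one[of f G G] that G(1) by (simp add: iso_def)
      then show ?thesis
        using True G.triv_subgroup by (simp add: family_inter_def characteristic_subgroup_def)
    next
      case False
      interpret p_stable_group G p "\<phi> ` carrier S" "(\<lambda>A. \<phi> ` A) ` \<A>"
      proof (intro p_stable_group.intro p_stable_group_axioms.intro)
        show "(\<lambda>A. \<phi> ` A) ` \<A> \<noteq> {}" using False by simp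
        show "subgroup A G" if "A \<in> (\<lambda>A. \<phi> ` A) ` \<A>" for A
          using that \<A>D(1) \<phi>.subgroup_img_is_subgroup by blast
        show "A \<subseteq> \<phi> ` carrier S" if "A \<in> (\<lambda>A. \<phi> ` A) ` \<A>" for A
          using that \<A>c by blast
        show "a \<otimes>\<^bsub>G\<^esub> b = b \<otimes>\<^bsub>G\<^esub> a" if A: "A \<in> (\<lambda>A. \<phi> ` A) ` \<A>" and ab: "a \<in> A" "b \<in> A" for A a b
        proof -
          obtain A' where A': "A' \<in> \<A>" "A = \<phi> ` A'" using A by blast
          then obtain x y where xy: "x \<in> A'" "y \<in> A'" "a = \<phi> x" "b = \<phi> y" using ab by blast
          have "\<phi> (x \<otimes>\<^bsub>S\<^esub> y) = \<phi> (y \<otimes>\<^bsub>S\<^esub> x)" using \<A>D(2)[OF A'(1)] xy by simp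
          then show ?thesis using xy \<A>c[OF A'(1)] by (simp add: subset_iff)
        qed
        show "D \<in> (\<lambda>A. \<phi> ` A) ` \<A>"
          if A: "A \<in> (\<lambda>A. \<phi> ` A) ` \<A>" and D: "subgroup D G" "D \<subseteq> \<phi> ` carrier S"
            and comm: "\<And>a b. a \<in> D \<Longrightarrow> b \<in> D \<Longrightarrow> a \<otimes>\<^bsub>G\<^esub> b = b \<otimes>\<^bsub>G\<^esub> a"
            and tor: "torsion_le G A D" for A D
        proof -
          obtain A' where A': "A' \<in> \<A>" "A = \<phi> ` A'" using A by blast
          \<comment> \<open>The closure condition in \<open>G\<close> is checked in
            \<open>S\<close>, on the preimage of \<open>D\<close>; the injective
            \<open>\<phi>\<close> preserves the torsion counts.\<close>
          define D' where "D' = {x \<in> carrier S. \<phi> x \<in> D}"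
          have D'c: "D' \<subseteq> carrier S" by (auto simp: D'_def)
          have im: "\<phi> ` D' = D" using D(2) by (auto simp: D'_def)
          have "subgroup D' S"
          proof (rule S.subgroupI)
            have "\<one>\<^bsub>S\<^esub> \<in> D'" using subgroup.one_closed[OF D(1)] by (simp add: D'_def)
            then show "D' \<noteq> {}" by blast
          qed (auto simp: D'_def subgroup.m_closed[OF D(1)] subgroup.m_inv_closed[OF D(1)])
          moreover have "x \<otimes>\<^bsub>S\<^esub> y = y \<otimes>\<^bsub>S\<^esub> x" if "x \<in> D'" "y \<in> D'" for x y
          proof (rule inj_onD[OF inj])
            show "\<phi> (x \<otimes>\<^bsub>S\<^esub> y) = \<phi> (y \<otimes>\<^bsub>S\<^esub> x)" using that comm by (simp add: D'_def)
          qed (use that D'c in auto)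
          ultimately have "D' \<in> abelian_subgroups S" by (simp add: abelian_subgroups_iff[OF gS])
          moreover have "torsion_le S A' D'"
            using tor torsion_le_image[OF gS G(1) hom inj D'c] torsion_le_image[OF gS G(1) hom inj \<A>c[OF A'(1)]]
            unfolding A'(2) torsion_le_def im by simp
          ultimately have "D' \<in> \<A>" by (rule up[OF A'(1)])
          then show ?thesis using im by blast
        qed
      qed (use p G syl con stab in auto)
      \<comment> \<open>Image and intersection commute because \<open>\<phi>\<close> is injective
        and the family is non-empty.\<close>
      have "\<phi> ` \<Inter>\<A> = \<Inter>((\<lambda>A. \<phi> ` A) ` \<A>)"
      proof -
        obtain A where "A \<in> \<A>" using False by blast
        then show ?thesis using image_INT[OF inj, of \<A> "\<lambda>A. A" A] \<A>c by simp
      qed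
      then show ?thesis using Z_characteristic False by (simp add: family_inter_def)
    qed
  qed
  ultimately show ?thesis unfolding glauberman_property_def by blast
qed

section \<open>Monotonicity of the invariants and upward closure of the six families\<close>

locale abelian_p_subgroups =
  fixes p :: nat and S :: "('a, 'm) monoid_scheme" (structure)
  assumes p: "Factorial_Ring.prime p" and S: "p_group p S"
begin

sublocale group S
  using S by (simp add: p_group_def)

lemma fin: "finite (carrier S)"
  using S by (simp add: p_group_def)

lemma abelianD:
  assumes "A \<in> abelian_subgroups S"
  shows "subgroup A S" "comm_group (S\<lparr>carrier := A\<rparr>)" "finite A" "\<exists>n. card A = p ^ n"
proof -
  show A: "subgroup A S" "comm_group (S\<lparr>carrier := A\<rparr>)" using assms by (simp_all add: abelian_subgroups_def)
  show "finite A" using finite_subset[OF subgroup.subset[OF A(1)] fin] .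
  obtain n where "order S = p ^ n" using S by (auto simp: p_group_def)
  then have "card A dvd p ^ n" using lagrange[OF A(1)] by (metis dvd_triv_right)
  then show "\<exists>n. card A = p ^ n" unfolding divides_primepow_nat[OF p] by blast
qed

lemma finite_abelian_subgroups: "finite (abelian_subgroups S)"
  using fin subgroup.subset by (auto simp: abelian_subgroups_def intro!: finite_subset[of _ "Pow (carrier S)"])

lemma pow_subgroup: "x [^]\<^bsub>S\<lparr>carrier := A\<rparr>\<^esub> (n::nat) = x [^] n"
  by (simp add: nat_pow_consistent[symmetric])

text \<open>Position \<open>i\<close> of the sequence refers to \<open>Omega\<close> with index
  \<open>Suc i\<close>, so the comparison of torsion counts is used at
  \<open>n = p^(i+1)\<close>.\<close>

lemma omega_seq_le:
  assumes A: "A \<in> abelian_subgroups S" and D: "D \<in> abelian_subgroups S" and le: "torsion_le S A D"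
  shows "omega_seq p (S\<lparr>carrier := A\<rparr>) i \<le> omega_seq p (S\<lparr>carrier := D\<rparr>) i"
proof -
  have "card (Omega p (Suc i) (S\<lparr>carrier := B\<rparr>)) = card {x \<in> B. x [^] (p ^ Suc i) = \<one>}"
    if B: "B \<in> abelian_subgroups S" for B
  proof -
    obtain n where "card B = p ^ n" using abelianD(4)[OF B] by blast
    then show ?thesis
      using Omega_comm_group[OF abelianD(2)[OF B] p, of n "Suc i"] by (simp add: pow_subgroup del: power_Suc)
  qed
  then show ?thesis using A D le by (simp add: omega_seq_def torsion_le_def del: power_Suc)
qed

lemma lex_ge_of_torsion_le:
  "A \<in> abelian_subgroups S \<Longrightarrow> D \<in> abelian_subgroups S \<Longrightarrow> torsion_le S A D \<Longrightarrow>
   lex_ge (omega_seq p (S\<lparr>carrier := D\<rparr>)) (omega_seq p (S\<lparr>carrier := A\<rparr>))"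
  by (intro lex_ge_of_pointwise omega_seq_le)

text \<open>If \<open>n\<close> kills \<open>A\<close>, its count is \<open>card A = card D\<close>,
  which leaves no element of \<open>D\<close> uncounted.\<close>

lemma torsion_le_kills:
  assumes D: "finite D" and le: "torsion_le S A D" and A: "\<forall>x\<in>A. x [^] n = \<one>" and x: "x \<in> D"
  shows "x [^] (n::nat) = \<one>"
proof -
  have "{x \<in> A. x [^] n = \<one>} = A" using A by blast
  moreover have "card A = card D" "card {x \<in> A. x [^] n = \<one>} \<le> card {x \<in> D. x [^] n = \<one>}"
    using le by (simp_all add: torsion_le_def)
  ultimately have "card D \<le> card {x \<in> D. x [^] n = \<one>}" by simp
  then have "{x \<in> D. x [^] n = \<one>} = D" using D by (intro card_seteq) auto
  then show ?thesis using x by blast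
qed

lemma exponent_le:
  assumes A: "A \<in> abelian_subgroups S" and D: "D \<in> abelian_subgroups S" and le: "torsion_le S A D"
  shows "group_exponent (S\<lparr>carrier := D\<rparr>) \<le> group_exponent (S\<lparr>carrier := A\<rparr>)"
proof -
  let ?e = "\<lambda>B n. 0 < n \<and> (\<forall>x \<in> B. x [^] (n::nat) = \<one>)"
  have ex: "group_exponent (S\<lparr>carrier := B\<rparr>) = (LEAST n. ?e B n)" for B
    by (simp add: group_exponent_def pow_subgroup)
  \<comment> \<open>A witness, so that the \<open>LEAST\<close> defining the exponent is
    attained.\<close>
  have "?e A (order S)"
    using pow_order_eq_1 subgroup.mem_carrier[OF abelianD(1)[OF A]] fin order_gt_0_iff_finite by simp
  then have "?e A (LEAST n. ?e A n)" by (rule LeastI)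
  then have "?e D (LEAST n. ?e A n)"
    using torsion_le_kills[OF abelianD(3)[OF D] le] by blast
  then show ?thesis unfolding ex by (rule Least_le)
qed

lemma p_rank_subgroup:
  assumes "A \<in> abelian_subgroups S"
  shows "p_group_rank (S\<lparr>carrier := A\<rparr>) = abelian_rank (S\<lparr>carrier := A\<rparr>)"
  using abelianD(2)[OF assms] by (simp add: p_group_rank_def)

text \<open>The rank is the logarithm to base \<open>p\<close> of the number of solutions of
  \<open>x^p = 1\<close>. Comparing these counts alone covers both \<open>torsion_le\<close> and
  inclusion in an abelian \<open>S\<close>.\<close>

lemma abelian_rank_mono:
  assumes A: "A \<in> abelian_subgroups S" and D: "D \<in> abelian_subgroups S"
    and le: "card {x \<in> A. x [^] p = \<one>} \<le> card {x \<in> D. x [^] p = \<one>}"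
  shows "abelian_rank (S\<lparr>carrier := A\<rparr>) \<le> abelian_rank (S\<lparr>carrier := D\<rparr>)"
proof -
  have "p ^ abelian_rank (S\<lparr>carrier := B\<rparr>) = card {x \<in> B. x [^] p = \<one>}"
    if B: "B \<in> abelian_subgroups S" for B
  proof -
    obtain n where "card B = p ^ n" using abelianD(4)[OF B] by blast
    then show ?thesis
      using comm_group.power_abelian_rank[OF abelianD(2)[OF B] p, of n] by (simp add: pow_subgroup)
  qed
  then have "p ^ abelian_rank (S\<lparr>carrier := A\<rparr>) \<le> p ^ abelian_rank (S\<lparr>carrier := D\<rparr>)"
    using A D le by simp
  then show ?thesis using prime_gt_1_nat[OF p] by (simp add: power_increasing_iff)
qed

lemma abelian_rank_le_p_rank:
  assumes D: "D \<in> abelian_subgroups S"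
  shows "abelian_rank (S\<lparr>carrier := D\<rparr>) \<le> p_group_rank S"
proof (cases "comm_group S")
  case True
  then have "carrier S \<in> abelian_subgroups S" using subgroup_self by (simp add: abelian_subgroups_def)
  then have "abelian_rank (S\<lparr>carrier := D\<rparr>) \<le> abelian_rank (S\<lparr>carrier := carrier S\<rparr>)"
    using fin subgroup.subset[OF abelianD(1)[OF D]]
    by (intro abelian_rank_mono[OF D] card_mono) auto
  then show ?thesis using True by (simp add: p_group_rank_def)
next
  case False
  then show ?thesis using finite_abelian_subgroups D by (simp add: p_group_rank_def)
qed

lemma A_o_upward:
  "A \<in> A_o S \<Longrightarrow> D \<in> abelian_subgroups S \<Longrightarrow> torsion_le S A D \<Longrightarrow> D \<in> A_o S"
  by (simp add: A_o_def torsion_le_def)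

text \<open>The rank can only grow from \<open>A\<close> to \<open>D\<close>, and on
  \<open>A\<close> it already has the maximal value.\<close>

lemma A_r_upward:
  assumes A: "A \<in> A_r S" and D: "D \<in> abelian_subgroups S" and le: "torsion_le S A D"
  shows "D \<in> A_r S"
proof -
  have A': "A \<in> abelian_subgroups S" "p_group_rank (S\<lparr>carrier := A\<rparr>) = p_group_rank S"
    using A by (simp_all add: A_r_def)
  have "abelian_rank (S\<lparr>carrier := A\<rparr>) \<le> abelian_rank (S\<lparr>carrier := D\<rparr>)"
    using le by (intro abelian_rank_mono[OF A'(1) D]) (simp add: torsion_le_def)
  then show ?thesis
    using A' abelian_rank_le_p_rank[OF D] D by (simp add: A_r_def p_rank_subgroup)
qed

lemma A_e_upward:
  assumes A: "A \<in> A_e p S" and D: "D \<in> abelian_subgroups S" and le: "torsion_le S A D"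
  shows "D \<in> A_e p S"
proof -
  have "A \<in> A_r S" and el: "\<forall>x\<in>A. x [^] p = \<one>"
    using A by (simp_all add: A_e_def elementary_abelian_def pow_subgroup)
  then have "D \<in> A_r S" using A_r_upward D le by blast
  moreover have "\<forall>x\<in>D. x [^] p = \<one>" using torsion_le_kills[OF abelianD(3)[OF D] le el] by blast
  moreover have "p_group p (S\<lparr>carrier := D\<rparr>)"
    using abelianD[OF D] subgroup_imp_group by (simp add: p_group_carrier_iff)
  ultimately show ?thesis
    using abelianD(2)[OF D] by (simp add: A_e_def elementary_abelian_def pow_subgroup)
qed

lemma A_lex_upward:
  "A \<in> A_lex p S \<Longrightarrow> D \<in> abelian_subgroups S \<Longrightarrow> torsion_le S A D \<Longrightarrow> D \<in> A_lex p S"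
  unfolding A_lex_def using lex_ge_of_torsion_le lex_ge_trans by blast

lemma A_olex_upward:
  assumes A: "A \<in> A_olex p S" and D: "D \<in> abelian_subgroups S" and le: "torsion_le S A D"
  shows "D \<in> A_olex p S"
proof -
  have "A \<in> A_o S" "A \<in> abelian_subgroups S" using A by (simp_all add: A_olex_def A_o_def)
  then show ?thesis
    using A A_o_upward[OF _ D le] lex_ge_trans[OF lex_ge_of_torsion_le[OF _ D le]]
    by (simp add: A_olex_def)
qed

lemma A_OEz_upward:
  assumes A: "A \<in> A_OEz p ord_exp exp_bound \<zeta> S" and D: "D \<in> abelian_subgroups S" and le: "torsion_le S A D"
  shows "D \<in> A_OEz p ord_exp exp_bound \<zeta> S"
proof -
  have A': "A \<in> abelian_subgroups S" using A by (simp add: A_OEz_def)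
  have "real (group_exponent (S\<lparr>carrier := D\<rparr>)) \<le> real (group_exponent (S\<lparr>carrier := A\<rparr>))"
    using exponent_le[OF A' D le] by simp
  then show ?thesis
    using A D le lex_ge_trans[OF lex_ge_of_torsion_le[OF A' D le]]
    by (simp add: A_OEz_def torsion_le_def)
qed

end

theorem corollary1p5:
  fixes p :: nat and S :: "'a monoid"
    and ord_exp exp_bound :: int and \<zeta> :: "nat \<Rightarrow> int"
  assumes "Factorial_Ring.prime p" and "odd p" and "p_group p S"
  shows "glauberman_property TYPE('g) p S (I_o S) \<and>
         glauberman_property TYPE('g) p S (I_r S) \<and>
         glauberman_property TYPE('g) p S (I_e p S) \<and>
         glauberman_property TYPE('g) p S (I_lex p S) \<and>
         glauberman_property TYPE('g) p S (I_olex p S) \<and>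
         glauberman_property TYPE('g) p S (I_OEz p ord_exp exp_bound \<zeta> S)"
proof -
  interpret abelian_p_subgroups p S using assms by unfold_locales
  note glauberman = glauberman_property_of_upward_closed[OF assms]
  show ?thesis
    unfolding I_o_def I_r_def I_e_def I_lex_def I_olex_def I_OEz_def
  proof (intro conjI glauberman)
    show "A_o S \<subseteq> abelian_subgroups S" "A_r S \<subseteq> abelian_subgroups S" "A_e p S \<subseteq> abelian_subgroups S"
      "A_lex p S \<subseteq> abelian_subgroups S" "A_olex p S \<subseteq> abelian_subgroups S"
      "A_OEz p ord_exp exp_bound \<zeta> S \<subseteq> abelian_subgroups S"
      by (auto simp: A_o_def A_r_def A_e_def A_lex_def A_olex_def A_OEz_def)
  qed (fact A_o_upward A_r_upward A_e_upward A_lex_upward A_olex_upward A_OEz_upward)+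
qed

end
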